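(* Let $\overrightarrow{G}$ be a cyclic graph with underlying undirected graph $G$. Then $$\mathrm{Cl}(G)\simeq\begin{cases} S^{2l+1} & \text{if } \frac{l}{2l+1}<\mathrm{wf}(\overrightarrow{G})<\frac{l+1}{2l+3} \text{ for some } l=0,1,\ldots,\\ \bigvee^{n-2k-1}S^{2l} & \text{if } \mathrm{wf}(\overrightarrow{G})=\frac{l}{2l+1} \text{ and } \overrightarrow{G} \text{ dismantles to } \overrightarrow{C_n^k},\end{cases}$$ where an empty wedge sum means a point.
   Context: A directed graph is a finite pair $(V,E)$ with $E\subseteq V\times V$, no loops $(v,v)$, and never both $(v,w)$ and $(w,v)$ in $E$; write $v\to w$ for $(v,w)\in E$. A directed cycle is a sequence $v_1,\dots,v_s$ with $v_i\to v_{i+1}$ for all $i$ (indices mod $s$). A directed graph is cyclic if its vertices can be listed as $v_0,\dots,v_{n-1}$ (a cyclic order, indices taken mod $n$) so that whenever $v_i\to v_j$, either $j=i+1$ or both $v_i\to v_{j-1}$ and $v_{i+1}\to v_j$. A cyclic order on a finite set $S$, $|S|=n$, is a bijection $S\to\{0,\dots,n-1\}$, written $x_0\prec\cdots\prec x_{n-1}$; for three elements, $x_i\prec x_j\prec x_k$ means $i<j<k$ or $k<i<j$ or $j<k<i$. A subinterval of it is $\emptyset$, a set $\{x_i,\dots,x_j\}$ with $i\le j$, or a set $\{x_j,\dots,x_{n-1},x_0,\dots,x_i\}$ with $i<j$. A map $f:S\to T$ between cyclically ordered sets is cyclic monotone if every fibre $f^{-1}(t)$ is a subinterval and $f(s)\prec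 f(s')\prec f(s'')$ implies $s\prec s'\prec s''$. A homomorphism of directed graphs is a vertex map $f$ with $f(v)=f(w)$ or $f(v)\to f(w)$ for each edge $v\to w$. A cyclic homomorphism between cyclic graphs is a cyclic monotone homomorphism that is non-constant whenever the source has a directed cycle. For integers $0\le k<n/2$, $\overrightarrow{C_n^k}$ is the directed graph on $\{0,\dots,n-1\}$ with $i\to j$ iff $0<(j-i)\bmod n\le k$ (a cyclic graph with the natural order). The winding fraction is $\mathrm{wf}(\overrightarrow{G})=\sup\{k/n:\text{there is a cyclic homomorphism }\overrightarrow{C_n^k}\to\overrightarrow{G}\}$. For a vertex $v$, $N^-(\overrightarrow G,v)=\{w:w\to v\}$ and $N^-[\overrightarrow G,v]=N^-(\overrightarrow G,v)\cup\{v\}$. In a cyclic graph with order $v_0\prec\cdots\prec v_{n-1}$, $v_i$ is dominated (by $v_{i+1}$) if $N^-(\overrightarrow G,v_{i+1})=N^-[\overrightarrow G,v_i]$. $\overrightarrow G$ dismantles to an induced subgraph $\overrightarrow H$ if $\overrightarrow H$ is obtained by successively deleting dominated vertices (each intermediate graph carries the induced cyclic order). $G$ is the underlying undirected graph and $\mathrm{Cl}(G)$ its clique complex (faces are the vertex sets of complete subgraphs). *)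

theory Defs
  imports "HOL-Analysis.Analysis"
begin

text \<open>A finite cyclically ordered set is represented by a distinct list vs:
  the element vs!i has position i, i.e. vs!0, ..., vs!(n-1) is the cyclic order.\<close>

definition digraph :: "'a set \<Rightarrow> ('a \<Rightarrow> 'a \<Rightarrow> bool) \<Rightarrow> bool" where
  "digraph V E \<longleftrightarrow> finite V \<and> (\<forall>v w. E v w \<longrightarrow> v \<in> V \<and> w \<in> V)
     \<and> (\<forall>v. \<not> E v v) \<and> (\<forall>v w. \<not> (E v w \<and> E w v))"

definition cyclic_graph :: "'a list \<Rightarrow> ('a \<Rightarrow> 'a \<Rightarrow> bool) \<Rightarrow> bool" where
  "cyclic_graph vs E \<longleftrightarrow> distinct vs \<and> digraph (set vs) E \<and>
     (let n = length vs in \<forall>i<n. \<forall>j<n. E (vs!i) (vs!j) \<longrightarrow>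
        j = (i+1) mod n \<or>
        (E (vs!i) (vs!((j+n-1) mod n)) \<and> E (vs!((i+1) mod n)) (vs!j)))"

definition cbetw :: "nat \<Rightarrow> nat \<Rightarrow> nat \<Rightarrow> bool" where
  "cbetw i j k \<longleftrightarrow> (i < j \<and> j < k) \<or> (k < i \<and> i < j) \<or> (j < k \<and> k < i)"

definition ctri :: "'a list \<Rightarrow> 'a \<Rightarrow> 'a \<Rightarrow> 'a \<Rightarrow> bool" where
  "ctri xs a b c \<longleftrightarrow> (\<exists>i<length xs. \<exists>j<length xs. \<exists>k<length xs.
     xs!i = a \<and> xs!j = b \<and> xs!k = c \<and> cbetw i j k)"

definition subinterval :: "'a list \<Rightarrow> 'a set \<Rightarrow> bool" where
  "subinterval xs A \<longleftrightarrow> A = {} \<or>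
     (\<exists>i j. i \<le> j \<and> j < length xs \<and> A = {xs!t | t. i \<le> t \<and> t \<le> j}) \<or>
     (\<exists>i j. i < j \<and> j < length xs \<and> A = {xs!t | t. (j \<le> t \<and> t < length xs) \<or> t \<le> i})"

definition cyclic_monotone :: "'a list \<Rightarrow> 'b list \<Rightarrow> ('a \<Rightarrow> 'b) \<Rightarrow> bool" where
  "cyclic_monotone xs ys f \<longleftrightarrow> f ` set xs \<subseteq> set ys \<and>
     (\<forall>t\<in>set ys. subinterval xs {s\<in>set xs. f s = t}) \<and>
     (\<forall>a\<in>set xs. \<forall>b\<in>set xs. \<forall>c\<in>set xs.
        ctri ys (f a) (f b) (f c) \<longrightarrow> ctri xs a b c)"

definition graph_hom :: "('a \<Rightarrow> 'a \<Rightarrow> bool) \<Rightarrow> ('b \<Rightarrow> 'b \<Rightarrow> bool) \<Rightarrow> ('a \<Rightarrow> 'b) \<Rightarrow> bool" where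
  "graph_hom E1 E2 f \<longleftrightarrow> (\<forall>v w. E1 v w \<longrightarrow> f v = f w \<or> E2 (f v) (f w))"

definition has_dcycle :: "'a set \<Rightarrow> ('a \<Rightarrow> 'a \<Rightarrow> bool) \<Rightarrow> bool" where
  "has_dcycle V E \<longleftrightarrow> (\<exists>cs. cs \<noteq> [] \<and> set cs \<subseteq> V \<and>
     (\<forall>i<length cs. E (cs!i) (cs!((i+1) mod length cs))))"

definition cyclic_hom ::
  "'a list \<Rightarrow> ('a \<Rightarrow> 'a \<Rightarrow> bool) \<Rightarrow> 'b list \<Rightarrow> ('b \<Rightarrow> 'b \<Rightarrow> bool) \<Rightarrow> ('a \<Rightarrow> 'b) \<Rightarrow> bool" where
  "cyclic_hom xs E1 ys E2 f \<longleftrightarrow> cyclic_monotone xs ys f \<and> graph_hom E1 E2 f \<and>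
     (has_dcycle (set xs) E1 \<longrightarrow> (\<exists>a\<in>set xs. \<exists>b\<in>set xs. f a \<noteq> f b))"

definition Cnk :: "nat \<Rightarrow> nat \<Rightarrow> nat \<Rightarrow> nat \<Rightarrow> bool" where
  "Cnk n k i j \<longleftrightarrow> i < n \<and> j < n \<and> 0 < (j + n - i) mod n \<and> (j + n - i) mod n \<le> k"

definition winding_fraction :: "'a list \<Rightarrow> ('a \<Rightarrow> 'a \<Rightarrow> bool) \<Rightarrow> real" where
  "winding_fraction vs E = Sup {real k / real n | n k. 2 * k < n \<and>
      (\<exists>f. cyclic_hom [0..<n] (Cnk n k) vs E f)}"

definition in_nbhd :: "'a list \<Rightarrow> ('a \<Rightarrow> 'a \<Rightarrow> bool) \<Rightarrow> 'a \<Rightarrow> 'a set" where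
  "in_nbhd vs E v = {w \<in> set vs. E w v}"

definition dominated :: "'a list \<Rightarrow> ('a \<Rightarrow> 'a \<Rightarrow> bool) \<Rightarrow> nat \<Rightarrow> bool" where
  "dominated vs E i \<longleftrightarrow> i < length vs \<and>
     in_nbhd vs E (vs ! ((i+1) mod length vs)) = insert (vs!i) (in_nbhd vs E (vs!i))"

definition dismantle_step :: "('a \<Rightarrow> 'a \<Rightarrow> bool) \<Rightarrow> 'a list \<Rightarrow> 'a list \<Rightarrow> bool" where
  "dismantle_step E vs ws \<longleftrightarrow> (\<exists>i. dominated vs E i \<and> ws = take i vs @ drop (Suc i) vs)"

definition dismantles :: "'a list \<Rightarrow> ('a \<Rightarrow> 'a \<Rightarrow> bool) \<Rightarrow> 'a list \<Rightarrow> bool" where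
  "dismantles vs E ws \<longleftrightarrow> (dismantle_step E)\<^sup>*\<^sup>* vs ws"

definition iso_Cnk :: "'a list \<Rightarrow> ('a \<Rightarrow> 'a \<Rightarrow> bool) \<Rightarrow> nat \<Rightarrow> nat \<Rightarrow> bool" where
  "iso_Cnk ws E n k \<longleftrightarrow> 2 * k < n \<and> (\<exists>f. bij_betw f (set ws) {0..<n} \<and>
     cyclic_monotone ws [0..<n] f \<and>
     (\<forall>v\<in>set ws. \<forall>w\<in>set ws. E v w \<longleftrightarrow> Cnk n k (f v) (f w)))"

definition dismantles_to_Cnk :: "'a list \<Rightarrow> ('a \<Rightarrow> 'a \<Rightarrow> bool) \<Rightarrow> nat \<Rightarrow> nat \<Rightarrow> bool" where
  "dismantles_to_Cnk vs E n k \<longleftrightarrow> (\<exists>ws. dismantles vs E ws \<and> iso_Cnk ws E n k)"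

text \<open>Geometric realization of the clique complex of the underlying undirected graph,
  as a subspace of the product space 'a => real (barycentric coordinates).\<close>
definition is_clique :: "('a \<Rightarrow> 'a \<Rightarrow> bool) \<Rightarrow> 'a set \<Rightarrow> bool" where
  "is_clique E S \<longleftrightarrow> (\<forall>v\<in>S. \<forall>w\<in>S. v \<noteq> w \<longrightarrow> E v w \<or> E w v)"

definition clique_complex_space :: "'a set \<Rightarrow> ('a \<Rightarrow> 'a \<Rightarrow> bool) \<Rightarrow> ('a \<Rightarrow> real) topology" where
  "clique_complex_space V E = subtopology (powertop_real UNIV)
     {x. (\<forall>v. 0 \<le> x v) \<and> (\<forall>v. v \<notin> V \<longrightarrow> x v = 0) \<and> sum x V = 1 \<and>
         is_clique E {v\<in>V. x v \<noteq> 0}}"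

text \<open>Wedge of m copies of S^d: the j-th sphere lives in coordinates block j and passes
  through the origin (common base point); for m = 0 it is a point.\<close>
definition sphere_block :: "nat \<Rightarrow> nat \<Rightarrow> nat set" where
  "sphere_block d j = {j * (d+1) ..< (j+1) * (d+1)}"

definition wedge_spheres :: "nat \<Rightarrow> nat \<Rightarrow> (nat \<Rightarrow> real) topology" where
  "wedge_spheres m d = subtopology (powertop_real UNIV)
     ({\<lambda>_. 0} \<union> (\<Union>j<m. {x. (\<forall>i. i \<notin> sphere_block d j \<longrightarrow> x i = 0) \<and>
        (x (j * (d+1)) - 1)^2 + (\<Sum>i\<in>sphere_block d j - {j * (d+1)}. (x i)^2) = 1}))"

end

theory Submission
  imports Defs
begin

text \<open>
  Lifting the cyclic order of \<open>n\<close> vertices to the integers turns a cyclic graph into a monotone map \<open>F\<close>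
  with \<open>F (x + n) = F x + n\<close>, where \<open>F x\<close> is the last out-neighbour of \<open>x\<close>; the winding fraction is the rotation
  number of \<open>F\<close>. A vertex is dominated iff it is not a value of \<open>F\<close>, so that iterating \<open>F\<close> performs
  dismantlings, and a graph without dominated vertices has a bijective \<open>F\<close>, that is, it is some \<open>C_n^k\<close>.

  Put \<open>n = 2 * k + d\<close> and \<open>k = l * d + s\<close> with \<open>0 \<le> s < d\<close>. The link of a vertex of \<open>C_n^k\<close> is again a
  cyclic graph, and the orbits of its map show that it dismantles to a clique if \<open>s \<ge> 2\<close> and to the graph of
  a cross-polytope if \<open>s \<le> 1\<close>. If \<open>s \<ge> 2\<close> the vertex can be deleted, and the winding fraction stays above
  \<open>l / (2 * l + 1)\<close>. If \<open>s = 1\<close> the graph without the vertex dismantles to a clique, so the complex is the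
  suspension of the link. If \<open>s = 0\<close> the non-neighbours of the vertex can be exchanged one by one for copies
  of it, and the complex is the join of \<open>d\<close> points with the link.
\<close>

section \<open>Clique complexes and removal of vertices\<close>

text \<open>The induction runs over all cyclic graphs and not over the circulant ones, because
  deleting a vertex from \<open>C_n^k\<close> destroys the rotational symmetry. Winding fractions
  are therefore replaced by the two inequalities \<open>(F ^^ (2*l+1)) x > x + l*n\<close> and
  \<open>(F ^^ (2*l+3)) x < x + (l+1)*n\<close> for all vertices \<open>x\<close>. They pass to the
  image of \<open>F\<close>. After a deletion the second survives since the new map lies below the
  old one; the first survives since \<open>2*l+1\<close> steps in \<open>C_n^k\<close> advance by
  \<open>l*n + s\<close> and the deletion costs at most 1 of \<open>s >= 2\<close>. For
  \<open>s = 1\<close> that loss would be fatal, and exactly there the link is no longer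
  contractible. On the topological side, apart from isomorphisms, each step removes or inserts one
  vertex with contractible link; only the model, a join of points with a cross-polytope, is compared
  with a wedge of spheres by explicit maps. The supremum in the winding fraction is handled through
  orbits: for \<open>2*p < q\<close>, a cyclic homomorphism from \<open>C_q^p\<close> exists iff
  \<open>(F ^^ q) x >= x + p*n\<close> for some \<open>x\<close>.\<close>

definition cl_real :: "'a set \<Rightarrow> ('a \<Rightarrow> 'a \<Rightarrow> bool) \<Rightarrow> ('a \<Rightarrow> real) set" where
  "cl_real V E = {x. (\<forall>v. 0 \<le> x v) \<and> (\<forall>v. v \<notin> V \<longrightarrow> x v = 0) \<and> sum x V = 1 \<and>
         is_clique E {v\<in>V. x v \<noteq> 0}}"

lemma clique_complex_space_eq: "clique_complex_space V E = top_of_set (cl_real V E)"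
  by (simp add: clique_complex_space_def cl_real_def euclidean_product_topology)

lemma cl_realD:
  assumes "x \<in> cl_real V E"
  shows "0 \<le> x v" "v \<notin> V \<Longrightarrow> x v = 0" "sum x V = 1"
    "u \<noteq> v \<Longrightarrow> x u \<noteq> 0 \<Longrightarrow> x v \<noteq> 0 \<Longrightarrow> E u v \<or> E v u"
proof -
  show "u \<noteq> v \<Longrightarrow> x u \<noteq> 0 \<Longrightarrow> x v \<noteq> 0 \<Longrightarrow> E u v \<or> E v u"
    using assms unfolding cl_real_def is_clique_def by blast
qed (use assms in \<open>auto simp: cl_real_def\<close>)

lemma cl_realI:
  assumes "\<And>v. 0 \<le> x v" "\<And>v. v \<notin> V \<Longrightarrow> x v = 0" "sum x V = 1"
    "\<And>u v. u \<noteq> v \<Longrightarrow> x u \<noteq> 0 \<Longrightarrow> x v \<noteq> 0 \<Longrightarrow> E u v \<or> E v u"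
  shows "x \<in> cl_real V E"
  using assms unfolding cl_real_def is_clique_def by auto

lemma cl_real_le_1:
  assumes "x \<in> cl_real V E" "finite V" shows "x v \<le> 1"
proof (cases "v \<in> V")
  case True
  then have "x v \<le> sum x V" using assms by (meson cl_realD(1) member_le_sum)
  then show ?thesis using assms cl_realD(3) by metis
qed (use assms cl_realD(2) in force)

lemma continuous_on_coord [continuous_intros]:
  "continuous_on S (\<lambda>x. x i :: 'c::topological_space)"
  by (rule continuous_on_subset[OF continuous_on_product_coordinates]) simp

lemma continuous_on_snd_coord [continuous_intros]:
  "continuous_on S (\<lambda>p. snd p i :: 'c::topological_space)"
  by (rule continuous_on_product_then_coordinatewise, rule continuous_on_snd, rule continuous_on_id)

lemma homotopic_top_of_setI:
  assumes "continuous_on ({0..1} \<times> S) (\<lambda>p. h (fst p) (snd p))"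
    "\<And>t x. 0 \<le> t \<Longrightarrow> t \<le> 1 \<Longrightarrow> x \<in> S \<Longrightarrow> h t x \<in> T"
    "\<And>x. x \<in> S \<Longrightarrow> h 0 x = f x" "\<And>x. x \<in> S \<Longrightarrow> h (1::real) x = g x"
  shows "homotopic_with (\<lambda>_. True) (top_of_set S) (top_of_set T) f g"
proof -
  have "continuous_map (prod_topology (top_of_set {0..1}) (top_of_set S)) (top_of_set T) (\<lambda>p. h (fst p) (snd p))"
    unfolding prod_topology_subtopology_eu using assms(1,2)
    by (auto simp: continuous_map_in_subtopology)
  then show ?thesis
    using assms(3,4) by (subst homotopic_with) (auto intro!: exI[of _ "\<lambda>p. h (fst p) (snd p)"])
qed

text \<open>The clique condition is closed: for each non-adjacent pair of distinct vertices one of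
  the two coordinates vanishes. Closedness permits homotopies to be glued from pieces.\<close>

lemma closed_cl_real:
  assumes "finite V" shows "closed (cl_real V E)"
proof -
  have *: "cl_real V E = (\<Inter>v. {x. 0 \<le> x v}) \<inter> (\<Inter>v\<in>-V. {x. x v = 0}) \<inter> {x. sum x V = 1}
     \<inter> (\<Inter>(u,v)\<in>{(u,v). u \<noteq> v \<and> \<not> E u v \<and> \<not> E v u}. {x. x u = 0} \<union> {x. x v = 0})"
    by (auto intro!: cl_realI dest: cl_realD)
  show ?thesis unfolding *
    by (intro closed_Int closed_INT closed_Collect_le closed_Collect_eq continuous_intros ballI)
      (auto intro!: closed_Collect_eq continuous_intros)
qed

text \<open>Straight-line contraction to the vertex \<open>c\<close>: along the way the support
  grows at most by \<open>c\<close>, which is adjacent to everything.\<close>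

lemma contractible_cone:
  assumes "finite V" "c \<in> V" "\<And>u. u \<in> V \<Longrightarrow> u \<noteq> c \<Longrightarrow> E u c \<or> E c u"
  shows "contractible_space (clique_complex_space V E)"
proof -
  define d where "d = (\<lambda>u. if u = c then 1 else 0::real)"
  have d: "sum d V = 1" using assms by (simp add: d_def)
  have "homotopic_with (\<lambda>_. True) (top_of_set (cl_real V E)) (top_of_set (cl_real V E)) id (\<lambda>_. d)"
  proof (rule homotopic_top_of_setI[where h="\<lambda>t x u. (1 - t) * x u + t * d u"])
    show "continuous_on ({0..1} \<times> cl_real V E) (\<lambda>p u. (1 - fst p) * snd p u + fst p * d u)"
      by (intro continuous_on_coordinatewise_then_product continuous_intros)
    fix t :: real and x assume t: "0 \<le> t" "t \<le> 1" and x: "x \<in> cl_real V E"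
    show "(\<lambda>u. (1 - t) * x u + t * d u) \<in> cl_real V E"
    proof (rule cl_realI)
      show "0 \<le> (1 - t) * x v + t * d v" for v
        using t cl_realD(1)[OF x] by (simp add: d_def)
      show "(1 - t) * x v + t * d v = 0" if "v \<notin> V" for v
        using cl_realD(2)[OF x that] that assms by (auto simp: d_def)
      show "(\<Sum>u\<in>V. (1 - t) * x u + t * d u) = 1"
        using cl_realD(3)[OF x] d by (simp add: sum.distrib flip: sum_distrib_left)
      fix u v assume uv: "u \<noteq> v" "(1 - t) * x u + t * d u \<noteq> 0" "(1 - t) * x v + t * d v \<noteq> 0"
      have "u = c \<or> x u \<noteq> 0" "v = c \<or> x v \<noteq> 0" using uv by (auto simp: d_def)
      then show "E u v \<or> E v u"
        using cl_realD(4)[OF x uv(1)] uv(1) assms(3)[of u] assms(3)[of v] cl_realD(2)[OF x] by blast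
    qed
  qed auto
  then show ?thesis unfolding contractible_space_def clique_complex_space_eq by blast
qed

text \<open>The complex sees adjacency only up to direction, so relabelling coordinates is a
  homeomorphism even between differently oriented graphs.\<close>

lemma clique_complex_iso:
  assumes bij: "bij_betw f V W" and fin: "finite V"
    and E: "\<And>u v. u \<in> V \<Longrightarrow> v \<in> V \<Longrightarrow> u \<noteq> v \<Longrightarrow> (E u v \<or> E v u) \<longleftrightarrow> (E' (f u) (f v) \<or> E' (f v) (f u))"
  shows "clique_complex_space V E homotopy_equivalent_space clique_complex_space W E'"
proof -
  define g where "g = inv_into V f"
  have g: "bij_betw g W V" and gf: "\<And>u. u \<in> V \<Longrightarrow> g (f u) = u" and fg: "\<And>w. w \<in> W \<Longrightarrow> f (g w) = w"
    using bij unfolding g_def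
    by (auto simp: bij_betw_inv_into bij_betw_inv_into_left bij_betw_inv_into_right)
  have fV: "f u \<in> W" if "u \<in> V" for u using bij that by (auto simp: bij_betw_def)
  have gW: "g u \<in> V" if "u \<in> W" for u using g that by (auto simp: bij_betw_def)
  define P where "P = (\<lambda>(x::'a\<Rightarrow>real) w. if w \<in> W then x (g w) else 0)"
  define Q where "Q = (\<lambda>(x::'b\<Rightarrow>real) u. if u \<in> V then x (f u) else 0)"
  have P: "P x \<in> cl_real W E'" if x: "x \<in> cl_real V E" for x
  proof (rule cl_realI)
    show "0 \<le> P x v" for v using cl_realD(1)[OF x] by (auto simp: P_def)
    show "v \<notin> W \<Longrightarrow> P x v = 0" for v by (simp add: P_def)
    show "sum (P x) W = 1"
      using cl_realD(3)[OF x] sum.reindex_bij_betw[OF g, of x] by (simp add: P_def)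
    show "u \<noteq> v \<Longrightarrow> P x u \<noteq> 0 \<Longrightarrow> P x v \<noteq> 0 \<Longrightarrow> E' u v \<or> E' v u" for u v
    proof -
      assume uv: "u \<noteq> v" "P x u \<noteq> 0" "P x v \<noteq> 0"
      then have W: "u \<in> W" "v \<in> W" and nz: "x (g u) \<noteq> 0" "x (g v) \<noteq> 0" by (auto simp: P_def split: if_splits)
      then have "g u \<noteq> g v" using fg uv(1) by metis
      then have "E (g u) (g v) \<or> E (g v) (g u)" using nz by (rule cl_realD(4)[OF x])
      then show ?thesis using E[OF gW gW, OF W \<open>g u \<noteq> g v\<close>] fg W by simp
    qed
  qed
  have Q: "Q x \<in> cl_real V E" if x: "x \<in> cl_real W E'" for x
  proof (rule cl_realI)
    show "0 \<le> Q x v" for v using cl_realD(1)[OF x] by (auto simp: Q_def)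
    show "v \<notin> V \<Longrightarrow> Q x v = 0" for v by (simp add: Q_def)
    show "sum (Q x) V = 1"
      using cl_realD(3)[OF x] sum.reindex_bij_betw[OF bij, of x] by (simp add: Q_def)
    show "u \<noteq> v \<Longrightarrow> Q x u \<noteq> 0 \<Longrightarrow> Q x v \<noteq> 0 \<Longrightarrow> E u v \<or> E v u" for u v
    proof -
      assume uv: "u \<noteq> v" "Q x u \<noteq> 0" "Q x v \<noteq> 0"
      then have W: "u \<in> V" "v \<in> V" and nz: "x (f u) \<noteq> 0" "x (f v) \<noteq> 0" by (auto simp: Q_def split: if_splits)
      then have "f u \<noteq> f v" using gf uv(1) by metis
      then have "E' (f u) (f v) \<or> E' (f v) (f u)" using nz by (rule cl_realD(4)[OF x])
      then show ?thesis using E[OF W uv(1)] by simp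
    qed
  qed
  have QP: "Q (P x) = x" if "x \<in> cl_real V E" for x
    using cl_realD(2)[OF that] by (auto simp: P_def Q_def gf fV)
  have PQ: "P (Q x) = x" if "x \<in> cl_real W E'" for x
    using cl_realD(2)[OF that] by (auto simp: P_def Q_def fg gW)
  have "continuous_on (cl_real V E) P"
    unfolding P_def
  proof (rule continuous_on_coordinatewise_then_product)
    show "continuous_on (cl_real V E) (\<lambda>x. if w \<in> W then x (g w) else 0)" for w
      by (cases "w \<in> W") (simp_all add: continuous_intros)
  qed
  moreover have "continuous_on (cl_real W E') Q"
    unfolding Q_def
  proof (rule continuous_on_coordinatewise_then_product)
    show "continuous_on (cl_real W E') (\<lambda>x. if w \<in> V then x (f w) else 0)" for w
      by (cases "w \<in> V") (simp_all add: continuous_intros)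
  qed
  ultimately have "homeomorphic_maps (clique_complex_space V E) (clique_complex_space W E') P Q"
    unfolding homeomorphic_maps_def clique_complex_space_eq using P Q PQ QP by (auto)
  then show ?thesis
    by (metis homeomorphic_imp_homotopy_equivalent_space homeomorphic_space_def)
qed

lemma clique_complex_cong:
  assumes "finite V"
    and "\<And>u v. u \<in> V \<Longrightarrow> v \<in> V \<Longrightarrow> u \<noteq> v \<Longrightarrow> (E u v \<or> E v u) \<longleftrightarrow> (E' u v \<or> E' v u)"
  shows "clique_complex_space V E homotopy_equivalent_space clique_complex_space V E'"
  using clique_complex_iso[of id V V E E'] assms by auto

lemma cl_real_mono: "V \<subseteq> W \<Longrightarrow> finite W \<Longrightarrow> cl_real V E \<subseteq> cl_real W E"
proof
  fix x assume VW: "V \<subseteq> W" "finite W" and x: "x \<in> cl_real V E"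
  have "sum x W = sum x V"
    by (rule sum.mono_neutral_right) (use VW cl_realD(2)[OF x] in auto)
  then show "x \<in> cl_real W E"
    using VW cl_realD(2)[OF x] cl_realD(4)[OF x]
    by (intro cl_realI) (auto simp: cl_realD(1,3)[OF x] subset_iff)
qed

lemma cl_real_supportI:
  assumes "x \<in> cl_real W E" "finite W" "\<And>v. v \<notin> V \<Longrightarrow> x v = 0" "V \<subseteq> W"
  shows "x \<in> cl_real V E"
proof -
  have "sum x W = sum x V"
    by (rule sum.mono_neutral_right) (use assms in auto)
  then show ?thesis
    using assms(3) by (intro cl_realI) (auto simp: cl_realD(1)[OF assms(1)] cl_realD(3)[OF assms(1), symmetric] dest: cl_realD(4)[OF assms(1)])
qed

lemma unit_mult:
  fixes a b :: real
  assumes "0 \<le> a" "a \<le> 1" "0 \<le> b" "b \<le> 1"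
  shows "0 \<le> a * b \<and> a * b \<le> 1"
  using assms by (simp add: mult_le_one)

lemma cone_comb_in_cl_real:
  assumes "finite V" "v \<in> V" "L = {u\<in>V. u \<noteq> v \<and> (E u v \<or> E v u)}" "z \<in> cl_real L E" "0 \<le> c" "c \<le> 1"
  shows "(\<lambda>u. c * z u + (1 - c) * (if u = v then 1 else 0)) \<in> cl_real V E"
proof (rule cl_realI)
  have zV: "z \<in> cl_real V E" using cl_real_mono[of L V E] assms by auto
  show "0 \<le> c * z u + (1 - c) * (if u = v then 1 else 0)" for u
    using assms cl_realD(1)[OF zV] by simp
  show "u \<notin> V \<Longrightarrow> c * z u + (1 - c) * (if u = v then 1 else 0) = 0" for u
    using assms cl_realD(2)[OF zV] by auto
  have "(\<Sum>u\<in>V. c * z u + (1 - c) * (if u = v then 1 else 0)) = c * sum z V + (1 - c) * (\<Sum>u\<in>V. (if u = v then 1 else 0))"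
    by (simp only: sum.distrib sum_distrib_left)
  then show "(\<Sum>u\<in>V. c * z u + (1 - c) * (if u = v then 1 else 0)) = 1"
    using cl_realD(3)[OF zV] assms by simp
  fix a b assume ab: "a \<noteq> b" "c * z a + (1 - c) * (if a = v then 1 else 0) \<noteq> 0"
    "c * z b + (1 - c) * (if b = v then 1 else 0) \<noteq> 0"
  then have "a = v \<or> z a \<noteq> 0" "b = v \<or> z b \<noteq> 0" by auto
  then show "E a b \<or> E b a"
    using ab(1) cl_realD(2,4)[OF assms(4)] assms(3) by blast
qed

text \<open>The homotopy \<open>P\<close> pushes the half of the cone nearest to its apex \<open>v\<close> into \<open>v\<close>; then \<open>Q\<close> uses the
  rest of the cone to run through the contraction \<open>h\<close> of the link, and finally slides \<open>v\<close> to its end point \<open>a\<close>.\<close>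

lemma clique_complex_remove_vertex:
  assumes fin: "finite V" and v: "v \<in> V" and L: "L = {u\<in>V. u \<noteq> v \<and> (E u v \<or> E v u)}"
    and ne: "L \<noteq> {}" and con: "contractible_space (clique_complex_space L E)"
  shows "clique_complex_space V E homotopy_equivalent_space clique_complex_space (V - {v}) E"
proof -
  define X where "X = cl_real V E"
  have finL: "finite L" and LV: "L \<subseteq> V - {v}" and vL: "v \<notin> L" using fin L by auto
  obtain a where "homotopic_with (\<lambda>_. True) (top_of_set (cl_real L E)) (top_of_set (cl_real L E)) id (\<lambda>_. a)"
    using con unfolding contractible_space_def clique_complex_space_eq by blast
  then obtain h where h: "continuous_on ({0..1} \<times> cl_real L E) h"
      "\<And>p. p \<in> {0..1} \<times> cl_real L E \<Longrightarrow> h p \<in> cl_real L E"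
      "\<And>x. h (0, x) = x" "\<And>x. h (1::real, x) = a"
    unfolding homotopic_with_def by (auto simp: Pi_iff)
  obtain w where w: "w \<in> L" using ne by blast
  define y0 where "y0 = (\<lambda>u. if u = w then 1 else 0::real)"
  have "y0 \<in> cl_real L E" using w finL by (intro cl_realI) (auto simp: y0_def split: if_splits)
  then have a: "a \<in> cl_real L E" using h(2)[of "(1,y0)"] h(4) by auto
  \<comment> \<open>Radial projection of the punctured star of \<open>v\<close>, away from
    \<open>v\<close>, onto the link.\<close>
  define nrm where "nrm = (\<lambda>(x::'a\<Rightarrow>real) u. if u = v then 0 else x u / (1 - x v))"
  \<comment> \<open>\<open>C0\<close> is the complex without \<open>v\<close>; \<open>C1\<close> and
    \<open>C2\<close> are the outer and the inner half of the star of \<open>v\<close>, meeting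
    where the coordinate at \<open>v\<close> is 1/2.\<close>
  define C0 where "C0 = cl_real (V - {v}) E"
  define C1 where "C1 = {x \<in> cl_real (insert v L) E. x v \<le> 1/2}"
  define C2 where "C2 = {x \<in> cl_real (insert v L) E. x v \<ge> 1/2}"
  have cl: "closed C0" "closed C1" "closed C2"
    unfolding C0_def C1_def C2_def using fin finL
    by (auto simp: Collect_conj_eq intro!: closed_cl_real closed_Int closed_Collect_le continuous_intros)
  have X012: "X = C0 \<union> (C1 \<union> C2)"
  proof
    show "X \<subseteq> C0 \<union> (C1 \<union> C2)"
    proof
      fix x assume x: "x \<in> X"
      show "x \<in> C0 \<union> (C1 \<union> C2)"
      proof (cases "x v = 0")
        case True
        have xV: "x \<in> cl_real V E" using x X_def by simp
        then have "x \<in> C0" unfolding C0_def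
          by (rule cl_real_supportI) (use True fin cl_realD(2)[OF xV] in auto)
        then show ?thesis by simp
      next
        case False
        have "x \<in> cl_real (insert v L) E"
        proof (rule cl_real_supportI[of x V])
          show "u \<notin> insert v L \<Longrightarrow> x u = 0" for u
            using False cl_realD(2)[of x V E u] cl_realD(4)[of x V E u v] x unfolding X_def L by blast
        qed (use x X_def fin v LV in auto)
        then show ?thesis unfolding C1_def C2_def by auto
      qed
    qed
    show "C0 \<union> (C1 \<union> C2) \<subseteq> X"
      unfolding C0_def C1_def C2_def X_def using cl_real_mono[of _ V E] fin v LV by blast
  qed
  have nrm: "nrm x \<in> cl_real L E" if "x \<in> C1" for x
  proof -
    have x: "x \<in> cl_real (insert v L) E" "x v \<le> 1/2" using that by (auto simp: C1_def)
    show ?thesis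
    proof (rule cl_realI)
      show "0 \<le> nrm x u" for u using x cl_realD(1)[OF x(1)] by (simp add: nrm_def)
      show "u \<notin> L \<Longrightarrow> nrm x u = 0" for u using cl_realD(2)[OF x(1)] by (auto simp: nrm_def)
      have "sum x L = 1 - x v" using cl_realD(3)[OF x(1)] finL vL by simp
      moreover have "sum (nrm x) L = (\<Sum>u\<in>L. x u / (1 - x v))"
        by (rule sum.cong) (use vL in \<open>auto simp: nrm_def\<close>)
      ultimately show "sum (nrm x) L = 1" using x(2) by (simp flip: sum_divide_distrib)
      show "a \<noteq> b \<Longrightarrow> nrm x a \<noteq> 0 \<Longrightarrow> nrm x b \<noteq> 0 \<Longrightarrow> E a b \<or> E b a" for a b
        using cl_realD(4)[OF x(1), of a b] by (auto simp: nrm_def split: if_splits)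
    qed
  qed
  have nrm0: "nrm x = x" if "x v = 0" for x using that by (auto simp: nrm_def)
  have C1_0: "x v = 0" if "x \<in> C0" for x using that cl_realD(2) unfolding C0_def by fastforce
  have xv: "0 \<le> x v" "x v \<le> 1" if "x \<in> X" for x
    using that cl_realD(1) cl_real_le_1[OF _ fin] unfolding X_def by metis+
  define D where "D = (\<lambda>c (z::'a\<Rightarrow>real) u. c * z u + (1 - c) * (if u = v then 1 else 0))"
  \<comment> \<open>For \<open>t = 0\<close> the coefficient is 1, so that the homotopy is fixed on
    \<open>C0\<close>. For \<open>t = 1/2\<close> it stays 0 until the time
    \<open>min 1 (2 * s)\<close> of the contraction has reached its end; the value there is thus
    independent of the direction and fits \<open>f2\<close>. For \<open>s = 1\<close> it is 1, so
    that nothing remains on \<open>v\<close>.\<close>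
  define c where "c = (\<lambda>s t::real. max ((1 - 2*t) * (1 - t)) (2 * s - 1))"
  define c' where "c' = (\<lambda>s::real. max 0 (2 * s - 1))"
  define f1 where "f1 = (\<lambda>s x. D (c s (x v)) (h (min 1 (2 * s) * (2 * x v), nrm x)))"
  define f2 where "f2 = (\<lambda>s. D (c' s) a)"
  define Q where "Q = (\<lambda>s x. if x v = 0 then x else if x v \<le> 1/2 then f1 s x else f2 s)"
  have Dcong: "D c z = D c' z'" if "c = c'" "c = 0 \<or> z = z'" for c c' z z' using that by (auto simp: D_def)
  have DX: "D c z \<in> X" if "z \<in> cl_real L E" "0 \<le> c" "c \<le> 1" for c z
    unfolding X_def D_def by (rule cone_comb_in_cl_real[OF fin v L that])
  have c_bd: "0 \<le> c s t" "c s t \<le> 1" if "0 \<le> s" "s \<le> 1" "0 \<le> t" "t \<le> 1/2" for s t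
  proof -
    have le: "0 \<le> (1 - 2*t) * (1 - t)" "(1 - 2*t) * (1 - t) \<le> 1" using that by (auto intro!: mult_le_one)
    show "0 \<le> c s t" unfolding c_def by (rule max.coboundedI1) fact
    show "c s t \<le> 1" unfolding c_def by (rule max.boundedI) (fact le(2), use that in simp)
  qed
  have hin: "h (min 1 (2 * s) * (2 * x v), nrm x) \<in> cl_real L E"
     "(min 1 (2 * s) * (2 * x v)) \<in> {0..1}" if "x \<in> C1" "0 \<le> s" "s \<le> 1" for s x
  proof -
    have "x \<in> X" using that X012 by auto
    then have "0 \<le> x v" "x v \<le> 1/2" using that xv by (auto simp: C1_def)
    then have "0 \<le> min 1 (2 * s) * (2 * x v)" "min 1 (2 * s) * (2 * x v) \<le> 1" using that
      using unit_mult[of "min 1 (2 * s)" "2 * x v"] by auto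
    then show "(min 1 (2 * s) * (2 * x v)) \<in> {0..1}" by auto
    then show "h (min 1 (2 * s) * (2 * x v), nrm x) \<in> cl_real L E"
      using h(2) nrm[OF that(1)] by auto
  qed
  have QC0: "Q s x = x" if "x \<in> C0" for s x using C1_0[OF that] by (simp add: Q_def)
  have QC1: "Q s x = f1 s x" if "x \<in> C1" "0 \<le> s" "s \<le> 1" for s x
    using that by (auto simp: Q_def C1_def f1_def D_def c_def nrm0 h(3))
  have QC2: "Q s x = f2 s" if "x \<in> C2" "0 \<le> s" "s \<le> 1" for s x
  proof (cases "x v = 1/2")
    case True
    have "f1 s x = f2 s" unfolding f1_def f2_def
      by (rule Dcong) (auto simp: True c_def c'_def h(4) min_def)
    then show ?thesis by (simp add: Q_def True)
  next
    case False
    then show ?thesis using that by (auto simp: Q_def C2_def)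
  qed
  have contQ: "continuous_on ({0..1} \<times> X) (\<lambda>p. Q (fst p) (snd p))"
  proof -
    have eq: "{0..1} \<times> X = ({0..1} \<times> C0) \<union> (({0..1} \<times> C1) \<union> ({0..1::real} \<times> C2))"
      unfolding X012 by blast
    have "continuous_on ({0..1} \<times> C0) (\<lambda>p. Q (fst p) (snd p))"
      by (rule continuous_on_eq[of _ snd]) (auto simp: QC0 intro: continuous_intros)
    moreover have "continuous_on ({0..1} \<times> C1) (\<lambda>p. Q (fst p) (snd p))"
    proof (rule continuous_on_eq)
      have "continuous_on ({0..1} \<times> C1) (\<lambda>p. h (min 1 (2 * fst p) * (2 * snd p v), nrm (snd p)))"
      proof (rule continuous_on_compose2[OF h(1)])
        have "continuous_on ({0..1} \<times> C1) (\<lambda>p. nrm (snd p))"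
        proof (rule continuous_on_coordinatewise_then_product)
          show "continuous_on ({0..1} \<times> C1) (\<lambda>p. nrm (snd p) u)" for u
            by (cases "u = v") (auto simp: nrm_def C1_def intro!: continuous_intros)
        qed
        then show "continuous_on ({0..1} \<times> C1) (\<lambda>p. (min 1 (2 * fst p) * (2 * snd p v), nrm (snd p)))"
          by (intro continuous_on_Pair) (auto intro!: continuous_intros)
        show "(\<lambda>p. (min 1 (2 * fst p) * (2 * snd p v), nrm (snd p))) ` ({0..1} \<times> C1) \<subseteq> {0..1} \<times> cl_real L E"
          using hin(2) nrm by auto
      qed
      then have "continuous_on ({0..1} \<times> C1) (\<lambda>p. h (min 1 (2 * fst p) * (2 * snd p v), nrm (snd p)) u)" for u
        by (rule continuous_on_product_then_coordinatewise)
      then show "continuous_on ({0..1} \<times> C1) (\<lambda>p. f1 (fst p) (snd p))"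
        unfolding f1_def D_def c_def
        by (intro continuous_on_coordinatewise_then_product) (intro continuous_intros)
      show "x \<in> {0..1} \<times> C1 \<Longrightarrow> f1 (fst x) (snd x) = Q (fst x) (snd x)" for x
        using QC1 by auto
    qed
    moreover have "continuous_on ({0..1} \<times> C2) (\<lambda>p. Q (fst p) (snd p))"
    proof (rule continuous_on_eq)
      show "continuous_on ({0..1} \<times> C2) (\<lambda>p. f2 (fst p))"
        unfolding f2_def D_def c'_def
        by (intro continuous_on_coordinatewise_then_product) (intro continuous_intros)
      show "x \<in> {0..1} \<times> C2 \<Longrightarrow> f2 (fst x) = Q (fst x) (snd x)" for x
        using QC2 by auto
    qed
    ultimately show ?thesis unfolding eq
      by (intro continuous_on_closed_Un closed_Un closed_Times cl closed_atLeastAtMost)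
  qed
  have QX: "Q s x \<in> X" if s: "0 \<le> s" "s \<le> 1" and x: "x \<in> X" for s x
  proof -
    consider "x \<in> C0" | "x \<in> C1" | "x \<in> C2" using x X012 by blast
    then show ?thesis
    proof cases
      case 1 then show ?thesis using QC0 x by simp
    next
      case 2
      have "0 \<le> x v" "x v \<le> 1/2" using x xv 2 by (auto simp: C1_def)
      then show ?thesis using QC1[OF 2 s] hin(1)[OF 2 s] c_bd[OF s] unfolding f1_def by (auto intro!: DX)
    next
      case 3
      then show ?thesis using QC2[OF 3 s] a s unfolding f2_def c'_def by (auto intro!: DX)
    qed
  qed
  have Q1: "Q 1 x \<in> C0" if x: "x \<in> X" for x
  proof -
    have LC: "cl_real L E \<subseteq> C0" unfolding C0_def using LV fin by (intro cl_real_mono) auto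
    consider "x \<in> C0" | "x \<in> C1" | "x \<in> C2" using x X012 by blast
    then show ?thesis
    proof cases
      case 1 then show ?thesis using QC0 by simp
    next
      case 2
      have "0 \<le> x v" "x v \<le> 1/2" using x xv 2 by (auto simp: C1_def)
      then have "(1 - 2 * x v) * (1 - x v) \<le> 1" by (intro mult_le_one) auto
      then have "c 1 (x v) = 1" by (simp add: c_def)
      then have "Q 1 x = h (min 1 (2 * 1) * (2 * x v), nrm x)" using QC1[OF 2, of 1] by (simp add: f1_def D_def)
      then show ?thesis using hin(1)[OF 2, of 1] LC by auto
    next
      case 3
      then show ?thesis using QC2[OF 3, of 1] a LC by (auto simp: f2_def D_def c'_def)
    qed
  qed
  have Q0: "Q 0 x = (\<lambda>u. if u = v then 1 - (1 - x v) * (1 - min 1 (2 * x v)) else x u * (1 - min 1 (2 * x v)))"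
    if x: "x \<in> X" for x
  proof -
    consider "x \<in> C0" | "x \<in> C1" | "x \<in> C2" using x X012 by blast
    then show ?thesis
    proof cases
      case 1
      then show ?thesis using QC0 C1_0 by fastforce
    next
      case 2
      have le: "0 \<le> x v" "x v \<le> 1/2" using x xv 2 by (auto simp: C1_def)
      then have "0 \<le> (1 - 2 * x v) * (1 - x v)" using unit_mult[of "1 - 2 * x v" "1 - x v"] by auto
      then have "c 0 (x v) = (1 - 2 * x v) * (1 - x v)" unfolding c_def by (intro max.absorb1) linarith
      then have q: "Q 0 x = D ((1 - 2 * x v) * (1 - x v)) (nrm x)" using QC1[OF 2, of 0] by (simp add: f1_def h(3))
      have m: "min 1 (2 * x v) = 2 * x v" using le by simp
      show ?thesis unfolding q m D_def nrm_def
        using le by (intro ext) auto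
    next
      case 3
      then have "x v \<ge> 1/2" by (auto simp: C2_def)
      then show ?thesis using QC2[OF 3, of 0] a by (auto simp: f2_def D_def c'_def)
    qed
  qed
  define P where "P = (\<lambda>(s::real) (x::'a\<Rightarrow>real) u. if u = v then 1 - (1 - x v) * (1 - s * min 1 (2 * x v))
      else x u * (1 - s * min 1 (2 * x v)))"
  have PX: "P s x \<in> X" if s: "0 \<le> s" "s \<le> 1" and x: "x \<in> X" for s x
  proof -
    define m where "m = 1 - s * min 1 (2 * x v)"
    have "0 \<le> s * min 1 (2 * x v)" "s * min 1 (2 * x v) \<le> 1"
      using s xv[OF x] using unit_mult[of s "min 1 (2 * x v)"] by auto
    then have m: "0 \<le> m" "m \<le> 1" by (auto simp: m_def)
    have P: "P s x = (\<lambda>u. if u = v then 1 - (1 - x v) * m else x u * m)" unfolding P_def m_def by (rule refl)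
    have x': "x \<in> cl_real V E" using x X_def by simp
    show ?thesis unfolding X_def P
    proof (rule cl_realI)
      have "(1 - x v) * m \<le> 1" using xv[OF x] m by (intro mult_le_one) auto
      then show "0 \<le> (if u = v then 1 - (1 - x v) * m else x u * m)" for u
        using m cl_realD(1)[OF x'] by auto
      show "u \<notin> V \<Longrightarrow> (if u = v then 1 - (1 - x v) * m else x u * m) = 0" for u
        using v cl_realD(2)[OF x'] by auto
      have "(\<Sum>u\<in>V. if u = v then 1 - (1 - x v) * m else x u * m) = (1 - (1 - x v) * m) + (\<Sum>u\<in>V - {v}. x u * m)"
        by (subst sum.remove[OF fin v]) (auto intro!: sum.cong)
      moreover have "sum x (V - {v}) = 1 - x v" using cl_realD(3)[OF x'] sum.remove[OF fin v, of x] by simp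
      ultimately show "(\<Sum>u\<in>V. if u = v then 1 - (1 - x v) * m else x u * m) = 1"
        by (simp flip: sum_distrib_right)
      have "x v \<noteq> 0" if "1 - (1 - x v) * m \<noteq> 0" using that by (auto simp: m_def)
      then show "b \<noteq> d \<Longrightarrow> (if b = v then 1 - (1 - x v) * m else x b * m) \<noteq> 0 \<Longrightarrow>
          (if d = v then 1 - (1 - x v) * m else x d * m) \<noteq> 0 \<Longrightarrow> E b d \<or> E d b" for b d
        using cl_realD(4)[OF x', of b d] by (auto split: if_splits)
    qed
  qed
  have "homotopic_with (\<lambda>_. True) (top_of_set X) (top_of_set X) id (P 1)"
  proof (rule homotopic_top_of_setI[where h = P])
    show "continuous_on ({0..1} \<times> X) (\<lambda>p. P (fst p) (snd p))"
    proof (rule continuous_on_coordinatewise_then_product)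
      show "continuous_on ({0..1} \<times> X) (\<lambda>p. P (fst p) (snd p) u)" for u
        by (cases "u = v") (auto simp: P_def intro!: continuous_intros)
    qed
  qed (auto simp: PX, auto simp: P_def)
  \<comment> \<open>\<open>Q\<close> starts at \<open>P 1\<close>, so the two homotopies can be
    concatenated. \<open>Q\<close> fixes \<open>C0\<close> throughout and maps everything into it at
    the end.\<close>
  moreover have "homotopic_with (\<lambda>_. True) (top_of_set X) (top_of_set X) (P 1) (Q 1)"
    by (rule homotopic_top_of_setI[where h = Q]) (auto simp: contQ QX Q0 P_def)
  ultimately have hom: "homotopic_with (\<lambda>_. True) (top_of_set X) (top_of_set X) (Q 1) id"
    by (meson homotopic_with_symD homotopic_with_trans)
  have contQ1: "continuous_on X (Q 1)"
    using homotopic_with_imp_continuous[OF hom] by simp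
  show ?thesis
    unfolding homotopy_equivalent_space_def clique_complex_space_eq X_def[symmetric] C0_def[symmetric]
  proof (intro exI conjI)
    show "continuous_map (top_of_set X) (top_of_set C0) (Q 1)"
      using contQ1 Q1 by (auto simp: continuous_map_in_subtopology)
    show "continuous_map (top_of_set C0) (top_of_set X) id"
      using X012 by (auto simp: continuous_map_in_subtopology)
    show "homotopic_with (\<lambda>x. True) (top_of_set X) (top_of_set X) (id \<circ> Q 1) id"
      using hom by simp
    show "homotopic_with (\<lambda>x. True) (top_of_set C0) (top_of_set C0) (Q 1 \<circ> id) id"
      by (rule homotopic_with_id2) (simp add: QC0)
  qed
qed

text \<open>The link of the dominated vertex \<open>u\<close> is a cone with apex
  \<open>w\<close>.\<close>

lemma clique_complex_remove_dominated:
  assumes "finite V" "u \<in> V" "w \<in> V" "u \<noteq> w" "E u w \<or> E w u"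
    and "\<And>x. x \<in> V \<Longrightarrow> x \<noteq> u \<Longrightarrow> x \<noteq> w \<Longrightarrow> E x u \<or> E u x \<Longrightarrow> E x w \<or> E w x"
  shows "clique_complex_space V E homotopy_equivalent_space clique_complex_space (V - {u}) E"
proof (rule clique_complex_remove_vertex[OF assms(1,2) refl])
  have w: "w \<in> {x \<in> V. x \<noteq> u \<and> (E x u \<or> E u x)}" using assms by auto
  then show "{x \<in> V. x \<noteq> u \<and> (E x u \<or> E u x)} \<noteq> {}" by blast
  show "contractible_space (clique_complex_space {x \<in> V. x \<noteq> u \<and> (E x u \<or> E u x)} E)"
    by (rule contractible_cone[of _ w]) (use assms w in auto)
qed

section \<open>Joins of points with cross-polytopes\<close>

text \<open>The \<open>Inl i\<close> are pairwise non-adjacent points; \<open>Inr (i, True)\<close>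
  and \<open>Inr (i, False)\<close> are the antipodal vertices on axis \<open>i\<close> of a
  cross-polytope. With \<open>d >= 1\<close> points and \<open>r\<close> axes the clique complex is
  the join of \<open>d\<close> points with an (r-1)-sphere, a wedge of \<open>d - 1\<close> spheres
  of dimension \<open>r\<close>.\<close>

fun join_adj :: "nat + nat \<times> bool \<Rightarrow> nat + nat \<times> bool \<Rightarrow> bool" where
  "join_adj (Inl i) (Inl j) = False"
| "join_adj (Inl i) (Inr q) = True"
| "join_adj (Inr p) (Inl j) = True"
| "join_adj (Inr p) (Inr q) = (fst p \<noteq> fst q)"

definition join_verts :: "nat \<Rightarrow> nat \<Rightarrow> (nat + nat \<times> bool) set" where
  "join_verts d r = Inl ` {..<d} \<union> Inr ` ({..<r} \<times> UNIV)"

lemma finite_join_verts: "finite (join_verts d r)"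
  by (simp add: join_verts_def)

lemma sum_join_verts:
  fixes x :: "nat + nat \<times> bool \<Rightarrow> real"
  shows "sum x (join_verts d r) = (\<Sum>j<d. x (Inl j)) + (\<Sum>i<r. x (Inr (i, True)) + x (Inr (i, False)))"
proof -
  have "sum x (join_verts d r) = sum x (Inl ` {..<d}) + sum x (Inr ` ({..<r} \<times> UNIV))"
    unfolding join_verts_def by (rule sum.union_disjoint) auto
  also have "sum x (Inl ` {..<d}) = (\<Sum>j<d. x (Inl j))" by (subst sum.reindex) auto
  also have "sum x (Inr ` ({..<r} \<times> UNIV)) = (\<Sum>p\<in>{..<r} \<times> UNIV. x (Inr p))" by (subst sum.reindex) auto
  also have "\<dots> = (\<Sum>i<r. \<Sum>b\<in>UNIV. x (Inr (i, b)))" by (simp add: sum.cartesian_product)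
  finally show ?thesis by (simp add: UNIV_bool add.commute)
qed

text \<open>Unnormalised join coordinates: \<open>z\<close> is a vector of the space containing the
  cross-polytope and \<open>h j\<close> the weight of point \<open>j\<close>, a negative weight
  counting as 0. After division by the total, straight lines in \<open>(h, z)\<close> run inside the
  join as long as at most one weight is positive.\<close>

definition join_tot :: "nat \<Rightarrow> nat \<Rightarrow> (nat \<Rightarrow> real) \<Rightarrow> (nat \<Rightarrow> real) \<Rightarrow> real" where
  "join_tot d r h z = (\<Sum>j<d. max (h j) 0) + (\<Sum>i<r. \<bar>z i\<bar>)"

definition join_pt :: "nat \<Rightarrow> nat \<Rightarrow> (nat \<Rightarrow> real) \<Rightarrow> (nat \<Rightarrow> real) \<Rightarrow> nat + nat \<times> bool \<Rightarrow> real" where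
  "join_pt d r h z v = (case v of Inl j \<Rightarrow> if j < d then max (h j) 0 / join_tot d r h z else 0
     | Inr (i, b) \<Rightarrow> if i < r then max (if b then z i else - z i) 0 / join_tot d r h z else 0)"

lemma join_tot_nonneg: "0 \<le> join_tot d r h z"
  unfolding join_tot_def by (intro add_nonneg_nonneg sum_nonneg) auto

lemma join_pt_in:
  assumes T: "join_tot d r h z \<noteq> 0" and one: "\<And>i j. i < d \<Longrightarrow> j < d \<Longrightarrow> 0 < h i \<Longrightarrow> 0 < h j \<Longrightarrow> i = j"
  shows "join_pt d r h z \<in> cl_real (join_verts d r) join_adj"
proof (rule cl_realI)
  show "0 \<le> join_pt d r h z v" for v
    using join_tot_nonneg[of d r h z] by (auto simp: join_pt_def split: sum.splits prod.splits)
  show "v \<notin> join_verts d r \<Longrightarrow> join_pt d r h z v = 0" for v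
    by (cases v) (auto simp: join_pt_def join_verts_def image_iff split: prod.splits)
  have "sum (join_pt d r h z) (join_verts d r) = (\<Sum>j<d. max (h j) 0 / join_tot d r h z) + (\<Sum>i<r. \<bar>z i\<bar> / join_tot d r h z)"
    unfolding sum_join_verts by (intro arg_cong2[of _ _ _ _ "(+)"] sum.cong) (auto simp: join_pt_def abs_if max_def)
  also have "\<dots> = 1" using T unfolding join_tot_def by (simp flip: sum_divide_distrib add_divide_distrib)
  finally show "sum (join_pt d r h z) (join_verts d r) = 1" .
  fix u v assume uv: "u \<noteq> v" "join_pt d r h z u \<noteq> 0" "join_pt d r h z v \<noteq> 0"
  show "join_adj u v \<or> join_adj v u"
  proof (cases u; cases v)
    fix i j assume "u = Inl i" "v = Inl j"
    then show ?thesis using uv one[of i j] by (auto simp: join_pt_def max_def split: if_splits)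
  next
    fix p q assume "u = Inr p" "v = Inr q"
    then show ?thesis using uv by (cases p; cases q) (auto simp: join_pt_def max_def split: if_splits)
  qed auto
qed

lemma continuous_on_join_pt:
  assumes "\<And>j. continuous_on A (\<lambda>a. h a j)" "\<And>j. continuous_on A (\<lambda>a. z a j)"
    and "\<And>a. a \<in> A \<Longrightarrow> join_tot d r (h a) (z a) \<noteq> 0"
  shows "continuous_on A (\<lambda>a. join_pt d r (h a) (z a))"
proof (rule continuous_on_coordinatewise_then_product)
  have T: "continuous_on A (\<lambda>a. join_tot d r (h a) (z a))"
    unfolding join_tot_def by (intro continuous_intros assms)
  fix v show "continuous_on A (\<lambda>a. join_pt d r (h a) (z a) v)"
  proof (cases v)
    case (Inl j)
    then show ?thesis using assms T by (cases "j < d") (auto simp: join_pt_def intro!: continuous_intros)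
  next
    case (Inr p)
    then obtain i b where "v = Inr (i, b)" by (cases p) auto
    then show ?thesis using assms T by (cases "i < r"; cases b) (auto simp: join_pt_def intro!: continuous_intros)
  qed
qed

text \<open>The active apex keeps its weight and all others receive the negative of it. For an
  active apex \<open>Suc j0\<close>, both here and in \<open>psi_h\<close> the apexes 0 and
  \<open>Suc j0\<close> have opposite weights and the rest have none that are positive; hence along
  a segment between the two at most one weight is positive.\<close>

definition join_h :: "nat \<Rightarrow> (nat + nat \<times> bool \<Rightarrow> real) \<Rightarrow> nat \<Rightarrow> real" where
  "join_h d x j = 2 * x (Inl j) - (\<Sum>i<d. x (Inl i))"

definition join_z :: "(nat + nat \<times> bool \<Rightarrow> real) \<Rightarrow> nat \<Rightarrow> real" where
  "join_z x i = x (Inr (i, True)) - x (Inr (i, False))"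

lemma join_z_zero:
  assumes "x \<in> cl_real (join_verts d r) join_adj"
  shows "x (Inr (i, True)) = 0 \<or> x (Inr (i, False)) = 0"
  using cl_realD(4)[OF assms, of "Inr (i,True)" "Inr (i,False)"] by auto

text \<open>Two apexes are never adjacent, so at most one carries weight; if none does, any index
  serves, whence \<open>0 < d\<close>. Of an antipodal pair only one vertex carries weight, which is
  then the absolute value of \<open>join_z\<close>.\<close>

lemma join_apex:
  assumes x: "x \<in> cl_real (join_verts d r) join_adj" and d: "0 < d"
  obtains j where "j < d" "\<And>i. i \<noteq> j \<Longrightarrow> x (Inl i) = 0" "(\<Sum>i<d. x (Inl i)) = x (Inl j)"
    "x (Inl j) + (\<Sum>i<r. \<bar>join_z x i\<bar>) = 1" "0 \<le> x (Inl j)"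
proof -
  have ex: "\<exists>j<d. \<forall>i. i \<noteq> j \<longrightarrow> x (Inl i) = 0"
  proof (cases "\<exists>j<d. x (Inl j) \<noteq> 0")
    case True
    then obtain j where j: "j < d" "x (Inl j) \<noteq> 0" by blast
    have "x (Inl i) = 0" if "i \<noteq> j" for i
      using cl_realD(4)[OF x, of "Inl i" "Inl j"] that j by auto
    then show ?thesis using j by blast
  next
    case False
    then have "x (Inl i) = 0" for i
      using cl_realD(2)[OF x, of "Inl i"] by (cases "i < d") (auto simp: join_verts_def)
    then show ?thesis using d by blast
  qed
  then obtain j where j: "j < d" "\<And>i. i \<noteq> j \<Longrightarrow> x (Inl i) = 0" by blast
  have s: "(\<Sum>i<d. x (Inl i)) = x (Inl j)"
    using j by (subst sum.remove[of _ j]) auto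
  have "\<bar>join_z x i\<bar> = x (Inr (i, True)) + x (Inr (i, False))" for i
    using join_z_zero[OF x, of i] cl_realD(1)[OF x, of "Inr (i,True)"]
      cl_realD(1)[OF x, of "Inr (i,False)"] by (auto simp: join_z_def)
  then have "x (Inl j) + (\<Sum>i<r. \<bar>join_z x i\<bar>) = 1"
    using cl_realD(3)[OF x] s by (simp add: sum_join_verts)
  then show ?thesis using that[OF j] s cl_realD(1)[OF x] by auto
qed

lemma join_pt_h_z:
  assumes x: "x \<in> cl_real (join_verts d r) join_adj" and d: "0 < d"
  shows "join_pt d r (join_h d x) (join_z x) = x"
proof -
  obtain j where j: "j < d" "\<And>i. i \<noteq> j \<Longrightarrow> x (Inl i) = 0" "(\<Sum>i<d. x (Inl i)) = x (Inl j)"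
    "x (Inl j) + (\<Sum>i<r. \<bar>join_z x i\<bar>) = 1" "0 \<le> x (Inl j)"
    using join_apex[OF assms] by blast
  have h: "max (join_h d x i) 0 = x (Inl i)" for i
    using j(2)[of i] j(3,5) by (cases "i = j") (auto simp: join_h_def)
  have T: "join_tot d r (join_h d x) (join_z x) = 1"
    using j(3,4) by (simp add: join_tot_def h)
  have "join_pt d r (join_h d x) (join_z x) v = x v" for v
  proof (cases v)
    case (Inl i)
    then show ?thesis using cl_realD(2)[OF x, of v] by (auto simp: join_pt_def T h join_verts_def)
  next
    case (Inr p)
    then obtain i b where v: "v = Inr (i, b)" by (cases p) auto
    have "max (if b then join_z x i else - join_z x i) 0 = x v"
      using join_z_zero[OF x, of i] cl_realD(1)[OF x, of "Inr (i,True)"]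
      cl_realD(1)[OF x, of "Inr (i,False)"] v by (cases b) (auto simp: join_z_def)
    then show ?thesis using cl_realD(2)[OF x, of v] v by (auto simp: join_pt_def T join_verts_def)
  qed
  then show ?thesis by blast
qed

section \<open>Wedges of spheres in blocks of coordinates\<close>

definition wedge_set :: "nat \<Rightarrow> nat \<Rightarrow> (nat \<Rightarrow> real) set" where
  "wedge_set m r = {w. (\<forall>q \<ge> m * (r+1). w q = 0)
     \<and> (\<forall>j<m. (\<Sum>e\<le>r. (w (j * (r+1) + e) - (if e = 0 then 1 else 0))\<^sup>2) = 1)
     \<and> (\<exists>j0. \<forall>j<m. j \<noteq> j0 \<longrightarrow> (\<forall>e\<le>r. w (j * (r+1) + e) = 0))}"

lemma block_index:
  fixes q r :: nat
  shows "q = (q div (r+1)) * (r+1) + q mod (r+1)" "q mod (r+1) \<le> r"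
  using mod_less_divisor[of "r+1" q] by (simp_all only: div_mult_mod_eq) linarith+

text \<open>Each sphere passes through the origin, so a vanishing block satisfies its sphere
  equation too. The union of the spheres is therefore cut out by all equations together with the
  condition that all blocks but one vanish; \<open>j0 \<ge> m\<close> describes the base point and
  covers \<open>m = 0\<close>.\<close>

lemma wedge_spheres_eq: "wedge_spheres m r = top_of_set (wedge_set m r)"
proof -
  let ?B = "\<lambda>j. {x. (\<forall>i. i \<notin> sphere_block r j \<longrightarrow> x i = 0) \<and>
        (x (j * (r+1)) - 1)^2 + (\<Sum>i\<in>sphere_block r j - {j * (r+1)}. (x i)^2) = (1::real)}"
  have base: "(\<Sum>e\<le>r. ((0::real) - (if e = 0 then 1 else 0))\<^sup>2) = 1" for r :: nat
  proof -
    have "((0::real) - (if e = 0 then 1 else 0))\<^sup>2 = (if e = 0 then 1 else 0)" for e :: nat by simp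
    then show ?thesis by simp
  qed
  have blk: "(x (j * (r+1)) - 1)^2 + (\<Sum>i\<in>sphere_block r j - {j * (r+1)}. (x i)^2)
      = (\<Sum>e\<le>r. (x (j * (r+1) + e) - (if e = 0 then 1 else 0))\<^sup>2)" for x :: "nat \<Rightarrow> real" and j
  proof -
    have "(\<Sum>e\<le>r. (x (j * (r+1) + e) - (if e = 0 then 1 else 0))\<^sup>2)
       = (x (j * (r+1)) - 1)^2 + (\<Sum>e\<in>{..r} - {0}. (x (j * (r+1) + e) - (if e = 0 then 1 else 0))\<^sup>2)"
      by (subst sum.remove[of _ 0]) auto
    also have "(\<Sum>e\<in>{..r} - {0}. (x (j * (r+1) + e) - (if e = 0 then 1 else 0))\<^sup>2)
       = (\<Sum>i\<in>sphere_block r j - {j * (r+1)}. (x i)^2)"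
      by (rule sum.reindex_bij_witness[of _ "\<lambda>i. i - j * (r+1)" "\<lambda>e. j * (r+1) + e"])
        (auto simp: sphere_block_def algebra_simps)
    finally show ?thesis by simp
  qed
  have mem: "j * (r+1) + e \<in> sphere_block r j' \<longleftrightarrow> j = j'" if "e \<le> r" for j j' e
  proof -
    consider "j = j'" | "j < j'" | "j' < j" by linarith
    then show ?thesis
    proof cases
      case 1 then show ?thesis using that by (simp add: sphere_block_def)
    next
      case 2
      then have "(j+1) * (r+1) \<le> j' * (r+1)" by (intro mult_le_mono1) simp
      then show ?thesis using that 2 by (simp add: sphere_block_def)
    next
      case 3
      then have "(j'+1) * (r+1) \<le> j * (r+1)" by (intro mult_le_mono1) simp
      then show ?thesis using that 3 by (simp add: sphere_block_def)
    qed
  qed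
  have "wedge_set m r = {\<lambda>_. 0} \<union> (\<Union>j<m. ?B j)"
  proof (intro set_eqI iffI)
    fix w assume w: "w \<in> wedge_set m r"
    then obtain j0 where j0: "\<And>j e. j < m \<Longrightarrow> j \<noteq> j0 \<Longrightarrow> e \<le> r \<Longrightarrow> w (j * (r+1) + e) = 0"
      unfolding wedge_set_def by blast
    have out: "w q = 0" if "q \<notin> sphere_block r j0 \<or> j0 \<ge> m" for q
    proof (cases "q div (r+1) < m")
      case True
      have "q div (r+1) \<noteq> j0" using that mem[OF block_index(2), of "q div (r+1)" q j0] block_index(1)[of q r] True by auto
      then show ?thesis using j0[OF True _ block_index(2)[of q r]] block_index(1)[of q r] by simp
    next
      case False
      then have "q \<ge> m * (r+1)" by (metis div_times_less_eq_dividend le_trans mult_le_mono1 not_le)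
      then show ?thesis using w by (auto simp: wedge_set_def)
    qed
    show "w \<in> {\<lambda>_. 0} \<union> (\<Union>j<m. ?B j)"
    proof (cases "j0 < m")
      case True
      then have "w \<in> ?B j0" using w out blk[of w j0] unfolding wedge_set_def by simp
      then show ?thesis using True by blast
    next
      case False
      then show ?thesis using out by auto
    qed
  next
    fix w assume "w \<in> {\<lambda>_. 0} \<union> (\<Union>j<m. ?B j)"
    then show "w \<in> wedge_set m r"
    proof
      assume "w \<in> {\<lambda>_. 0}" then show ?thesis using base[of r] by (auto simp: wedge_set_def)
    next
      assume "w \<in> (\<Union>j<m. ?B j)"
      then obtain j0 where j0: "j0 < m" "w \<in> ?B j0" by blast
      have z: "w (j * (r+1) + e) = 0" if "j \<noteq> j0" "e \<le> r" for j e
        using j0(2) mem[OF that(2), of j j0] that by blast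
      have "w q = 0" if "q \<ge> m * (r+1)" for q
      proof -
        have "m \<le> q div (r+1)" using that by (metis div_le_mono nonzero_mult_div_cancel_right add_is_0 one_neq_zero)
        then show ?thesis using z[of "q div (r+1)", OF _ block_index(2)[of q r]] j0(1) block_index(1)[of q r] by auto
      qed
      moreover have "(\<Sum>e\<le>r. (w (j * (r+1) + e) - (if e = 0 then 1 else 0))\<^sup>2) = 1" if "j < m" for j
      proof (cases "j = j0")
        case True then show ?thesis using j0(2) blk[of w j] by simp
      next
        case False
        have "(\<Sum>e\<le>r. (w (j * (r+1) + e) - (if e = 0 then 1 else 0))\<^sup>2) = (\<Sum>e\<le>r. ((0::real) - (if e = 0 then 1 else 0))\<^sup>2)"
          by (rule sum.cong[OF refl], subst z) (use False in auto)
        then show ?thesis using base by simp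
      qed
      ultimately show ?thesis using z unfolding wedge_set_def by blast
    qed
  qed
  then show ?thesis unfolding wedge_spheres_def euclidean_product_topology by simp
qed

definition blk_norm :: "nat \<Rightarrow> (nat \<Rightarrow> nat \<Rightarrow> real) \<Rightarrow> nat \<Rightarrow> real" where
  "blk_norm r p j = sqrt (\<Sum>e\<le>r. (p j e)\<^sup>2)"

text \<open>\<open>p j\<close> is a vector based at the centre of the \<open>j\<close>-th sphere; it
  is scaled to length 1 and moved to that centre. The vector (-1, 0, ..., 0) yields the base
  point.\<close>

definition wedge_pt :: "nat \<Rightarrow> nat \<Rightarrow> (nat \<Rightarrow> nat \<Rightarrow> real) \<Rightarrow> nat \<Rightarrow> real" where
  "wedge_pt m r p q = (if q div (r+1) < m
     then (if q mod (r+1) = 0 then 1 else 0) + p (q div (r+1)) (q mod (r+1)) / blk_norm r p (q div (r+1)) else 0)"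

lemma wedge_pt_at:
  assumes "j < m" "e \<le> r"
  shows "wedge_pt m r p (j * (r+1) + e) = (if e = 0 then 1 else 0) + p j e / blk_norm r p j"
proof -
  have "(j * (r+1) + e) div (r+1) = j + e div (r+1)" by (rule div_mult_self3) simp
  moreover have "(j * (r+1) + e) mod (r+1) = e mod (r+1)" by (rule mod_mult_self3)
  ultimately have "(j * (r+1) + e) div (r+1) = j" "(j * (r+1) + e) mod (r+1) = e" using assms by simp_all
  then show ?thesis using assms by (simp add: wedge_pt_def del: mult_Suc_right)
qed

lemma blk_norm_pos: "e \<le> r \<Longrightarrow> p j e \<noteq> 0 \<Longrightarrow> 0 < blk_norm r p j"
  unfolding blk_norm_def by (auto intro!: sum_pos2)

lemma blk_norm_base: "p j 0 = -1 \<Longrightarrow> (\<And>e. 0 < e \<Longrightarrow> e \<le> r \<Longrightarrow> p j e = 0) \<Longrightarrow> blk_norm r p j = 1"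
  by (simp add: blk_norm_def sum.atMost_shift)

lemma wedge_pt_in:
  assumes nz: "\<And>j. j < m \<Longrightarrow> 0 < blk_norm r p j"
    and act: "\<And>j e. j < m \<Longrightarrow> j \<noteq> j0 \<Longrightarrow> e \<le> r \<Longrightarrow> p j e = (if e = 0 then -1 else 0)"
  shows "wedge_pt m r p \<in> wedge_set m r"
  unfolding wedge_set_def
proof (intro CollectI conjI allI impI)
  fix q assume "m * (r+1) \<le> q"
  then have "m \<le> q div (r+1)" by (metis div_le_mono nonzero_mult_div_cancel_right add_is_0 one_neq_zero)
  then show "wedge_pt m r p q = 0" by (simp add: wedge_pt_def)
next
  fix j assume j: "j < m"
  have "(\<Sum>e\<le>r. (wedge_pt m r p (j * (r + 1) + e) - (if e = 0 then 1 else 0))\<^sup>2) = (\<Sum>e\<le>r. (p j e)\<^sup>2 / (blk_norm r p j)\<^sup>2)"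
    by (rule sum.cong[OF refl], subst wedge_pt_at[OF j]) (auto simp: power_divide)
  also have "\<dots> = (\<Sum>e\<le>r. (p j e)\<^sup>2) / (blk_norm r p j)\<^sup>2" by (simp flip: sum_divide_distrib)
  also have "(blk_norm r p j)\<^sup>2 = (\<Sum>e\<le>r. (p j e)\<^sup>2)" by (simp add: blk_norm_def sum_nonneg)
  also have "(\<Sum>e\<le>r. (p j e)\<^sup>2) / (\<Sum>e\<le>r. (p j e)\<^sup>2) = 1" using nz[OF j] by (simp add: blk_norm_def)
  finally show "(\<Sum>e\<le>r. (wedge_pt m r p (j * (r + 1) + e) - (if e = 0 then 1 else 0))\<^sup>2) = 1" .
next
  have "wedge_pt m r p (j * (r+1) + e) = 0" if "j < m" "j \<noteq> j0" "e \<le> r" for j e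
  proof -
    have "blk_norm r p j = 1" using act[OF that(1,2)] by (intro blk_norm_base) auto
    then show ?thesis using wedge_pt_at[OF that(1,3), of p] act[OF that] by simp
  qed
  then show "\<exists>j0. \<forall>j<m. j \<noteq> j0 \<longrightarrow> (\<forall>e\<le>r. wedge_pt m r p (j * (r + 1) + e) = 0)" by blast
qed

lemma continuous_on_wedge_pt:
  assumes "\<And>j e. continuous_on A (\<lambda>a. p a j e)" "\<And>a j. a \<in> A \<Longrightarrow> j < m \<Longrightarrow> 0 < blk_norm r (p a) j"
  shows "continuous_on A (\<lambda>a. wedge_pt m r (p a))"
proof (rule continuous_on_coordinatewise_then_product)
  fix q
  have N: "continuous_on A (\<lambda>a. blk_norm r (p a) j)" for j
    unfolding blk_norm_def by (intro continuous_intros assms)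
  show "continuous_on A (\<lambda>a. wedge_pt m r (p a) q)"
  proof (cases "q div (r+1) < m")
    case True
    then have "blk_norm r (p a) (q div (r+1)) \<noteq> 0" if "a \<in> A" for a using assms(2)[OF that True] by simp
    then have "continuous_on A (\<lambda>a. (if q mod (r+1) = 0 then 1 else 0) + p a (q div (r+1)) (q mod (r+1)) / blk_norm r (p a) (q div (r+1)))"
      by (intro continuous_on_add continuous_on_const continuous_on_divide assms(1) N) auto
    then show ?thesis unfolding wedge_pt_def using True by (simp only: if_True)
  qed (simp add: wedge_pt_def)
qed

definition wedge_vec :: "nat \<Rightarrow> (nat \<Rightarrow> real) \<Rightarrow> nat \<Rightarrow> nat \<Rightarrow> real" where
  "wedge_vec r w j e = w (j * (r+1) + e) - (if e = 0 then 1 else 0)"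

lemma wedge_pt_vec:
  assumes w: "w \<in> wedge_set m r"
  shows "wedge_pt m r (wedge_vec r w) = w"
proof
  fix q
  show "wedge_pt m r (wedge_vec r w) q = w q"
  proof (cases "q div (r+1) < m")
    case True
    have "blk_norm r (wedge_vec r w) (q div (r+1)) = 1"
      using w True unfolding wedge_set_def blk_norm_def wedge_vec_def by simp
    then have "wedge_pt m r (wedge_vec r w) (q div (r+1) * (r+1) + q mod (r+1)) = w (q div (r+1) * (r+1) + q mod (r+1))"
      by (subst wedge_pt_at[OF True block_index(2)]) (simp add: wedge_vec_def)
    then show ?thesis using block_index(1)[of q r] by simp
  next
    case False
    then have "q \<ge> m * (r+1)" by (metis div_times_less_eq_dividend le_trans mult_le_mono1 not_le)
    then show ?thesis using w False by (auto simp: wedge_set_def wedge_pt_def)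
  qed
qed

lemma wedge_active:
  assumes w: "w \<in> wedge_set m r"
  obtains j0 where "\<And>j e. j < m \<Longrightarrow> j \<noteq> j0 \<Longrightarrow> e \<le> r \<Longrightarrow> w (j * (r+1) + e) = 0"
    "j0 < m \<Longrightarrow> (w (j0 * (r+1)) - 1)\<^sup>2 + (\<Sum>i<r. (w (j0 * (r+1) + Suc i))\<^sup>2) = 1"
proof -
  obtain j0 where j0: "\<And>j e. j < m \<Longrightarrow> j \<noteq> j0 \<Longrightarrow> e \<le> r \<Longrightarrow> w (j * (r+1) + e) = 0"
    using w unfolding wedge_set_def by blast
  moreover have "(w (j0 * (r+1)) - 1)\<^sup>2 + (\<Sum>i<r. (w (j0 * (r+1) + Suc i))\<^sup>2) = 1" if "j0 < m"
  proof -
    have "(\<Sum>e\<le>r. (w (j0 * (r+1) + e) - (if e = 0 then 1 else 0))\<^sup>2) = 1" 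
      using w that unfolding wedge_set_def by blast
    then show ?thesis by (simp add: sum.atMost_shift)
  qed
  ultimately show ?thesis using that by blast
qed

text \<open>The map \<open>phi\<close> collapses the cone over apex \<open>0\<close> and wraps the cone over apex \<open>Suc j\<close> around
  the \<open>j\<close>-th sphere; \<open>psi\<close> maps that sphere homeomorphically onto the two cones over \<open>0\<close> and \<open>Suc j\<close>.
  In both composites a point and its image are never antipodal, so normalised straight lines join them.\<close>

definition phi_vec :: "(nat + nat \<times> bool \<Rightarrow> real) \<Rightarrow> nat \<Rightarrow> nat \<Rightarrow> real" where
  "phi_vec x j e = (if e = 0 then 2 * x (Inl (Suc j)) - 1 else x (Inl (Suc j)) * join_z x (e - 1))"

text \<open>\<open>w (i * (r+1)) - 1\<close> is the height above the centre of the sphere: a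
  positive height weighs on apex \<open>Suc i\<close>, a negative one on apex 0. At most one block
  of \<open>w\<close> is non-zero, so the sum in the weight of apex 0 is the entry of that block and
  no case distinction is needed.\<close>

definition psi_h :: "nat \<Rightarrow> nat \<Rightarrow> (nat \<Rightarrow> real) \<Rightarrow> nat \<Rightarrow> real" where
  "psi_h m r w j = (case j of 0 \<Rightarrow> 1 - (\<Sum>i<m. w (i * (r+1))) | Suc i \<Rightarrow> w (i * (r+1)) - 1)"

definition psi_z :: "nat \<Rightarrow> nat \<Rightarrow> (nat \<Rightarrow> real) \<Rightarrow> nat \<Rightarrow> real" where
  "psi_z m r w i = (\<Sum>j<m. w (j * (r+1) + Suc i))"

lemma sum_max_lessThan_Suc:
  "(\<Sum>j<Suc m. max (h j) (0::real)) = max (h 0) 0 + (\<Sum>j<m. max (h (Suc j)) 0)"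
  by (simp add: sum.lessThan_Suc_shift del: sum.lessThan_Suc)

lemma psi_inactive:
  assumes "\<forall>j e. j < m \<and> e \<le> r \<longrightarrow> w (j * (r+1) + e) = 0"
  shows "psi_h m r w 0 = 1" "j < m \<Longrightarrow> psi_h m r w (Suc j) = -1" "i < r \<Longrightarrow> psi_z m r w i = 0"
  using assms[rule_format, of _ 0] assms[rule_format, of _ "Suc i"] by (auto simp: psi_h_def psi_z_def)

lemma psi_active:
  assumes z: "\<forall>j e. j < m \<and> j \<noteq> j0 \<and> e \<le> r \<longrightarrow> w (j * (r+1) + e) = 0" and j0: "j0 < m"
  shows "psi_h m r w 0 = 1 - w (j0 * (r+1))" "psi_h m r w (Suc j0) = w (j0 * (r+1)) - 1"
    "j < m \<Longrightarrow> j \<noteq> j0 \<Longrightarrow> psi_h m r w (Suc j) = -1" "i < r \<Longrightarrow> psi_z m r w i = w (j0 * (r+1) + Suc i)"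
proof -
  have s: "(\<Sum>j<m. w (j * (r+1) + e)) = w (j0 * (r+1) + e)" if "e \<le> r" for e
  proof -
    have "(\<Sum>j<m. w (j * (r+1) + e)) = (\<Sum>j\<in>{j0}. w (j * (r+1) + e))"
      by (rule sum.mono_neutral_right) (use j0 z that in auto)
    then show ?thesis by simp
  qed
  show "psi_h m r w 0 = 1 - w (j0 * (r+1))" using s[of 0] by (simp add: psi_h_def)
  show "psi_h m r w (Suc j0) = w (j0 * (r+1)) - 1" by (simp add: psi_h_def)
  show "j < m \<Longrightarrow> j \<noteq> j0 \<Longrightarrow> psi_h m r w (Suc j) = -1" using z[rule_format, of j 0] by (simp add: psi_h_def)
  show "i < r \<Longrightarrow> psi_z m r w i = w (j0 * (r+1) + Suc i)" using s[of "Suc i"] by (simp add: psi_z_def)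
qed

text \<open>The positive parts of \<open>g\<close> and \<open>- g\<close> add up to
  \<open>\<bar>g\<bar>\<close>, so the total is the l1-norm of \<open>(g, z)\<close> and vanishes
  only at the origin.\<close>

lemma join_tot_active:
  assumes "j0 < m" "h 0 = - g" "h (Suc j0) = g" "\<And>j. j < m \<Longrightarrow> j \<noteq> j0 \<Longrightarrow> h (Suc j) \<le> 0"
  shows "join_tot (Suc m) r h z = \<bar>g\<bar> + (\<Sum>i<r. \<bar>z i\<bar>)"
    "i < Suc m \<Longrightarrow> j < Suc m \<Longrightarrow> 0 < h i \<Longrightarrow> 0 < h j \<Longrightarrow> i = j"
proof -
  have "(\<Sum>j<m. max (h (Suc j)) 0) = (\<Sum>j\<in>{j0}. max (h (Suc j)) 0)"
    by (rule sum.mono_neutral_right) (use assms in \<open>auto simp: max_def dest: antisym\<close>)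
  then show "join_tot (Suc m) r h z = \<bar>g\<bar> + (\<Sum>i<r. \<bar>z i\<bar>)"
    using assms(2,3) unfolding join_tot_def sum_max_lessThan_Suc by (auto simp: max_def)
  show "i < Suc m \<Longrightarrow> j < Suc m \<Longrightarrow> 0 < h i \<Longrightarrow> 0 < h j \<Longrightarrow> i = j"
    using assms(2,3) assms(4)[of "i-1"] assms(4)[of "j-1"] by (cases i; cases j) (auto, (smt (verit))+)
qed

lemma join_tot_base:
  assumes "\<And>j. j < m \<Longrightarrow> h (Suc j) \<le> 0"
  shows "join_tot (Suc m) r h z = max (h 0) 0 + (\<Sum>i<r. \<bar>z i\<bar>)"
    "i < Suc m \<Longrightarrow> j < Suc m \<Longrightarrow> 0 < h i \<Longrightarrow> 0 < h j \<Longrightarrow> i = j"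
proof -
  have "(\<Sum>j<m. max (h (Suc j)) 0) = (\<Sum>j<m. 0)"
    by (rule sum.cong) (use assms in \<open>auto simp: max_def dest: antisym\<close>)
  then show "join_tot (Suc m) r h z = max (h 0) 0 + (\<Sum>i<r. \<bar>z i\<bar>)"
    unfolding join_tot_def sum_max_lessThan_Suc by simp
  show "i < Suc m \<Longrightarrow> j < Suc m \<Longrightarrow> 0 < h i \<Longrightarrow> 0 < h j \<Longrightarrow> i = j"
    using assms[of "i-1"] assms[of "j-1"] by (cases i; cases j) auto
qed

text \<open>A vanishing total would put the active block at the centre of its sphere, from which it
  has distance 1.\<close>

lemma psi_good:
  assumes w: "w \<in> wedge_set m r"
  shows "join_tot (Suc m) r (psi_h m r w) (psi_z m r w) \<noteq> 0"
    "i < Suc m \<Longrightarrow> j < Suc m \<Longrightarrow> 0 < psi_h m r w i \<Longrightarrow> 0 < psi_h m r w j \<Longrightarrow> i = j"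
proof -
  obtain j0 where j0: "\<And>j e. j < m \<Longrightarrow> j \<noteq> j0 \<Longrightarrow> e \<le> r \<Longrightarrow> w (j * (r+1) + e) = 0"
    "j0 < m \<Longrightarrow> (w (j0 * (r+1)) - 1)\<^sup>2 + (\<Sum>i<r. (w (j0 * (r+1) + Suc i))\<^sup>2) = 1"
    using wedge_active[OF w] by blast
  have "join_tot (Suc m) r (psi_h m r w) (psi_z m r w) \<noteq> 0 \<and>
    (i < Suc m \<longrightarrow> j < Suc m \<longrightarrow> 0 < psi_h m r w i \<longrightarrow> 0 < psi_h m r w j \<longrightarrow> i = j)"
  proof (cases "j0 < m")
    case True
    have "\<forall>j e. j < m \<and> j \<noteq> j0 \<and> e \<le> r \<longrightarrow> w (j * (r+1) + e) = 0" using j0(1) by blast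
    note P = psi_active[OF this True]
    have "join_tot (Suc m) r (psi_h m r w) (psi_z m r w) = \<bar>w (j0 * (r+1)) - 1\<bar> + (\<Sum>i<r. \<bar>psi_z m r w i\<bar>)"
      by (rule join_tot_active[OF True]) (use P in auto)
    moreover have "\<dots> \<noteq> 0"
    proof
      assume "\<bar>w (j0 * (r+1)) - 1\<bar> + (\<Sum>i<r. \<bar>psi_z m r w i\<bar>) = 0"
      then have z: "w (j0 * (r+1)) - 1 = 0" "(\<Sum>i<r. \<bar>psi_z m r w i\<bar>) = 0"
        by (smt (verit) sum_nonneg abs_ge_zero)+
      then have "\<forall>i\<in>{..<r}. w (j0 * (r+1) + Suc i) = 0" using P(4) by (simp add: sum_nonneg_eq_0_iff)
      then have "(\<Sum>i<r. (w (j0 * (r+1) + Suc i))\<^sup>2) = 0" by (intro sum.neutral) auto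
      then show False using j0(2)[OF True] z(1) by simp
    qed
    moreover have "i < Suc m \<Longrightarrow> j < Suc m \<Longrightarrow> 0 < psi_h m r w i \<Longrightarrow> 0 < psi_h m r w j \<Longrightarrow> i = j"
      by (rule join_tot_active(2)[OF True, of "psi_h m r w" "w (j0 * (r+1)) - 1"]) (use P in auto)
    ultimately show ?thesis by simp
  next
    case False
    have z: "\<forall>j e. j < m \<and> e \<le> r \<longrightarrow> w (j * (r+1) + e) = 0" using j0(1) False by blast
    note P = psi_inactive[OF z]
    have "join_tot (Suc m) r (psi_h m r w) (psi_z m r w) = max (psi_h m r w 0) 0 + (\<Sum>i<r. \<bar>psi_z m r w i\<bar>)"
      by (rule join_tot_base) (use P in auto)
    moreover have "i < Suc m \<Longrightarrow> j < Suc m \<Longrightarrow> 0 < psi_h m r w i \<Longrightarrow> 0 < psi_h m r w j \<Longrightarrow> i = j"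
      by (rule join_tot_base(2)[of m "psi_h m r w"]) (use P in auto)
    ultimately show ?thesis using P by simp
  qed
  then show "join_tot (Suc m) r (psi_h m r w) (psi_z m r w) \<noteq> 0"
    "i < Suc m \<Longrightarrow> j < Suc m \<Longrightarrow> 0 < psi_h m r w i \<Longrightarrow> 0 < psi_h m r w j \<Longrightarrow> i = j" by blast+
qed

lemma phi_vec_base: "x (Inl (Suc j)) = 0 \<Longrightarrow> phi_vec x j e = (if e = 0 then -1 else 0)"
  by (simp add: phi_vec_def)

text \<open>If entry 0 vanishes, apex \<open>Suc j\<close> has weight 1/2; the other half lies on
  the cross-polytope, so some later entry is non-zero.\<close>

lemma phi_vec_pos:
  assumes x: "x \<in> cl_real (join_verts (Suc m) r) join_adj"
  shows "0 < blk_norm r (phi_vec x) j"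
proof (cases "2 * x (Inl (Suc j)) - 1 = 0")
  case False
  then show ?thesis by (intro blk_norm_pos[of 0]) (auto simp: phi_vec_def)
next
  case True
  obtain j1 where j1: "j1 < Suc m" "\<And>i. i \<noteq> j1 \<Longrightarrow> x (Inl i) = 0" "x (Inl j1) + (\<Sum>i<r. \<bar>join_z x i\<bar>) = 1"
    using join_apex[OF x] by (metis zero_less_Suc)
  have "Suc j = j1" using True j1(2)[of "Suc j"] by auto
  then have "(\<Sum>i<r. \<bar>join_z x i\<bar>) = 1/2" using True j1(3) by simp
  then obtain i where "i < r" "join_z x i \<noteq> 0"
    using sum.neutral[of "{..<r}" "\<lambda>i. \<bar>join_z x i\<bar>"] by fastforce
  then show ?thesis using True by (intro blk_norm_pos[of "Suc i"]) (auto simp: phi_vec_def)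
qed

lemma phi_in:
  assumes x: "x \<in> cl_real (join_verts (Suc m) r) join_adj"
  shows "wedge_pt m r (phi_vec x) \<in> wedge_set m r"
proof -
  obtain j1 where j1: "\<And>i. i \<noteq> j1 \<Longrightarrow> x (Inl i) = 0"
    using join_apex[OF x] by (metis zero_less_Suc)
  have ex: "\<exists>j0. \<forall>j. j \<noteq> j0 \<longrightarrow> x (Inl (Suc j)) = 0" 
  proof (cases j1)
    case 0 then show ?thesis using j1 by auto
  next
    case (Suc j0) then show ?thesis using j1 by (intro exI[of _ j0]) auto
  qed
  then obtain j0 where "\<And>j. j \<noteq> j0 \<Longrightarrow> x (Inl (Suc j)) = 0" by blast
  then show ?thesis
    by (intro wedge_pt_in[of m r _ j0] phi_vec_pos[OF x]) (auto simp: phi_vec_base)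
qed

lemma join_pt_Inl: "j < d \<Longrightarrow> join_pt d r h z (Inl j) = max (h j) 0 / join_tot d r h z"
  by (simp add: join_pt_def)

lemma join_z_join_pt: "i < r \<Longrightarrow> join_z (join_pt d r h z) i = z i / join_tot d r h z"
  by (simp add: join_z_def join_pt_def max_def)

definition psi :: "nat \<Rightarrow> nat \<Rightarrow> (nat \<Rightarrow> real) \<Rightarrow> nat + nat \<times> bool \<Rightarrow> real" where
  "psi m r w = join_pt (Suc m) r (psi_h m r w) (psi_z m r w)"

definition phi :: "nat \<Rightarrow> nat \<Rightarrow> (nat + nat \<times> bool \<Rightarrow> real) \<Rightarrow> nat \<Rightarrow> real" where
  "phi m r x = wedge_pt m r (phi_vec x)"

lemma psi_in: "w \<in> wedge_set m r \<Longrightarrow> psi m r w \<in> cl_real (join_verts (Suc m) r) join_adj"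
  unfolding psi_def by (rule join_pt_in) (use psi_good in auto)

lemma psi_cont: "continuous_on (wedge_set m r) (psi m r)"
  unfolding psi_def
proof (rule continuous_on_join_pt)
  show "continuous_on (wedge_set m r) (\<lambda>w. psi_h m r w j)" for j
    by (cases j) (auto simp: psi_h_def intro!: continuous_intros)
qed (auto simp: psi_z_def psi_good intro!: continuous_intros)

lemma phi_cont: "continuous_on (cl_real (join_verts (Suc m) r) join_adj) (phi m r)"
  unfolding phi_def
proof (rule continuous_on_wedge_pt)
  show "continuous_on (cl_real (join_verts (Suc m) r) join_adj) (\<lambda>x. phi_vec x j e)" for j e
    by (cases "e = 0") (auto simp: phi_vec_def join_z_def intro!: continuous_intros)
qed (rule phi_vec_pos)

text \<open>The entries of \<open>v j0\<close> after the first are those of \<open>w\<close> times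
  \<open>(1 - t) + t * (s0 / T)\<close>. If this factor is 0, then \<open>t = 1\<close> and
  \<open>s0 = 0\<close>, and the first entry is \<open>-1\<close>. Otherwise a vanishing block makes
  \<open>w\<close> a pole of its sphere, where \<open>T = 1\<close> and the two vectors to be joined
  agree.\<close>

lemma phi_psi_homotopy:
  assumes w: "w \<in> wedge_set m r" and t: "0 \<le> t" "t \<le> 1"
  defines "v \<equiv> (\<lambda>j e. (1 - t) * wedge_vec r w j e + t * phi_vec (psi m r w) j e)"
  shows "j < m \<Longrightarrow> 0 < blk_norm r v j" "wedge_pt m r v \<in> wedge_set m r"
proof -
  obtain j0 where j0: "\<And>j e. j < m \<Longrightarrow> j \<noteq> j0 \<Longrightarrow> e \<le> r \<Longrightarrow> w (j * (r+1) + e) = 0"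
    "j0 < m \<Longrightarrow> (w (j0 * (r+1)) - 1)\<^sup>2 + (\<Sum>i<r. (w (j0 * (r+1) + Suc i))\<^sup>2) = 1"
    using wedge_active[OF w] by blast
  define T where "T = join_tot (Suc m) r (psi_h m r w) (psi_z m r w)"
  have T: "0 < T" using psi_good(1)[OF w] join_tot_nonneg[of "Suc m" r "psi_h m r w" "psi_z m r w"] by (simp add: T_def)
  have s: "psi m r w (Inl (Suc j)) = max (w (j * (r+1)) - 1) 0 / T" if "j < m" for j
    using that by (simp add: psi_def join_pt_Inl T_def psi_h_def)
  have base: "v j e = (if e = 0 then -1 else 0)" if "j < m" "j \<noteq> j0" "e \<le> r" for j e
  proof -
    have "psi m r w (Inl (Suc j)) = 0" using s[OF that(1)] j0(1)[OF that(1,2), of 0] by simp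
    then have "phi_vec (psi m r w) j e = (if e = 0 then -1 else 0)" by (rule phi_vec_base)
    moreover have "wedge_vec r w j e = (if e = 0 then -1 else 0)" using j0(1)[OF that] by (simp add: wedge_vec_def)
    ultimately show ?thesis by (simp add: v_def)
  qed
  have act: "0 < blk_norm r v j0" if j0m: "j0 < m"
  proof (rule ccontr)
    assume "\<not> 0 < blk_norm r v j0"
    then have z: "v j0 e = 0" if "e \<le> r" for e using blk_norm_pos[of e r v j0] that by blast
    define h where "h = w (j0 * (r+1)) - 1"
    define y where "y = (\<lambda>i. w (j0 * (r+1) + Suc i))"
    define s0 where "s0 = max h 0 / T"
    have s0: "psi m r w (Inl (Suc j0)) = s0" using s[OF j0m] by (simp add: h_def s0_def)
    have s0_ge: "0 \<le> s0" using T by (simp add: s0_def)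
    have "\<forall>j e. j < m \<and> j \<noteq> j0 \<and> e \<le> r \<longrightarrow> w (j * (r+1) + e) = 0" using j0(1) by blast
    note P = psi_active[OF this j0m]
    have v0: "(1 - t) * h + t * (2 * s0 - 1) = 0"
      using z[of 0] by (simp add: v_def wedge_vec_def phi_vec_def s0 h_def)
    have vS: "y i * ((1 - t) + t * (s0 / T)) = 0" if "i < r" for i
    proof -
      have "join_z (psi m r w) i = y i / T" using that P(4)[OF that] by (simp add: psi_def join_z_join_pt T_def y_def)
      then show ?thesis
        using z[of "Suc i"] that by (simp add: v_def wedge_vec_def phi_vec_def s0 y_def algebra_simps)
    qed
    show False
    proof (cases "(1 - t) + t * (s0 / T) = 0")
      case True
      have "0 \<le> t * (s0 / T)" using t s0_ge T by simp
      then have "t = 1" "s0 / T = 0" using True t by (auto simp: add_nonneg_eq_0_iff)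
      then show False using v0 T by simp
    next
      case False
      then have y: "y i = 0" if "i < r" for i using vS[OF that] by simp
      then have "(\<Sum>i<r. (y i)\<^sup>2) = 0" by simp
      then have "h\<^sup>2 = 1" using j0(2)[OF j0m] by (simp add: h_def y_def)
      then have h: "h = 1 \<or> h = -1" by (simp add: power2_eq_1_iff)
      have "T = \<bar>h\<bar> + (\<Sum>i<r. \<bar>psi_z m r w i\<bar>)" unfolding T_def h_def
        by (rule join_tot_active[OF j0m]) (use P in auto)
      moreover have "(\<Sum>i<r. \<bar>psi_z m r w i\<bar>) = 0" using P(4) y by (intro sum.neutral) (auto simp: y_def)
      ultimately have "T = 1" using h by auto
      then show False using h v0 by (auto simp: s0_def)
    qed
  qed
  show nz: "0 < blk_norm r v j" if "j < m" for j
  proof (cases "j = j0")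
    case False
    then have "blk_norm r v j = 1" using base[OF that] by (intro blk_norm_base) auto
    then show ?thesis by simp
  qed (use act that in simp)
  show "wedge_pt m r v \<in> wedge_set m r"
    by (rule wedge_pt_in[of m r v j0]) (use nz base in auto)
qed

text \<open>If the apex is 0, the total is constantly 1. If it is \<open>Suc j0\<close>, a vanishing
  total means \<open>g = 0\<close> and \<open>z = 0\<close>: either the factor relating
  \<open>z\<close> to \<open>join_z x\<close> is 0, so \<open>t = 1\<close>, \<open>s = 0\<close>
  and \<open>g = -1/N\<close>, or \<open>x\<close> is the apex itself, where
  \<open>s = N = 1\<close> and \<open>g = 1\<close>.\<close>

lemma psi_phi_homotopy:
  assumes x: "x \<in> cl_real (join_verts (Suc m) r) join_adj" and t: "0 \<le> t" "t \<le> 1"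
  defines "h \<equiv> (\<lambda>j. (1 - t) * join_h (Suc m) x j + t * psi_h m r (phi m r x) j)"
    and "z \<equiv> (\<lambda>i. (1 - t) * join_z x i + t * psi_z m r (phi m r x) i)"
  shows "join_tot (Suc m) r h z \<noteq> 0"
    "join_pt (Suc m) r h z \<in> cl_real (join_verts (Suc m) r) join_adj"
proof -
  obtain j1 where j1: "j1 < Suc m" "\<And>i. i \<noteq> j1 \<Longrightarrow> x (Inl i) = 0" "(\<Sum>i<Suc m. x (Inl i)) = x (Inl j1)"
    "x (Inl j1) + (\<Sum>i<r. \<bar>join_z x i\<bar>) = 1" "0 \<le> x (Inl j1)"
    using join_apex[OF x zero_less_Suc] by blast
  define w where "w = phi m r x"
  have w_in: "w \<in> wedge_set m r" using phi_in[OF x] by (simp add: w_def phi_def)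
  have w0: "w (j * (r+1) + e) = 0" if "j < m" "Suc j \<noteq> j1" "e \<le> r" for j e
  proof -
    have p: "phi_vec x j e = (if e = 0 then -1 else 0)" for e using j1(2)[OF that(2)] by (rule phi_vec_base)
    then have "blk_norm r (phi_vec x) j = 1" by (intro blk_norm_base) auto
    then show ?thesis using wedge_pt_at[OF that(1,3), of "phi_vec x"] p[of e] by (simp add: w_def phi_def)
  qed
  have "join_tot (Suc m) r h z \<noteq> 0 \<and> (\<forall>i j. i < Suc m \<longrightarrow> j < Suc m \<longrightarrow> 0 < h i \<longrightarrow> 0 < h j \<longrightarrow> i = j)"
  proof (cases j1)
    case 0
    have w0': "\<forall>j e. j < m \<and> e \<le> r \<longrightarrow> w (j * (r+1) + e) = 0" using w0 0 by blast
    note P = psi_inactive[OF w0']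
    have h0: "h 0 = (1 - t) * x (Inl 0) + t" using P(1) j1(3) 0 by (simp add: h_def w_def join_h_def)
    have hS: "h (Suc j) \<le> 0" if "j < m" for j
    proof -
      have "h (Suc j) = - ((1 - t) * x (Inl 0)) - t"
        using P(2)[OF that] j1(3) j1(2)[of "Suc j"] 0 by (simp add: h_def w_def join_h_def algebra_simps)
      moreover have "0 \<le> (1 - t) * x (Inl 0)" using t j1(5) 0 by simp
      ultimately show ?thesis using t by simp
    qed
    have "(\<Sum>i<r. \<bar>z i\<bar>) = (\<Sum>i<r. (1 - t) * \<bar>join_z x i\<bar>)"
      using P(3) t by (intro sum.cong) (auto simp: z_def w_def[symmetric] abs_mult)
    also have "\<dots> = (1 - t) * (1 - x (Inl 0))" using j1(4) 0 by (simp flip: sum_distrib_left)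
    finally have "join_tot (Suc m) r h z = max (h 0) 0 + (1 - t) * (1 - x (Inl 0))"
      using join_tot_base(1)[of m h r z, OF hS] by simp
    moreover have "0 \<le> h 0" using h0 t j1(5) 0 by simp
    ultimately have "join_tot (Suc m) r h z = 1" using h0 by (simp add: algebra_simps)
    then show ?thesis using join_tot_base(2)[of m h, OF hS] by auto
  next
    case (Suc j0)
    then have j0: "j0 < m" using j1(1) by simp
    have w0': "\<forall>j e. j < m \<and> j \<noteq> j0 \<and> e \<le> r \<longrightarrow> w (j * (r+1) + e) = 0" using w0 Suc by blast
    note P = psi_active[OF w0' j0]
    define s where "s = x (Inl (Suc j0))"
    define N where "N = blk_norm r (phi_vec x) j0"
    have N: "0 < N" unfolding N_def by (rule phi_vec_pos[OF x])
    have s: "0 \<le> s" "s + (\<Sum>i<r. \<bar>join_z x i\<bar>) = 1" using j1(4,5) Suc by (auto simp: s_def)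
    have wb: "w (j0 * (r+1)) = 1 + (2 * s - 1) / N"
      using wedge_pt_at[OF j0, of 0 r "phi_vec x"] by (simp add: w_def phi_def phi_vec_def N_def s_def)
    have wS: "w (j0 * (r+1) + Suc i) = s * join_z x i / N" if "i < r" for i
      using wedge_pt_at[OF j0, of "Suc i" r "phi_vec x"] that by (simp add: w_def phi_def phi_vec_def N_def s_def)
    define g where "g = (1 - t) * s + t * ((2 * s - 1) / N)"
    have sm: "(\<Sum>i<Suc m. x (Inl i)) = s" using j1(3) Suc by (simp add: s_def)
    have h0: "h 0 = - g"
    proof -
      have "psi_h m r w 0 = - ((2 * s - 1) / N)" using P(1) wb by simp
      then show ?thesis using j1(2)[of 0] Suc unfolding h_def w_def[symmetric] join_h_def sm
        by (simp add: g_def del: minus_diff_eq)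
    qed
    have hj: "h (Suc j0) = g"
      using P(2) wb unfolding h_def w_def[symmetric] join_h_def sm by (simp add: g_def s_def)
    have hS: "h (Suc j) \<le> 0" if "j < m" "j \<noteq> j0" for j
    proof -
      have "h (Suc j) = (1 - t) * (- s) - t" using P(3)[OF that] j1(2)[of "Suc j"] Suc that
        unfolding h_def w_def[symmetric] join_h_def sm by simp
      moreover have "0 \<le> (1 - t) * s" using t s by simp
      ultimately show ?thesis using t by simp
    qed
    have zi: "z i = join_z x i * ((1 - t) + t * (s / N))" if "i < r" for i
      using P(4)[OF that] wS[OF that] unfolding z_def w_def[symmetric] by (simp add: algebra_simps)
    have tot: "join_tot (Suc m) r h z = \<bar>g\<bar> + (\<Sum>i<r. \<bar>z i\<bar>)"
      by (rule join_tot_active(1)[OF j0 h0 hj hS])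
    have "join_tot (Suc m) r h z \<noteq> 0"
    proof
      assume "join_tot (Suc m) r h z = 0"
      then have g0: "g = 0" and z0: "(\<Sum>i<r. \<bar>z i\<bar>) = 0" unfolding tot
        by (smt (verit) sum_nonneg abs_ge_zero)+
      then have z0: "z i = 0" if "i < r" for i using that by (simp add: sum_nonneg_eq_0_iff)
      show False
      proof (cases "(1 - t) + t * (s / N) = 0")
        case True
        have "0 \<le> t * (s / N)" using t s N by simp
        then have "t = 1" "s / N = 0" using True t by (auto simp: add_nonneg_eq_0_iff)
        then show False using g0 N by (simp add: g_def)
      next
        case False
        then have "(\<Sum>i<r. \<bar>join_z x i\<bar>) = 0" using z0 zi by simp
        then have s1: "s = 1" and "\<And>i. i < r \<Longrightarrow> join_z x i = 0" using s by (auto simp: sum_nonneg_eq_0_iff)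
        then have "N = 1" by (simp add: N_def blk_norm_def sum.atMost_shift phi_vec_def s_def)
        then show False using g0 s1 by (simp add: g_def)
      qed
    qed
    then show ?thesis using join_tot_active(2)[OF j0 h0 hj hS] by auto
  qed
  then show "join_tot (Suc m) r h z \<noteq> 0"
    "join_pt (Suc m) r h z \<in> cl_real (join_verts (Suc m) r) join_adj"
    using join_pt_in[of "Suc m" r h z] by auto
qed

lemma join_homotopy_equivalent_wedge:
  "clique_complex_space (join_verts (Suc m) r) join_adj homotopy_equivalent_space wedge_spheres m r"
proof -
  define Y where "Y = cl_real (join_verts (Suc m) r) join_adj"
  define W where "W = wedge_set m r"
  have phi: "phi m r x \<in> W" if "x \<in> Y" for x using phi_in that by (simp add: phi_def W_def Y_def)
  have psi: "psi m r w \<in> Y" if "w \<in> W" for w using psi_in that by (simp add: W_def Y_def)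
  have cphi: "continuous_on Y (phi m r)" and cpsi: "continuous_on W (psi m r)"
    using phi_cont psi_cont by (simp_all add: W_def Y_def)
  have "homotopic_with (\<lambda>_. True) (top_of_set W) (top_of_set W) id (phi m r \<circ> psi m r)"
  proof (rule homotopic_top_of_setI[where h="\<lambda>t w. wedge_pt m r (\<lambda>j e. (1 - t) * wedge_vec r w j e + t * phi_vec (psi m r w) j e)"])
    have c: "continuous_on ({0..1} \<times> W) (\<lambda>p. psi m r (snd p) u)" for u
      by (rule continuous_on_product_then_coordinatewise, rule continuous_on_compose2[OF cpsi])
        (auto intro: continuous_intros)
    show "continuous_on ({0..1} \<times> W) (\<lambda>p. wedge_pt m r (\<lambda>j e. (1 - fst p) * wedge_vec r (snd p) j e + fst p * phi_vec (psi m r (snd p)) j e))"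
    proof (rule continuous_on_wedge_pt)
      fix j e
      show "continuous_on ({0..1} \<times> W) (\<lambda>p. (1 - fst p) * wedge_vec r (snd p) j e + fst p * phi_vec (psi m r (snd p)) j e)"
        unfolding wedge_vec_def phi_vec_def join_z_def
        by (cases "e = 0") (auto intro!: continuous_intros c)
    qed (auto simp: W_def phi_psi_homotopy(1))
  qed (auto simp: W_def phi_psi_homotopy(2) wedge_pt_vec phi_def)
  moreover have "homotopic_with (\<lambda>_. True) (top_of_set Y) (top_of_set Y) id (psi m r \<circ> phi m r)"
  proof (rule homotopic_top_of_setI[where h="\<lambda>t x. join_pt (Suc m) r (\<lambda>j. (1 - t) * join_h (Suc m) x j + t * psi_h m r (phi m r x) j)
       (\<lambda>i. (1 - t) * join_z x i + t * psi_z m r (phi m r x) i)"])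
    have c: "continuous_on ({0..1} \<times> Y) (\<lambda>p. phi m r (snd p) u)" for u
      by (rule continuous_on_product_then_coordinatewise, rule continuous_on_compose2[OF cphi])
        (auto intro: continuous_intros)
    show "continuous_on ({0..1} \<times> Y) (\<lambda>p. join_pt (Suc m) r (\<lambda>j. (1 - fst p) * join_h (Suc m) (snd p) j + fst p * psi_h m r (phi m r (snd p)) j)
       (\<lambda>i. (1 - fst p) * join_z (snd p) i + fst p * psi_z m r (phi m r (snd p)) i))"
    proof (rule continuous_on_join_pt)
      fix j
      show "continuous_on ({0..1} \<times> Y) (\<lambda>p. (1 - fst p) * join_h (Suc m) (snd p) j + fst p * psi_h m r (phi m r (snd p)) j)"
        unfolding join_h_def psi_h_def
        by (cases j) (auto intro!: continuous_intros c simp del: sum.lessThan_Suc)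
      show "continuous_on ({0..1} \<times> Y) (\<lambda>p. (1 - fst p) * join_z (snd p) j + fst p * psi_z m r (phi m r (snd p)) j)"
        unfolding join_z_def psi_z_def by (intro continuous_intros c)
    qed (use psi_phi_homotopy(1) in \<open>auto simp: Y_def\<close>)
  qed (use psi_phi_homotopy(2) in \<open>auto simp: Y_def join_pt_h_z psi_def\<close>)
  ultimately show ?thesis
    unfolding homotopy_equivalent_space_def clique_complex_space_eq wedge_spheres_eq Y_def[symmetric] W_def[symmetric]
    using phi psi cphi cpsi
    by (intro exI[of _ "phi m r"] exI[of _ "psi m r"])
      (auto simp: continuous_map_in_subtopology homotopic_with_symD)
qed

lemma wedge_one_homotopy_equivalent_nsphere: "wedge_spheres 1 r homotopy_equivalent_space nsphere r"
proof -
  define S where "S = {x :: nat \<Rightarrow> real. (\<Sum>i\<le>r. x i ^ 2) = 1 \<and> (\<forall>i>r. x i = 0)}"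
  have S: "nsphere r = top_of_set S"
    unfolding nsphere S_def euclidean_product_topology by simp
  have W: "wedge_set 1 r = {w. (\<forall>q>r. w q = 0) \<and> (\<Sum>e\<le>r. (w e - (if e = 0 then 1 else 0))\<^sup>2) = 1}"
    unfolding wedge_set_def by (auto simp: Suc_le_eq)
  define f where "f = (\<lambda>(w::nat\<Rightarrow>real) q. w q - (if q = 0 then 1 else 0))"
  define g where "g = (\<lambda>(w::nat\<Rightarrow>real) q. w q + (if q = 0 then 1 else 0))"
  have "continuous_on A f" "continuous_on A g" for A
    unfolding f_def g_def by (intro continuous_on_coordinatewise_then_product continuous_intros)+
  moreover have "f w \<in> S" if "w \<in> wedge_set 1 r" for w
    using that unfolding W S_def f_def by auto
  moreover have "g w \<in> wedge_set 1 r" if "w \<in> S" for w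
    using that unfolding W S_def g_def by auto
  moreover have "f (g w) = w" "g (f w) = w" for w by (auto simp: f_def g_def)
  ultimately have "homeomorphic_maps (wedge_spheres 1 r) (nsphere r) f g"
    unfolding homeomorphic_maps_def wedge_spheres_eq S by auto
  then show ?thesis
    by (metis homeomorphic_imp_homotopy_equivalent_space homeomorphic_space_def)
qed

section \<open>Strong collapses and suspensions\<close>

text \<open>Domination in the undirected sense: the closed neighbourhood of \<open>u\<close> lies in
  that of \<open>w\<close>. Orientation is dropped here since the complex does not see it.\<close>

inductive strong_collapse :: "('a \<Rightarrow> 'a \<Rightarrow> bool) \<Rightarrow> 'a set \<Rightarrow> 'a set \<Rightarrow> bool" for E V where
  strong_collapse_refl: "strong_collapse E V V"
| strong_collapse_step: "strong_collapse E V W \<Longrightarrow> u \<in> W \<Longrightarrow> w \<in> W \<Longrightarrow> u \<noteq> w \<Longrightarrow> E u w \<or> E w u \<Longrightarrow>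
    (\<And>x. x \<in> W \<Longrightarrow> x \<noteq> u \<Longrightarrow> x \<noteq> w \<Longrightarrow> E x u \<or> E u x \<Longrightarrow> E x w \<or> E w x) \<Longrightarrow>
    strong_collapse E V (W - {u})"

lemma strong_collapse_subset: "strong_collapse E V W \<Longrightarrow> W \<subseteq> V"
  by (induction rule: strong_collapse.induct) auto

lemma strong_collapse_trans:
  assumes "strong_collapse E V W" "strong_collapse E U V" shows "strong_collapse E U W"
  using assms(1)
proof (induction rule: strong_collapse.induct)
  case strong_collapse_refl show ?case by fact
next
  case (strong_collapse_step W u w)
  show ?case by (rule strong_collapse.strong_collapse_step[of E U W u w]) (use strong_collapse_step in blast)+
qed

lemma strong_collapse_equiv:
  assumes "strong_collapse E V W" "finite V"
  shows "clique_complex_space V E homotopy_equivalent_space clique_complex_space W E"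
  using assms(1)
proof (induction rule: strong_collapse.induct)
  case strong_collapse_refl show ?case by (rule homotopy_equivalent_space_refl)
next
  case (strong_collapse_step W u w)
  have "finite W" using strong_collapse_subset[OF strong_collapse_step(1)] assms(2) finite_subset by blast
  then have "clique_complex_space W E homotopy_equivalent_space clique_complex_space (W - {u}) E"
    by (rule clique_complex_remove_dominated[where w = w]) (use strong_collapse_step in blast)+
  then show ?case using strong_collapse_step.IH homotopy_eqv_trans by blast
qed

lemma strong_collapse_cong:
  assumes "strong_collapse E V W" and "\<And>x y. x \<in> V \<Longrightarrow> y \<in> V \<Longrightarrow> E x y = E' x y"
  shows "strong_collapse E' V W"
  using assms(1)
proof (induction rule: strong_collapse.induct)
  case strong_collapse_refl show ?case by (rule strong_collapse.strong_collapse_refl)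
next
  case (strong_collapse_step W u w)
  have WV: "W \<subseteq> V" using strong_collapse_subset[OF strong_collapse_step(1)] .
  show ?case
    by (rule strong_collapse.strong_collapse_step[of E' V W u w])
      (use strong_collapse_step WV assms(2) in \<open>auto simp: subset_iff\<close>)
qed

text \<open>New, pairwise non-adjacent vertices \<open>Inl i\<close> are coned off over the
  prescribed sets \<open>A i\<close>. All intermediate stages of the suspension arguments have this
  form.\<close>

fun cone_rel :: "(nat \<Rightarrow> 'a \<Rightarrow> bool) \<Rightarrow> ('a \<Rightarrow> 'a \<Rightarrow> bool) \<Rightarrow> nat + 'a \<Rightarrow> nat + 'a \<Rightarrow> bool" where
  "cone_rel A E (Inl i) (Inl j) = False"
| "cone_rel A E (Inl i) (Inr a) = A i a"
| "cone_rel A E (Inr a) (Inl i) = A i a"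
| "cone_rel A E (Inr a) (Inr b) = E a b"

abbreviation points_join :: "nat \<Rightarrow> 'a set \<Rightarrow> ('a \<Rightarrow> 'a \<Rightarrow> bool) \<Rightarrow> (nat + 'a \<Rightarrow> real) topology" where
  "points_join d L E \<equiv> clique_complex_space (Inl ` {..<d} \<union> Inr ` L) (cone_rel (\<lambda>_ _. True) E)"

lemma points_join_strong_collapse:
  assumes "strong_collapse E V W" "finite V"
  shows "points_join d V E homotopy_equivalent_space points_join d W E"
proof -
  let ?R = "cone_rel (\<lambda>_ _. True) E"
  have "strong_collapse ?R (Inl ` {..<d} \<union> Inr ` V) (Inl ` {..<d} \<union> Inr ` W)"
    using assms(1)
  proof (induction rule: strong_collapse.induct)
    case strong_collapse_refl show ?case by (rule strong_collapse.strong_collapse_refl)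
  next
    case (strong_collapse_step W u w)
    have eq: "Inl ` {..<d} \<union> Inr ` (W - {u}) = (Inl ` {..<d} \<union> Inr ` W) - {Inr u}" by auto
    show ?case unfolding eq
    proof (rule strong_collapse.strong_collapse_step[where w = "Inr w"])
      fix x assume x: "x \<in> Inl ` {..<d} \<union> Inr ` W" "x \<noteq> Inr u" "x \<noteq> Inr w" "?R x (Inr u) \<or> ?R (Inr u) x"
      show "?R x (Inr w) \<or> ?R (Inr w) x"
      proof (cases x)
        case (Inr a)
        then have "a \<in> W" "a \<noteq> u" "a \<noteq> w" "E a u \<or> E u a" using x by auto
        then show ?thesis using strong_collapse_step.hyps(6) Inr by simp
      qed simp
    qed (use strong_collapse_step in auto)
  qed
  then show ?thesis using strong_collapse_equiv assms(2) by blast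
qed

section \<open>Added cone points and suspensions\<close>

lemma image_Inr_equiv:
  assumes "finite V"
  shows "clique_complex_space (Inr ` V) (cone_rel A E) homotopy_equivalent_space clique_complex_space V E"
  by (subst homotopy_equivalent_space_sym, rule clique_complex_iso[of Inr]) (use assms in \<open>auto simp: bij_betw_def\<close>)

lemma insert_Inl_equiv:
  assumes "finite W" "v \<notin> W" and "\<And>a. a \<in> W \<Longrightarrow> (E v a \<or> E a v) \<longleftrightarrow> A i a"
  shows "clique_complex_space (insert v W) E homotopy_equivalent_space
    clique_complex_space (insert (Inl i) (Inr ` W)) (cone_rel A E)"
proof (rule clique_complex_iso[of "\<lambda>a. if a = v then Inl i else Inr a"])
  show "bij_betw (\<lambda>a. if a = v then Inl i else Inr a) (insert v W) (insert (Inl i) (Inr ` W))"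
    using assms(2) by (auto simp: bij_betw_def inj_on_def)
qed (use assms in \<open>auto split: if_splits\<close>)

lemma add_cone_vertex:
  assumes "finite X" "X = Inl ` I \<union> Inr ` W" "i \<notin> I" and B: "B = {a\<in>W. A i a}" "B \<noteq> {}"
    and "contractible_space (clique_complex_space B E)"
  shows "clique_complex_space (insert (Inl i) X) (cone_rel A E) homotopy_equivalent_space clique_complex_space X (cone_rel A E)"
proof -
  have finW: "finite W" using assms(1,2) by (auto dest: finite_imageD)
  have nb: "{u \<in> insert (Inl i) X. u \<noteq> Inl i \<and> (cone_rel A E u (Inl i) \<or> cone_rel A E (Inl i) u)} = Inr ` B"
    using assms(2) B(1) by auto
  have "contractible_space (clique_complex_space (Inr ` B) (cone_rel A E))"
    using image_Inr_equiv[of B A E] finW B assms(6) homotopy_equivalent_space_contractibility by force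
  then have "clique_complex_space (insert (Inl i) X) (cone_rel A E) homotopy_equivalent_space
      clique_complex_space (insert (Inl i) X - {Inl i}) (cone_rel A E)"
    using assms(1) B(2) by (intro clique_complex_remove_vertex[OF _ _ nb[symmetric]]) auto
  moreover have "insert (Inl i) X - {Inl i} = X" using assms(2,3) by auto
  ultimately show ?thesis by simp
qed

text \<open>A second cone point \<open>Inl 1\<close> over the whole contractible rest changes
  nothing up to homotopy. It then dominates every non-neighbour of \<open>v\<close>, and removing
  these leaves two cone points over \<open>L\<close>.\<close>

lemma suspension_equiv:
  assumes fin: "finite V" and v: "v \<in> V" and L: "L = {u\<in>V. u \<noteq> v \<and> (E u v \<or> E v u)}"
    and ne: "V - {v} \<noteq> {}" and con: "contractible_space (clique_complex_space (V - {v}) E)"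
  shows "clique_complex_space V E homotopy_equivalent_space points_join 2 L E"
proof -
  define A where "A = (\<lambda>i::nat. \<lambda>a. i = 0 \<longrightarrow> a \<in> L)"
  let ?R = "cone_rel A E"
  have 1: "clique_complex_space V E homotopy_equivalent_space clique_complex_space (insert (Inl 0) (Inr ` (V - {v}))) ?R"
  proof -
    have "insert v (V - {v}) = V" using v by auto
    then show ?thesis using insert_Inl_equiv[of "V - {v}" v E A 0] fin L by (auto simp: A_def)
  qed
  have 2: "clique_complex_space (insert (Inl 1) (insert (Inl 0) (Inr ` (V - {v})))) ?R homotopy_equivalent_space
     clique_complex_space (insert (Inl 0) (Inr ` (V - {v}))) ?R"
    by (rule add_cone_vertex[of _ "{0}" "V - {v}" 1 "V - {v}"]) (use fin ne con in \<open>auto simp: A_def\<close>)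
  have sc: "strong_collapse ?R (Inl ` {0,1} \<union> Inr ` (V - {v})) (Inl ` {0,1} \<union> Inr ` (V - {v} - U))"
    if "finite U" "U \<subseteq> V - {v} - L" for U
    using that
  proof (induction U rule: finite_induct)
    case empty
    then show ?case by (simp add: strong_collapse_refl)
  next
    case (insert u U)
    have eq: "Inl ` {0,1} \<union> Inr ` (V - {v} - insert u U) = (Inl ` {0,1} \<union> Inr ` (V - {v} - U)) - {Inr u}" by auto
    show ?case unfolding eq
      by (rule strong_collapse_step[where w = "Inl 1"]) (use insert in \<open>auto simp: A_def\<close>)
  qed
  have LV: "V - {v} - (V - {v} - L) = L" using L by auto
  have two: "Inl ` {0,1} = Inl ` {..<2::nat}" by (auto simp: numeral_2_eq_2 lessThan_Suc)
  have "strong_collapse ?R (Inl ` {0,1} \<union> Inr ` (V - {v})) (Inl ` {0,1} \<union> Inr ` L)"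
    using sc[of "V - {v} - L"] fin LV by simp
  then have 3: "clique_complex_space (Inl ` {0,1} \<union> Inr ` (V - {v})) ?R homotopy_equivalent_space
     clique_complex_space (Inl ` {0,1} \<union> Inr ` L) ?R"
    using strong_collapse_equiv fin by blast
  have 4: "clique_complex_space (Inl ` {..<2} \<union> Inr ` L) ?R homotopy_equivalent_space points_join 2 L E"
    by (rule clique_complex_cong) (use fin L in \<open>auto simp: A_def\<close>)
  have eq: "insert (Inl 1) (insert (Inl 0) (Inr ` (V - {v}))) = Inl ` {0,1} \<union> Inr ` (V - {v})" by auto
  show ?thesis using 1 2 3 4 unfolding eq two
    by (meson homotopy_equivalent_space_sym homotopy_eqv_trans)
qed

text \<open>The vertices \<open>w j\<close> are replaced in turn by copies \<open>Inl j\<close> of \<open>v\<close>: the copy is first added with the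
  contractible link \<open>insert (w j) L\<close>, and afterwards the link of \<open>w j\<close> is contractible as well.\<close>

lemma multi_suspension_equiv:
  fixes w :: "nat \<Rightarrow> 'a"
  assumes fin: "finite L" and v: "v \<notin> L" "v \<notin> w ` {1..q}" and w: "inj_on w {1..q}" "w ` {1..q} \<inter> L = {}"
    and vL: "\<And>a. a \<in> L \<Longrightarrow> E v a \<or> E a v" and vw: "\<And>j. j \<in> {1..q} \<Longrightarrow> \<not> E v (w j) \<and> \<not> E (w j) v"
    and con1: "\<And>j. j \<in> {1..q} \<Longrightarrow> contractible_space (clique_complex_space (insert (w j) L) E)"
    and con2: "\<And>j. j \<in> {1..q} \<Longrightarrow> contractible_space (clique_complex_space
       (insert v {a \<in> L \<union> w ` {j<..q}. E a (w j) \<or> E (w j) a}) E)"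
  shows "clique_complex_space (insert v (L \<union> w ` {1..q})) E homotopy_equivalent_space points_join (Suc q) L E"
proof -
  \<comment> \<open>\<open>Inl 0\<close> stands for \<open>v\<close>; copy \<open>i \<ge> 1\<close>
    is adjacent to \<open>L\<close> and to its partner \<open>w i\<close>. At stage
    \<open>X j\<close> the vertices \<open>w 1, ..., w j\<close> have been exchanged.\<close>
  define A where "A = (\<lambda>i a. a \<in> L \<or> (i \<in> {1..q} \<and> a = w i))"
  let ?R = "cone_rel A E"
  define X where "X = (\<lambda>j. Inl ` {..<Suc j} \<union> Inr ` (L \<union> w ` {j<..q}))"
  have finX: "finite (X j)" for j using fin by (simp add: X_def)
  have 0: "clique_complex_space (insert v (L \<union> w ` {1..q})) E homotopy_equivalent_space clique_complex_space (X 0) ?R"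
  proof -
    have "X 0 = insert (Inl 0) (Inr ` (L \<union> w ` {1..q}))" by (auto simp: X_def)
    moreover have "clique_complex_space (insert v (L \<union> w ` {1..q})) E homotopy_equivalent_space
      clique_complex_space (insert (Inl 0) (Inr ` (L \<union> w ` {1..q}))) ?R"
    proof (rule insert_Inl_equiv)
      fix a assume "a \<in> L \<union> w ` {1..q}"
      moreover have "w a \<notin> L" if "a \<in> {1..q}" for a using w(2) that by blast
      ultimately show "(E v a \<or> E a v) \<longleftrightarrow> A 0 a" using vL vw unfolding A_def by fastforce
    qed (use fin v in auto)
    ultimately show ?thesis by simp
  qed
  have step: "clique_complex_space (X j) ?R homotopy_equivalent_space clique_complex_space (X (Suc j)) ?R" if j: "j < q" for j
  proof -
    let ?j = "Suc j"
    have jq: "?j \<in> {1..q}" using j by simp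
    have wj: "w ?j \<notin> L" using w(2) jq by blast
    have winj: "w i = w i' \<longleftrightarrow> i = i'" if "i \<in> {1..q}" "i' \<in> {1..q}" for i i' using inj_on_eq_iff[OF w(1)] that by blast
    have 1: "clique_complex_space (insert (Inl ?j) (X j)) ?R homotopy_equivalent_space clique_complex_space (X j) ?R"
    proof (rule add_cone_vertex[of _ "{..<Suc j}" "L \<union> w ` {j<..q}"])
      show "insert (w ?j) L = {a \<in> L \<union> w ` {j<..q}. A ?j a}" using jq by (auto simp: A_def)
    qed (use finX con1[OF jq] in \<open>auto simp: X_def\<close>)
    define B where "B = {a \<in> L \<union> w ` {?j<..q}. E a (w ?j) \<or> E (w ?j) a}"
    have memI: "w i \<noteq> w ?j" if "i \<in> {1..q}" "i \<noteq> ?j" for i using winj[OF that(1) jq] that(2) by blast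
    have wnot: "w ?j \<notin> w ` {?j<..q}"
    proof
      assume "w ?j \<in> w ` {?j<..q}"
      then obtain i where "i \<in> {?j<..q}" "w ?j = w i" by blast
      then show False using memI[of i] by simp
    qed
    have nb: "{u \<in> insert (Inl ?j) (X j). u \<noteq> Inr (w ?j) \<and> (?R u (Inr (w ?j)) \<or> ?R (Inr (w ?j)) u)} = insert (Inl ?j) (Inr ` B)"
    proof (rule set_eqI)
      fix u show "u \<in> {u \<in> insert (Inl ?j) (X j). u \<noteq> Inr (w ?j) \<and> (?R u (Inr (w ?j)) \<or> ?R (Inr (w ?j)) u)} \<longleftrightarrow> u \<in> insert (Inl ?j) (Inr ` B)"
      proof (cases u)
        case (Inl i)
        have "A i (w ?j) \<longleftrightarrow> i = ?j" using wj jq winj unfolding A_def by blast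
        then show ?thesis using Inl by (auto simp: X_def)
      next
        case (Inr a)
        have "a \<in> L \<union> w ` {j<..q} \<and> a \<noteq> w ?j \<longleftrightarrow> a \<in> L \<union> w ` {?j<..q}"
        proof -
          have "{j<..q} = insert ?j {?j<..q}" using j by auto
          then have "w ` {j<..q} = insert (w ?j) (w ` {?j<..q})" by simp
          then show ?thesis using wj wnot by blast
        qed
        then show ?thesis using Inr by (auto simp: X_def B_def)
      qed
    qed
    have vB: "v \<notin> B" using v jq unfolding B_def by fastforce
    \<comment> \<open>Within \<open>B\<close> the copy is adjacent exactly to the part in
      \<open>L\<close>, just as \<open>v\<close> is, so the assumption \<open>con2\<close> about
      \<open>v\<close> applies to it.\<close>
    have "clique_complex_space (insert v B) E homotopy_equivalent_space clique_complex_space (insert (Inl ?j) (Inr ` B)) ?R"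
    proof (rule insert_Inl_equiv)
      show "finite B" using fin by (auto simp: B_def)
      fix a assume a: "a \<in> B"
      show "(E v a \<or> E a v) \<longleftrightarrow> A ?j a"
      proof (cases "a \<in> L")
        case True then show ?thesis using vL by (simp add: A_def)
      next
        case False
        then obtain i where i: "i \<in> {?j<..q}" "a = w i" using a unfolding B_def by blast
        then have "\<not> E v a \<and> \<not> E a v" using vw[of i] by simp
        moreover have "a \<noteq> w ?j" using i memI by simp
        ultimately show ?thesis using False by (simp add: A_def)
      qed
    qed fact
    then have "contractible_space (clique_complex_space (insert (Inl ?j) (Inr ` B)) ?R)"
      using con2[OF jq] homotopy_equivalent_space_contractibility unfolding B_def[symmetric] by blast
    then have 2: "clique_complex_space (insert (Inl ?j) (X j)) ?R homotopy_equivalent_space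
       clique_complex_space (insert (Inl ?j) (X j) - {Inr (w ?j)}) ?R"
      using finX j by (intro clique_complex_remove_vertex[OF _ _ nb[symmetric]]) (auto simp: X_def)
    have "insert (Inl ?j) (X j) - {Inr (w ?j)} = X ?j"
    proof -
      have "{j<..q} = insert ?j {?j<..q}" using j by auto
      then have e: "w ` {j<..q} = insert (w ?j) (w ` {?j<..q})" by simp
      have "Inr ` (L \<union> w ` {j<..q}) - {Inr (w ?j)} = (Inr ` (L \<union> w ` {?j<..q}) :: (nat + 'a) set)"
        unfolding e using wj wnot by blast
      moreover have "insert (Inl ?j) (X j) - {Inr (w ?j)} = Inl ` {..<Suc ?j} \<union> (Inr ` (L \<union> w ` {j<..q}) - {Inr (w ?j)})"
        unfolding X_def lessThan_Suc by blast
      ultimately show ?thesis unfolding X_def by simp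
    qed
    then show ?thesis using 1 2 by (metis homotopy_equivalent_space_sym homotopy_eqv_trans)
  qed
  have "clique_complex_space (X 0) ?R homotopy_equivalent_space clique_complex_space (X j) ?R" if "j \<le> q" for j
    using that
  proof (induction j)
    case 0 show ?case by (rule homotopy_equivalent_space_refl)
  next
    case (Suc j) then show ?case using step[of j] homotopy_eqv_trans by (metis Suc_leD Suc_le_lessD)
  qed
  then have "clique_complex_space (X 0) ?R homotopy_equivalent_space clique_complex_space (X q) ?R" by simp
  moreover have "clique_complex_space (X q) ?R homotopy_equivalent_space points_join (Suc q) L E"
  proof -
    have "X q = Inl ` {..<Suc q} \<union> Inr ` L" by (simp add: X_def)
    then show ?thesis using fin by (simp only:) (rule clique_complex_cong, auto simp: A_def)
  qed
  ultimately show ?thesis using 0 homotopy_eqv_trans by blast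
qed

lemma points_join_cross:
  assumes bij: "bij_betw g P ({..<r} \<times> (UNIV :: bool set))" and fin: "finite P"
    and adj: "\<And>a b. a \<in> P \<Longrightarrow> b \<in> P \<Longrightarrow> a \<noteq> b \<Longrightarrow> (E a b \<or> E b a) \<longleftrightarrow> fst (g a) \<noteq> fst (g b)"
  shows "points_join d P E homotopy_equivalent_space clique_complex_space (join_verts d r) join_adj"
proof (rule clique_complex_iso[of "map_sum (id :: nat \<Rightarrow> nat) g"])
  have "inj_on g P" "g ` P = {..<r} \<times> UNIV" using bij by (auto simp: bij_betw_def)
  moreover have "map_sum (id :: nat \<Rightarrow> nat) g ` (Inl ` {..<d} \<union> Inr ` P) = Inl ` {..<d} \<union> Inr ` (g ` P)"
    by (simp add: image_Un image_image)
  moreover have "inj_on (map_sum (id :: nat \<Rightarrow> nat) g) (Inl ` {..<d} \<union> Inr ` P)"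
    by (rule inj_onI) (auto dest: inj_onD[OF \<open>inj_on g P\<close>])
  ultimately show "bij_betw (map_sum (id :: nat \<Rightarrow> nat) g) (Inl ` {..<d} \<union> Inr ` P) (join_verts d r)"
    by (simp add: bij_betw_def join_verts_def)
next
  fix u v assume uv: "u \<in> Inl ` {..<d} \<union> Inr ` P" "v \<in> Inl ` {..<d} \<union> Inr ` P" "u \<noteq> v"
  show "cone_rel (\<lambda>_ _. True) E u v \<or> cone_rel (\<lambda>_ _. True) E v u \<longleftrightarrow>
     join_adj (map_sum (id :: nat \<Rightarrow> nat) g u) (map_sum id g v) \<or> join_adj (map_sum id g v) (map_sum id g u)"
  proof (cases u; cases v)
    fix a b assume "u = Inr a" "v = Inr b"
    then show ?thesis using uv adj[of a b] by auto
  qed auto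
qed (use fin in simp)

section \<open>Periodic monotone maps\<close>

text \<open>The vertices are the residues of \<open>V\<close> modulo \<open>n\<close>, and \<open>F x\<close> is the last out-neighbour of \<open>x\<close>
  (or \<open>x\<close> itself if there is none). The condition \<open>F (F x) < x + n\<close> excludes opposite edges.\<close>

definition cyc :: "int \<Rightarrow> int set \<Rightarrow> (int \<Rightarrow> int) \<Rightarrow> bool" where
  "cyc n V F \<longleftrightarrow> 0 < n \<and> V \<noteq> {} \<and> (\<forall>x. x + n \<in> V \<longleftrightarrow> x \<in> V) \<and>
     (\<forall>x\<in>V. F x \<in> V \<and> x \<le> F x \<and> F (x + n) = F x + n \<and> F (F x) < x + n) \<and>
     (\<forall>x\<in>V. \<forall>y\<in>V. x \<le> y \<longrightarrow> F x \<le> F y)"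

definition cedge :: "int \<Rightarrow> (int \<Rightarrow> int) \<Rightarrow> int \<Rightarrow> int \<Rightarrow> bool" where
  "cedge n F x y \<longleftrightarrow> (\<exists>m. x < y + m * n \<and> y + m * n \<le> F x)"

abbreviation residues :: "int \<Rightarrow> int set \<Rightarrow> int set" where
  "residues n V \<equiv> V \<inter> {0..<n}"

lemma shift_mem:
  fixes n :: int
  assumes "\<forall>x. x + n \<in> V \<longleftrightarrow> x \<in> V" shows "x + m * n \<in> V \<longleftrightarrow> x \<in> V"
proof (induction m rule: int_induct[of _ 0])
  case (step1 i) then show ?case using assms[rule_format, of "x + i * n"] by (simp add: algebra_simps)
next
  case (step2 i) then show ?case using assms[rule_format, of "x + (i - 1) * n"] by (simp add: algebra_simps)
qed simp

lemma mod_mem: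
  fixes n :: int
  assumes "\<forall>x. x + n \<in> V \<longleftrightarrow> x \<in> V" shows "x mod n \<in> V \<longleftrightarrow> x \<in> V"
  using shift_mem[OF assms, of "x mod n" "x div n"] by (simp add: mult.commute)

lemma cycD:
  assumes "cyc n V F"
  shows "0 < n" "V \<noteq> {}" "\<forall>x. x + n \<in> V \<longleftrightarrow> x \<in> V" "x \<in> V \<Longrightarrow> F x \<in> V" "x \<in> V \<Longrightarrow> x \<le> F x"
    "x \<in> V \<Longrightarrow> F (F x) < x + n" "x \<in> V \<Longrightarrow> y \<in> V \<Longrightarrow> x \<le> y \<Longrightarrow> F x \<le> F y" "x \<in> V \<Longrightarrow> F x < x + n"
proof -
  show "F x < x + n" if "x \<in> V"
  proof -
    have "F x \<in> V" "F (F x) < x + n" using assms that unfolding cyc_def by blast+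
    moreover have "F x \<le> F (F x)" using assms \<open>F x \<in> V\<close> unfolding cyc_def by blast
    ultimately show ?thesis by simp
  qed
qed (use assms in \<open>auto simp: cyc_def\<close>)

lemma cyc_shift:
  assumes "cyc n V F" "x \<in> V" shows "F (x + m * n) = F x + m * n"
proof (induction m rule: int_induct[of _ 0])
  case (step1 i)
  have "x + i * n \<in> V" using shift_mem[OF cycD(3)[OF assms(1)]] assms(2) by simp
  then have "F (x + i * n + n) = F (x + i * n) + n" using assms(1) unfolding cyc_def by blast
  then show ?case using step1 by (simp add: algebra_simps)
next
  case (step2 i)
  have "x + (i - 1) * n \<in> V" using shift_mem[OF cycD(3)[OF assms(1)]] assms(2) by simp
  then have "F (x + (i - 1) * n + n) = F (x + (i - 1) * n) + n" using assms(1) unfolding cyc_def by blast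
  then show ?case using step2 by (simp add: algebra_simps)
qed simp

lemma cyc_funpow:
  assumes "cyc n V F" "x \<in> V"
  shows "(F ^^ i) x \<in> V" "(F ^^ i) (x + m * n) = (F ^^ i) x + m * n"
proof -
  show *: "(F ^^ i) x \<in> V" for i by (induction i) (use assms cycD(4) in auto)
  show "(F ^^ i) (x + m * n) = (F ^^ i) x + m * n"
    by (induction i) (use cyc_shift[OF assms(1)] * in auto)
qed

lemma cyc_funpow_mono:
  assumes "cyc n V F" "x \<in> V" "y \<in> V" "x \<le> y" shows "(F ^^ i) x \<le> (F ^^ i) y"
  by (induction i) (use assms cycD(7) cyc_funpow in auto)

lemma cedge_shift_right: "cedge n F x (y + m * n) \<longleftrightarrow> cedge n F x y"
proof
  assume "cedge n F x (y + m * n)"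
  then obtain k where "x < y + m * n + k * n" "y + m * n + k * n \<le> F x" unfolding cedge_def by blast
  then show "cedge n F x y" unfolding cedge_def by (intro exI[of _ "m + k"]) (simp add: algebra_simps)
next
  assume "cedge n F x y"
  then obtain k where "x < y + k * n" "y + k * n \<le> F x" unfolding cedge_def by blast
  then show "cedge n F x (y + m * n)" unfolding cedge_def by (intro exI[of _ "k - m"]) (simp add: algebra_simps)
qed

lemma cedge_shift_left: "F (x + m * n) = F x + m * n \<Longrightarrow> cedge n F (x + m * n) y \<longleftrightarrow> cedge n F x y"
  unfolding cedge_def
proof safe
  fix k assume "F (x + m * n) = F x + m * n" "x + m * n < y + k * n" "y + k * n \<le> F (x + m * n)"
  then show "\<exists>k. x < y + k * n \<and> y + k * n \<le> F x" by (intro exI[of _ "k - m"]) (simp add: algebra_simps)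
next
  fix k assume "F (x + m * n) = F x + m * n" "x < y + k * n" "y + k * n \<le> F x"
  then show "\<exists>k. x + m * n < y + k * n \<and> y + k * n \<le> F (x + m * n)" by (intro exI[of _ "k + m"]) (simp add: algebra_simps)
qed

lemma cedge_mod_right: "cedge n F x (y mod n) \<longleftrightarrow> cedge n F x y"
  using cedge_shift_right[of n F x "y mod n" "y div n"] by (simp add: mult.commute)

lemma cedge_mod_left:
  assumes "cyc n V F" "x \<in> V" shows "cedge n F (x mod n) y \<longleftrightarrow> cedge n F x y"
proof -
  have "F (x mod n + (x div n) * n) = F (x mod n) + (x div n) * n"
    by (rule cyc_shift[OF assms(1)]) (use mod_mem cycD(3)[OF assms(1)] assms(2) in blast)
  then show ?thesis using cedge_shift_left[of F "x mod n" "x div n" n y] by (simp add: mult.commute)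
qed

lemma cyc_subset:
  assumes "cyc n V F" "W \<subseteq> V" "F ` V \<subseteq> W" "\<forall>x. x + n \<in> W \<longleftrightarrow> x \<in> W"
  shows "cyc n W F"
  using assms unfolding cyc_def by (auto simp: subset_iff)

text \<open>A vertex outside the image of \<open>F\<close> is dominated by its successor.\<close>

lemma cyc_remove:
  assumes c: "cyc n V F" and x: "x \<in> V" "x \<notin> F ` V"
  shows "strong_collapse (cedge n F) (residues n V) (residues n V - {x mod n})"
proof -
  have n: "0 < n" using cycD(1)[OF c] .
  have Fx: "x < F x" "F x \<in> V" "F x < x + n" using cycD(4,5,8)[OF c x(1)] x by (auto simp: order_less_le)
  \<comment> \<open>\<open>y\<close> is the next vertex after \<open>x\<close>. It exists because
    \<open>F x\<close> lies beyond \<open>x\<close>, which is not a value of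
    \<open>F\<close>.\<close>
  define y where "y = Min {y\<in>V. x < y \<and> y \<le> F x}"
  have fin: "finite {y\<in>V. x < y \<and> y \<le> F x}" by (rule finite_subset[of _ "{x..F x}"]) auto
  have yin: "y \<in> {y\<in>V. x < y \<and> y \<le> F x}" unfolding y_def by (rule Min_in[OF fin]) (use Fx in auto)
  then have y: "y \<in> V" "x < y" "y \<le> F x" by auto
  have ymin: "y \<le> z" if "z \<in> V" "x < z" for z
  proof (cases "z \<le> F x")
    case True then show ?thesis unfolding y_def using that fin by (intro Min_le) auto
  qed (use y in simp)
  have memmod: "z mod n \<in> V \<longleftrightarrow> z \<in> V" for z using mod_mem[OF cycD(3)[OF c]] .
  have e1: "cedge n F (a mod n) (b mod n) \<longleftrightarrow> cedge n F a b" if "a \<in> V" for a b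
    using cedge_mod_left[OF c that] cedge_mod_right by blast
  have exy: "cedge n F x y" unfolding cedge_def using y by (intro exI[of _ 0]) auto
  have neq: "x mod n \<noteq> y mod n"
  proof
    assume "x mod n = y mod n"
    then have "n dvd y - x" by (metis mod_eq_dvd_iff)
    then have "n \<le> y - x" using y by (intro zdvd_imp_le) auto
    then show False using y Fx by simp
  qed
  have main: "cedge n F z y \<or> cedge n F y z" if z: "z \<in> V" "z mod n \<noteq> x mod n" "z mod n \<noteq> y mod n" and e: "cedge n F z x \<or> cedge n F x z" for z
    using e
  proof
    assume "cedge n F z x"
    then obtain m where m: "z < x + m * n" "x + m * n \<le> F z" unfolding cedge_def by blast
    define z' where "z' = z + (- m) * n"
    have z': "z' \<in> V" unfolding z'_def using shift_mem[OF cycD(3)[OF c]] z by blast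
    have Fz': "F z' = F z + (- m) * n" unfolding z'_def by (rule cyc_shift[OF c z(1)])
    have "z' < x" "x \<le> F z'" using m Fz' by (auto simp: z'_def)
    \<comment> \<open>The out-interval of \<open>z'\<close> reaches \<open>x\<close> but does not
      end there, so it reaches \<open>y\<close>.\<close>
    moreover have "F z' \<noteq> x" using x(2) z' by blast
    ultimately have "y \<le> F z'" using ymin[of "F z'"] cycD(4)[OF c z'] by simp
    then have "cedge n F z' y" unfolding cedge_def using \<open>z' < x\<close> y by (intro exI[of _ 0]) auto
    then have "cedge n F z y" using cedge_shift_left[of F z "-m" n y] Fz' by (simp add: z'_def)
    then show ?thesis ..
  next
    assume "cedge n F x z"
    then obtain m where m: "x < z + m * n" "z + m * n \<le> F x" unfolding cedge_def by blast
    have zm: "z + m * n \<in> V" using shift_mem[OF cycD(3)[OF c]] z by blast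
    have "z + m * n \<noteq> y" using z(3) by auto
    then have "y < z + m * n" using ymin[OF zm m(1)] by simp
    moreover have "z + m * n \<le> F y" using m(2) cycD(7)[OF c x(1) y(1)] y(2) by simp
    ultimately have "cedge n F y z" unfolding cedge_def by blast
    then show ?thesis ..
  qed
  show ?thesis
  proof (rule strong_collapse_step[OF strong_collapse_refl, where w = "y mod n"])
    show "x mod n \<in> residues n V" "y mod n \<in> residues n V" using memmod x y n by auto
    show "cedge n F (x mod n) (y mod n) \<or> cedge n F (y mod n) (x mod n)" using e1[OF x(1)] exy by blast
    fix z assume z: "z \<in> residues n V" "z \<noteq> x mod n" "z \<noteq> y mod n" "cedge n F z (x mod n) \<or> cedge n F (x mod n) z"
    have zz: "z mod n = z" using z by simp
    have "cedge n F z x \<or> cedge n F x z" using z(4) e1[OF x(1), of z] e1[of z x] z(1) zz by auto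
    then have "cedge n F z y \<or> cedge n F y z" using main[of z] z zz by auto
    then show "cedge n F z (y mod n) \<or> cedge n F (y mod n) z" using e1[OF y(1), of z] e1[of z y] z(1) zz by auto
  qed (rule neq)
qed

text \<open>Vertices outside \<open>W\<close> are not values of \<open>F\<close> and remain so on
  every smaller set, so they can be removed one residue class at a time.\<close>

lemma cyc_collapse:
  assumes "cyc n V F" "W \<subseteq> V" "F ` V \<subseteq> W" "\<forall>x. x + n \<in> W \<longleftrightarrow> x \<in> W"
  shows "strong_collapse (cedge n F) (residues n V) (residues n W)"
  using assms
proof (induction "card (residues n (V - W))" arbitrary: V rule: less_induct)
  case less
  show ?case
  proof (cases "V = W")
    case True then show ?thesis by (simp add: strong_collapse_refl)
  next
    case False
    then obtain x where x: "x \<in> V" "x \<notin> W" using less.prems by blast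
    then have xF: "x \<notin> F ` V" using less.prems by blast
    define V' where "V' = V - {y. y mod n = x mod n}"
    have n: "0 < n" using cycD(1)[OF less.prems(1)] .
    have W: "y mod n \<in> W \<longleftrightarrow> y \<in> W" for y using mod_mem[OF less.prems(4)] .
    have Vm: "y mod n \<in> V \<longleftrightarrow> y \<in> V" for y using mod_mem[OF cycD(3)[OF less.prems(1)]] .
    have WV': "W \<subseteq> V'" unfolding V'_def using less.prems(2) W x(2) by (auto, metis)
    have per: "\<forall>y. y + n \<in> V' \<longleftrightarrow> y \<in> V'" unfolding V'_def using cycD(3)[OF less.prems(1)] by auto
    have V'V: "V' \<subseteq> V" by (auto simp: V'_def)
    have c': "cyc n V' F"
      by (rule cyc_subset[OF less.prems(1) V'V _ per]) (use less.prems(3) WV' in blast)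
    have "residues n V' = residues n V - {x mod n}" by (auto simp: V'_def)
    then have 1: "strong_collapse (cedge n F) (residues n V) (residues n V')"
      using cyc_remove[OF less.prems(1) x(1) xF] by simp
    have "residues n (V' - W) \<subset> residues n (V - W)"
    proof
      show "residues n (V' - W) \<subseteq> residues n (V - W)" using V'V by auto
      have "x mod n \<in> residues n (V - W)" using x n W Vm by auto
      moreover have "x mod n \<notin> residues n (V' - W)" by (simp add: V'_def)
      ultimately show "residues n (V' - W) \<noteq> residues n (V - W)" by blast
    qed
    then have "card (residues n (V' - W)) < card (residues n (V - W))" by (intro psubset_card_mono) auto
    then have "strong_collapse (cedge n F) (residues n V') (residues n W)"
      by (rule less.hyps) (use c' WV' less.prems(3,4) V'V in blast)+
    then show ?thesis using strong_collapse_trans 1 by blast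
  qed
qed

lemma cyc_image:
  assumes c: "cyc n V F" shows "cyc n (F ` V) F" "strong_collapse (cedge n F) (residues n V) (residues n (F ` V))"
proof -
  have sub: "F ` V \<subseteq> V" using cycD(4)[OF c] by blast
  have per: "\<forall>x. x + n \<in> F ` V \<longleftrightarrow> x \<in> F ` V"
  proof (intro allI iffI)
    fix x assume "x + n \<in> F ` V"
    then obtain y where y: "y \<in> V" "x + n = F y" by blast
    then have "x = F (y + (-1) * n)" using cyc_shift[OF c y(1), of "-1"] by simp
    then show "x \<in> F ` V" using shift_mem[OF cycD(3)[OF c], of y "-1"] y by blast
  next
    fix x assume "x \<in> F ` V"
    then obtain y where y: "y \<in> V" "x = F y" by blast
    then have "x + n = F (y + 1 * n)" using cyc_shift[OF c y(1), of 1] by simp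
    then show "x + n \<in> F ` V" using shift_mem[OF cycD(3)[OF c], of y 1] y by blast
  qed
  show "cyc n (F ` V) F" by (rule cyc_subset[OF c sub subset_refl per])
  show "strong_collapse (cedge n F) (residues n V) (residues n (F ` V))"
    by (rule cyc_collapse[OF c sub subset_refl per])
qed

lemma cyc_image_funpow:
  assumes c: "cyc n V F"
  shows "cyc n ((F ^^ i) ` V) F \<and> strong_collapse (cedge n F) (residues n V) (residues n ((F ^^ i) ` V))"
proof (induction i)
  case 0 then show ?case using c by (simp add: strong_collapse_refl)
next
  case (Suc i)
  have "(F ^^ Suc i) ` V = F ` ((F ^^ i) ` V)" by (auto simp: image_image)
  then show ?case using Suc cyc_image[of n "(F ^^ i) ` V" F] strong_collapse_trans by metis
qed

text \<open>There are finitely many residue classes and \<open>A\<close> is never left, so one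
  number of iterations serves all vertices.\<close>

lemma cyc_uniform:
  assumes c: "cyc n V F" and per: "\<forall>x. x + n \<in> A \<longleftrightarrow> x \<in> A" and inv: "\<And>x. x \<in> V \<Longrightarrow> x \<in> A \<Longrightarrow> F x \<in> A"
    and ev: "\<And>x. x \<in> V \<Longrightarrow> \<exists>i. (F ^^ i) x \<in> A"
  obtains i where "(F ^^ i) ` V \<subseteq> A"
proof -
  have n: "0 < n" using cycD(1)[OF c] .
  obtain f where f: "\<And>x. x \<in> V \<Longrightarrow> (F ^^ f x) x \<in> A" using ev by metis
  have fin: "finite (residues n V)" by simp
  define M where "M = Max (insert 0 (f ` residues n V))"
  have stay: "(F ^^ (i + j)) x \<in> A" if "x \<in> V" "(F ^^ i) x \<in> A" for x i j
    by (induction j) (use that inv cyc_funpow(1)[OF c] in auto)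
  have "(F ^^ M) x \<in> A" if x: "x \<in> V" for x
  proof -
    have r: "x mod n \<in> residues n V" using mod_mem[OF cycD(3)[OF c]] x n by auto
    then have "f (x mod n) \<le> M" unfolding M_def using fin by (intro Max_ge) auto
    then obtain j where "M = f (x mod n) + j" using le_Suc_ex by blast
    then have "(F ^^ M) (x mod n) \<in> A" using stay[of "x mod n"] f r by auto
    moreover have "(F ^^ M) x = (F ^^ M) (x mod n) + (x div n) * n"
      using cyc_funpow(2)[OF c, of "x mod n" M "x div n"] r by (simp add: mult.commute)
    ultimately show ?thesis using shift_mem[OF per] by simp
  qed
  then show ?thesis using that by blast
qed

text \<open>After enough iterations the image of \<open>F\<close> lies in \<open>A\<close>, where
  distinct residues are adjacent; what is left is a simplex.\<close>

lemma cyc_contractible: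
  assumes c: "cyc n V F" and per: "\<forall>x. x + n \<in> A \<longleftrightarrow> x \<in> A" and inv: "\<And>x. x \<in> V \<Longrightarrow> x \<in> A \<Longrightarrow> F x \<in> A"
    and ev: "\<And>x. x \<in> V \<Longrightarrow> \<exists>i. (F ^^ i) x \<in> A"
    and cl: "\<And>x y. x \<in> V \<inter> A \<Longrightarrow> y \<in> V \<inter> A \<Longrightarrow> x mod n \<noteq> y mod n \<Longrightarrow> cedge n F x y \<or> cedge n F y x"
  shows "contractible_space (clique_complex_space (residues n V) (cedge n F))"
proof -
  obtain i where i: "(F ^^ i) ` V \<subseteq> A" using cyc_uniform[OF c per inv ev] by blast
  define U where "U = (F ^^ i) ` V"
  have U: "cyc n U F" "strong_collapse (cedge n F) (residues n V) (residues n U)"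
    using cyc_image_funpow[OF c] by (auto simp: U_def)
  have UV: "U \<subseteq> V \<inter> A" using i cyc_funpow(1)[OF c] by (auto simp: U_def)
  obtain u where "u \<in> U" using cycD(2)[OF U(1)] by blast
  then have u: "u mod n \<in> residues n U" using mod_mem[OF cycD(3)[OF U(1)]] cycD(1)[OF c] by auto
  have "contractible_space (clique_complex_space (residues n U) (cedge n F))"
  proof (rule contractible_cone[OF _ u])
    fix y assume "y \<in> residues n U" "y \<noteq> u mod n"
    then show "cedge n F y (u mod n) \<or> cedge n F (u mod n) y" using cl[of y "u mod n"] UV u by auto
  qed simp
  then show ?thesis using strong_collapse_equiv[OF U(2)] homotopy_equivalent_space_contractibility by auto
qed

text \<open>\<open>A\<close> is its own image, so every iterated image contains it, and after enough
  iterations nothing else is left.\<close>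

lemma cyc_collapse_onto:
  assumes c: "cyc n V F" and per: "\<forall>x. x + n \<in> A \<longleftrightarrow> x \<in> A" and A: "F ` A = A" "A \<subseteq> V"
    and ev: "\<And>x. x \<in> V \<Longrightarrow> \<exists>i. (F ^^ i) x \<in> A"
  shows "strong_collapse (cedge n F) (residues n V) (residues n A)"
proof -
  obtain i where i: "(F ^^ i) ` V \<subseteq> A" using cyc_uniform[OF c per _ ev] A by blast
  have "(F ^^ j) ` A = A" for j
  proof (induction j)
    case (Suc j)
    have "(F ^^ Suc j) ` A = F ` ((F ^^ j) ` A)" by (auto simp: image_image)
    then show ?case using Suc A by simp
  qed simp
  then have "(F ^^ i) ` V = A" using i A(2) by blast
  then show ?thesis using cyc_image_funpow[OF c] by metis
qed

text \<open>The map belonging to the subgraph induced on \<open>W\<close>.\<close>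

definition rst :: "int set \<Rightarrow> (int \<Rightarrow> int) \<Rightarrow> int \<Rightarrow> int" where
  "rst W F x = Max {y\<in>W. x \<le> y \<and> y \<le> F x}"

lemma rst_props:
  assumes "x \<in> W" "x \<le> F x"
  shows "rst W F x \<in> W" "x \<le> rst W F x" "rst W F x \<le> F x" "\<And>y. y \<in> W \<Longrightarrow> y \<le> F x \<Longrightarrow> y \<le> rst W F x"
proof -
  have fin: "finite {y\<in>W. x \<le> y \<and> y \<le> F x}" by (rule finite_subset[of _ "{x..F x}"]) auto
  have "rst W F x \<in> {y\<in>W. x \<le> y \<and> y \<le> F x}" unfolding rst_def by (rule Max_in[OF fin]) (use assms in auto)
  then show "rst W F x \<in> W" "x \<le> rst W F x" "rst W F x \<le> F x" by auto
  fix y assume "y \<in> W" "y \<le> F x"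
  then show "y \<le> rst W F x"
    using \<open>x \<le> rst W F x\<close> Max_ge[OF fin, of y] by (cases "x \<le> y") (auto simp: rst_def)
qed

lemma rst_eqI:
  assumes "x \<in> W" "x \<le> z" "z \<in> W" "z \<le> F x" "\<And>y. y \<in> W \<Longrightarrow> z < y \<Longrightarrow> y \<le> F x \<Longrightarrow> False"
  shows "rst W F x = z"
proof -
  have "x \<le> F x" using assms by simp
  note r = rst_props[where W=W and F=F, OF assms(1) this]
  have "z \<le> rst W F x" using r(4) assms by blast
  moreover have "\<not> z < rst W F x" using assms(5)[OF r(1)] r(3) by blast
  ultimately show ?thesis by simp
qed

lemma cyc_rst:
  assumes c: "cyc n V F" and W: "W \<subseteq> V" "W \<noteq> {}" "\<forall>x. x + n \<in> W \<longleftrightarrow> x \<in> W"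
  shows "cyc n W (rst W F)"
  unfolding cyc_def
proof (intro conjI ballI impI)
  have le: "x \<le> F x" if "x \<in> W" for x using cycD(5)[OF c] W that by blast
  note r = rst_props[where W=W and F=F, OF _ le]
  show "0 < n" "W \<noteq> {}" "\<forall>x. x + n \<in> W \<longleftrightarrow> x \<in> W" using cycD(1)[OF c] W by auto
  fix x assume x: "x \<in> W"
  then have xV: "x \<in> V" using W by blast
  show "rst W F x \<in> W" "x \<le> rst W F x" using r[OF x x] by auto
  show "rst W F (x + n) = rst W F x + n"
  proof (rule rst_eqI)
    show "x + n \<in> W" "rst W F x + n \<in> W" using W(3) x r(1)[OF x x] by auto
    show "x + n \<le> rst W F x + n" using r(2)[OF x x] by simp
    have F: "F (x + n) = F x + n" using cyc_shift[OF c xV, of 1] by simp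
    then show "rst W F x + n \<le> F (x + n)" using r(3)[OF x x] by simp
    fix y assume y: "y \<in> W" "rst W F x + n < y" "y \<le> F (x + n)"
    have "y - n \<in> W" using shift_mem[OF W(3), of y "-1"] y(1) by simp
    then show False using r(4)[OF x x, of "y - n"] y F by simp
  qed
  have "rst W F (rst W F x) \<le> F (rst W F x)" using r(3)[OF r(1)[OF x x] r(1)[OF x x]] .
  also have "\<dots> \<le> F (F x)" using cycD(7)[OF c, of "rst W F x" "F x"] r(1,3)[OF x x] W cycD(4)[OF c xV] by blast
  also have "\<dots> < x + n" by (rule cycD(6)[OF c xV])
  finally show "rst W F (rst W F x) < x + n" .
  fix y assume y: "y \<in> W" "x \<le> y"
  have "F x \<le> F y" using cycD(7)[OF c xV] y W by blast
  then show "rst W F x \<le> rst W F y" using r(4)[OF y(1) y(1), of "rst W F x"] r(1,3)[OF x x] by simp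
qed

lemma cedge_rst:
  assumes c: "cyc n V F" and W: "W \<subseteq> V" "\<forall>x. x + n \<in> W \<longleftrightarrow> x \<in> W" and x: "x \<in> W" and y: "y \<in> W"
  shows "cedge n (rst W F) x y \<longleftrightarrow> cedge n F x y"
proof -
  have le: "x \<le> F x" using cycD(5)[OF c] W x by blast
  have "y + m * n \<in> W" for m using shift_mem[OF W(2)] y by simp
  then show ?thesis unfolding cedge_def using rst_props(3,4)[where W=W and F=F, OF x le] by (meson order_trans)
qed

lemma rst_funpow_le:
  assumes c: "cyc n V F" and W: "W \<subseteq> V" "W \<noteq> {}" "\<forall>x. x + n \<in> W \<longleftrightarrow> x \<in> W" and x: "x \<in> W"
  shows "(rst W F ^^ i) x \<le> (F ^^ i) x"
proof (induction i)
  case (Suc i)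
  let ?a = "(rst W F ^^ i) x" and ?b = "(F ^^ i) x"
  have a: "?a \<in> W" using cyc_funpow(1)[OF cyc_rst[OF c W] x] .
  have "rst W F ?a \<le> F ?a" using rst_props(3)[OF a] cycD(5)[OF c] a W by blast
  also have "F ?a \<le> F ?b" using cycD(7)[OF c] a W cyc_funpow(1)[OF c] x Suc by blast
  finally show ?case by simp
qed simp

lemma rst_contractible:
  assumes c: "cyc n V F" and W: "W \<subseteq> V" "W \<noteq> {}" "\<forall>x. x + n \<in> W \<longleftrightarrow> x \<in> W"
    and per: "\<forall>x. x + n \<in> A \<longleftrightarrow> x \<in> A" and inv: "\<And>x. x \<in> W \<Longrightarrow> x \<in> A \<Longrightarrow> rst W F x \<in> A"
    and ev: "\<And>x. x \<in> W \<Longrightarrow> \<exists>i. (rst W F ^^ i) x \<in> A"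
    and cl: "\<And>x y. x \<in> W \<inter> A \<Longrightarrow> y \<in> W \<inter> A \<Longrightarrow> x mod n \<noteq> y mod n \<Longrightarrow> cedge n F x y \<or> cedge n F y x"
  shows "contractible_space (clique_complex_space (residues n W) (cedge n F))"
proof -
  have "contractible_space (clique_complex_space (residues n W) (cedge n (rst W F)))"
    by (rule cyc_contractible[OF cyc_rst[OF c W] per inv ev]) (use cl cedge_rst[OF c W(1,3)] in auto)
  moreover have "clique_complex_space (residues n W) (cedge n (rst W F)) homotopy_equivalent_space clique_complex_space (residues n W) (cedge n F)"
    by (rule clique_complex_cong) (use cedge_rst[OF c W(1,3)] in auto)
  ultimately show ?thesis using homotopy_equivalent_space_contractibility by blast
qed

section \<open>Circulant graphs\<close>

definition PC :: "int \<Rightarrow> int set \<Rightarrow> int set" where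
  "PC n S = {x. \<exists>a\<in>S. \<exists>m. x = a + m * n}"

lemma PC_periodic: "\<forall>x. x + n \<in> PC n S \<longleftrightarrow> x \<in> PC n S"
proof (intro allI iffI)
  fix x assume "x + n \<in> PC n S"
  then obtain a m where "a \<in> S" "x + n = a + m * n" unfolding PC_def by blast
  then show "x \<in> PC n S" unfolding PC_def by (auto simp: algebra_simps intro!: bexI[of _ a] exI[of _ "m - 1"])
next
  fix x assume "x \<in> PC n S"
  then obtain a m where "a \<in> S" "x = a + m * n" unfolding PC_def by blast
  then show "x + n \<in> PC n S" unfolding PC_def by (auto simp: algebra_simps intro!: bexI[of _ a] exI[of _ "m + 1"])
qed

lemma PC_I: "a \<in> S \<Longrightarrow> a \<in> PC n S"
  unfolding PC_def by (auto intro!: bexI[of _ a] exI[of _ 0])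

lemma PC_I': "a \<in> S \<Longrightarrow> a + m * n \<in> PC n S"
  unfolding PC_def by blast

lemma PC_cases:
  assumes "y \<in> PC n S" "0 < n"
  obtains "y \<in> S" | a where "a \<in> S" "a + n \<le> y" | a where "a \<in> S" "y \<le> a - n"
proof -
  obtain a m where a: "a \<in> S" "y = a + m * n" using assms unfolding PC_def by blast
  consider "m = 0" | "m \<ge> 1" | "m \<le> -1" by linarith
  then show ?thesis
  proof cases
    case 1 then show ?thesis using a that(1) by simp
  next
    case 2
    then have "1 * n \<le> m * n" using assms(2) by (intro mult_right_mono) auto
    then show ?thesis using a that(2) by simp
  next
    case 3
    then have "m * n \<le> -1 * n" using assms(2) by (intro mult_right_mono) auto
    then show ?thesis using a that(3) by simp
  qed
qed

definition cadj :: "int \<Rightarrow> int \<Rightarrow> int \<Rightarrow> bool" where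
  "cadj n k z \<longleftrightarrow> (\<exists>m. z + m * n \<noteq> 0 \<and> \<bar>z + m * n\<bar> \<le> k)"

lemma cadj_iff: "(cedge n (\<lambda>x. x + k) x y \<or> cedge n (\<lambda>x. x + k) y x) \<longleftrightarrow> cadj n k (y - x)"
proof
  assume "cedge n (\<lambda>x. x + k) x y \<or> cedge n (\<lambda>x. x + k) y x"
  then show "cadj n k (y - x)"
  proof
    assume "cedge n (\<lambda>x. x + k) x y"
    then obtain m where "x < y + m * n" "y + m * n \<le> x + k" unfolding cedge_def by blast
    then show ?thesis unfolding cadj_def by (intro exI[of _ m]) auto
  next
    assume "cedge n (\<lambda>x. x + k) y x"
    then obtain m where "y < x + m * n" "x + m * n \<le> y + k" unfolding cedge_def by blast
    then show ?thesis unfolding cadj_def by (intro exI[of _ "-m"]) auto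
  qed
next
  assume "cadj n k (y - x)"
  then obtain m where m: "y - x + m * n \<noteq> 0" "\<bar>y - x + m * n\<bar> \<le> k" unfolding cadj_def by blast
  show "cedge n (\<lambda>x. x + k) x y \<or> cedge n (\<lambda>x. x + k) y x"
  proof (cases "y - x + m * n > 0")
    case True
    then have "cedge n (\<lambda>x. x + k) x y" unfolding cedge_def using m by (intro exI[of _ m]) auto
    then show ?thesis ..
  next
    case False
    then have "cedge n (\<lambda>x. x + k) y x" unfolding cedge_def using m by (intro exI[of _ "-m"]) auto
    then show ?thesis ..
  qed
qed

text \<open>As \<open>\<bar>z\<bar> < n\<close> and \<open>2 * k < n\<close>, only the translates by
  0, \<open>n\<close> and \<open>- n\<close> can have absolute value at most
  \<open>k\<close>.\<close>

lemma cadj_range: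
  assumes "\<bar>z\<bar> < n" "z \<noteq> 0" "2 * k < n"
  shows "cadj n k z \<longleftrightarrow> \<bar>z\<bar> \<le> k \<or> n - k \<le> \<bar>z\<bar>"
proof
  assume "cadj n k z"
  then obtain m where m: "z + m * n \<noteq> 0" "\<bar>z + m * n\<bar> \<le> k" unfolding cadj_def by blast
  have n: "0 < n" using assms by linarith
  consider "m = 0" | "m = 1" | "m = -1" | "m \<ge> 2" | "m \<le> -2" by linarith
  then show "\<bar>z\<bar> \<le> k \<or> n - k \<le> \<bar>z\<bar>"
  proof cases
    case 4
    then have "2 * n \<le> m * n" using n by (intro mult_right_mono) auto
    then show ?thesis using m assms by linarith
  next
    case 5
    then have "m * n \<le> -2 * n" using n by (intro mult_right_mono) auto
    then show ?thesis using m assms by linarith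
  qed (use m assms in auto)
next
  assume a: "\<bar>z\<bar> \<le> k \<or> n - k \<le> \<bar>z\<bar>"
  show "cadj n k z"
  proof (cases "\<bar>z\<bar> \<le> k")
    case True then show ?thesis unfolding cadj_def using assms by (intro exI[of _ 0]) auto
  next
    case False
    then have "n - k \<le> \<bar>z\<bar>" using a by blast
    then have "z + (if z > 0 then -1 else 1) * n \<noteq> 0 \<and> \<bar>z + (if z > 0 then -1 else 1) * n\<bar> \<le> k"
      using assms by auto
    then show ?thesis unfolding cadj_def by blast
  qed
qed

lemma cadj_uminus: "cadj n k (- z) \<longleftrightarrow> cadj n k z"
proof -
  have "cadj n k z" if h: "cadj n k (- z)" for z
  proof -
    obtain m where "- z + m * n \<noteq> 0" "\<bar>- z + m * n\<bar> \<le> k" using h unfolding cadj_def by blast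
    then show ?thesis unfolding cadj_def by (intro exI[of _ "-m"]) auto
  qed
  from this[of z] this[of "-z"] show ?thesis by auto
qed

lemma cadj_shift: "cadj n k (z + m * n) \<longleftrightarrow> cadj n k z"
proof
  assume "cadj n k (z + m * n)"
  then obtain i where "z + m * n + i * n \<noteq> 0" "\<bar>z + m * n + i * n\<bar> \<le> k" unfolding cadj_def by blast
  then show "cadj n k z" unfolding cadj_def by (intro exI[of _ "m + i"]) (auto simp: algebra_simps)
next
  assume "cadj n k z"
  then obtain i where "z + i * n \<noteq> 0" "\<bar>z + i * n\<bar> \<le> k" unfolding cadj_def by blast
  then show "cadj n k (z + m * n)" unfolding cadj_def by (intro exI[of _ "i - m"]) (auto simp: algebra_simps)
qed

lemma cyc_circ: "0 \<le> k \<Longrightarrow> 2 * k < n \<Longrightarrow> cyc n UNIV (\<lambda>x. x + k)"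
  unfolding cyc_def by auto

text \<open>A vertex has \<open>d - 1\<close> non-neighbours. Since
  \<open>(2 * l + 1) * k = l * n + s\<close> and
  \<open>(2 * l + 3) * k = (l + 1) * n + s - d\<close>, the bounds on \<open>s\<close> say that
  \<open>2 * l + 1\<close> steps of length \<open>k\<close> make at least \<open>l\<close> turns and
  \<open>2 * l + 3\<close> steps fewer than \<open>l + 1\<close>, that is,
  \<open>l/(2l+1) <= k/n < (l+1)/(2l+3)\<close>.\<close>

locale circulant =
  fixes n k d l s :: int
  assumes n_eq: "n = 2 * k + d" and k_eq: "k = l * d + s" and s0: "0 \<le> s" and sd: "s < d" and l0: "0 \<le> l"
begin

lemma d_pos: "0 < d" using s0 sd by simp

lemma ld_nonneg: "0 \<le> l * d" using l0 d_pos by simp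

lemma k_nonneg: "0 \<le> k" using k_eq ld_nonneg s0 by simp

lemma n_gt: "2 * k < n" using n_eq d_pos by simp

lemma n_pos: "0 < n" using n_gt k_nonneg by simp

abbreviation sh :: "int \<Rightarrow> int" where "sh \<equiv> \<lambda>x. x + k"

lemma cyc_sh: "cyc n UNIV sh" by (rule cyc_circ[OF k_nonneg n_gt])

lemma cyc_PC: "T \<noteq> {} \<Longrightarrow> cyc n (PC n T) (rst (PC n T) sh)"
  by (rule cyc_rst[OF cyc_sh]) (auto simp: PC_periodic dest: PC_I)

lemma mult_d_mono: "i \<le> j \<Longrightarrow> i * d \<le> j * d"
  using d_pos by (simp add: mult_right_mono)

lemma mult_d_Suc: "i < j \<Longrightarrow> i * d + d \<le> j * d"
  using mult_d_mono[of "i + 1" j] by (simp add: algebra_simps)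

lemma le_l_k: "i \<le> l \<Longrightarrow> i * d \<le> k"
  using mult_d_mono[of i l] k_eq s0 by simp

definition reaches :: "int set \<Rightarrow> int set \<Rightarrow> int \<Rightarrow> bool" where
  "reaches T S x \<longleftrightarrow> (\<exists>i. (rst (PC n T) sh ^^ i) x \<in> PC n S)"

lemma reaches_base: "x \<in> PC n S \<Longrightarrow> reaches T S x"
  unfolding reaches_def by (intro exI[of _ 0]) simp

lemma reaches_step: "rst (PC n T) sh x = y \<Longrightarrow> reaches T S y \<Longrightarrow> reaches T S x"
  unfolding reaches_def by (metis funpow_Suc_right comp_apply)

lemma reaches_shift:
  assumes "x \<in> PC n T" shows "reaches T S (x + m * n) \<longleftrightarrow> reaches T S x"
proof -
  have "T \<noteq> {}" using assms by (auto simp: PC_def)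
  then show ?thesis
    unfolding reaches_def using cyc_funpow(2)[OF cyc_PC assms] shift_mem[OF PC_periodic] by simp
qed

lemma rst_shift:
  assumes "x \<in> PC n T" shows "rst (PC n T) sh (x + m * n) = rst (PC n T) sh x + m * n"
proof -
  have "T \<noteq> {}" using assms by (auto simp: PC_def)
  then show ?thesis using cyc_shift[OF cyc_PC assms] by simp
qed

text \<open>Periodicity reduces all checks to representatives: \<open>T\<close> of the vertices,
  \<open>S\<close> of a clique into which every orbit runs.\<close>

lemma PC_contractible:
  assumes ne: "T \<noteq> {}" and sub: "S \<subseteq> PC n T" and inv: "\<And>a. a \<in> S \<Longrightarrow> rst (PC n T) sh a \<in> PC n S"
    and ev: "\<And>a. a \<in> T \<Longrightarrow> reaches T S a"
    and cl: "\<And>a b. a \<in> S \<Longrightarrow> b \<in> S \<Longrightarrow> a \<noteq> b \<Longrightarrow> cadj n k (b - a)"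
  shows "contractible_space (clique_complex_space (residues n (PC n T)) (cedge n sh))"
proof (rule rst_contractible[OF cyc_sh, where A = "PC n S"])
  show "PC n T \<noteq> {}" using ne PC_I by blast
  show "rst (PC n T) sh x \<in> PC n S" if h: "x \<in> PC n S" for x
  proof -
    obtain a m where a: "a \<in> S" "x = a + m * n" using h unfolding PC_def by blast
    then have "rst (PC n T) sh x = rst (PC n T) sh a + m * n" using rst_shift sub by blast
    then show ?thesis using inv[OF a(1)] shift_mem[OF PC_periodic] by simp
  qed
  show "\<exists>i. (rst (PC n T) sh ^^ i) x \<in> PC n S" if h: "x \<in> PC n T" for x
  proof -
    obtain a m where a: "a \<in> T" "x = a + m * n" using h unfolding PC_def by blast
    then have "reaches T S x" using reaches_shift[OF PC_I[OF a(1)]] ev by simp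
    then show ?thesis by (simp add: reaches_def)
  qed
  fix x y assume x: "x \<in> PC n T \<inter> PC n S" and y: "y \<in> PC n T \<inter> PC n S" and ne: "x mod n \<noteq> y mod n"
  obtain a m where a: "a \<in> S" "x = a + m * n" using x unfolding PC_def by blast
  obtain b i where b: "b \<in> S" "y = b + i * n" using y unfolding PC_def by blast
  have "a \<noteq> b" using ne a b by auto
  then have "cadj n k (b - a)" by (rule cl[OF a(1) b(1)])
  moreover have "y - x = b - a + (i - m) * n" using a b by (simp add: algebra_simps)
  ultimately show "cedge n sh x y \<or> cedge n sh y x" unfolding cadj_iff using cadj_shift by simp
qed (auto simp: PC_periodic)

section \<open>The link of a vertex of a circulant graph\<close>

definition nbrs :: "int set" where "nbrs = {1..k} \<union> {-k..-1}"

lemma nbrs_gap: "y \<in> PC n nbrs \<Longrightarrow> \<not> (k < y \<and> y < k + d) \<and> y \<noteq> 0"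
  by (erule PC_cases[OF _ n_pos]) (use k_nonneg d_pos n_eq in \<open>auto simp: nbrs_def\<close>)

text \<open>Modulo \<open>n\<close>, two steps lower a large positive vertex by \<open>d\<close>:
  from \<open>x\<close> to \<open>x - d - k\<close> to \<open>x - d\<close>. The map falls short of
  the shift in two places only: steps into the gap of non-neighbours fall back to \<open>k\<close>,
  and the step to the missing vertex 0 falls back to \<open>-1\<close>.\<close>

lemma nbrs_step:
  shows "1 \<le> x \<Longrightarrow> x < d \<Longrightarrow> x \<le> k \<Longrightarrow> rst (PC n nbrs) sh x = k"
    "d \<le> x \<Longrightarrow> x \<le> k \<Longrightarrow> rst (PC n nbrs) sh x = (x - d - k) + 1 * n"
    "1 \<le> y \<Longrightarrow> y < k \<Longrightarrow> rst (PC n nbrs) sh (- y) = k - y"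
    "1 \<le> k \<Longrightarrow> rst (PC n nbrs) sh (- k) = -1"
proof -
  show "rst (PC n nbrs) sh x = k" if "1 \<le> x" "x < d" "x \<le> k"
  proof (rule rst_eqI)
    fix y assume "y \<in> PC n nbrs" "k < y" "y \<le> x + k"
    then show False using nbrs_gap[of y] that by auto
  qed (use that in \<open>auto intro!: PC_I simp: nbrs_def\<close>)
  show "rst (PC n nbrs) sh x = (x - d - k) + 1 * n" if "d \<le> x" "x \<le> k"
  proof (rule rst_eqI)
    show "x - d - k + 1 * n \<in> PC n nbrs" by (rule PC_I') (use that d_pos in \<open>auto simp: nbrs_def\<close>)
  qed (use that n_eq k_nonneg d_pos in \<open>auto intro!: PC_I simp: nbrs_def\<close>)
  show "rst (PC n nbrs) sh (- y) = k - y" if "1 \<le> y" "y < k"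
    by (rule rst_eqI) (use that in \<open>auto intro!: PC_I simp: nbrs_def\<close>)
  show "rst (PC n nbrs) sh (- k) = -1" if "1 \<le> k"
  proof (rule rst_eqI)
    fix y assume "y \<in> PC n nbrs" "-1 < y" "y \<le> - k + k"
    then show False using nbrs_gap[of y] by auto
  qed (use that in \<open>auto intro!: PC_I simp: nbrs_def\<close>)
qed

lemma nbrs_reaches_desc:
  assumes "d < x" "x \<le> k" "reaches nbrs S (x - d)" shows "reaches nbrs S x"
proof -
  have e: "- (k + d - x) = x - d - k" by simp
  have 1: "rst (PC n nbrs) sh (x - d - k) = x - d" using nbrs_step(3)[of "k + d - x"] assms d_pos unfolding e by simp
  have "x - d - k \<in> nbrs" using assms d_pos by (auto simp: nbrs_def)
  then have "reaches nbrs S (x - d - k + 1 * n)"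
    using reaches_shift[OF PC_I] reaches_step[OF 1 assms(3)] by blast
  then show ?thesis using reaches_step[OF nbrs_step(2)[of x]] assms by simp
qed

lemma nbrs_reaches_d:
  assumes "d \<le> k" "reaches nbrs S (-1)" shows "reaches nbrs S d"
proof -
  have k1: "1 \<le> k" using assms d_pos by simp
  have "- k \<in> nbrs" using k1 by (auto simp: nbrs_def)
  then have "reaches nbrs S (- k + 1 * n)"
    using reaches_shift[OF PC_I] reaches_step[OF nbrs_step(4)[OF k1] assms(2)] by blast
  then show ?thesis using reaches_step[OF nbrs_step(2)[of d]] assms by simp
qed

text \<open>The descent by \<open>d\<close> ends either below \<open>d\<close>, where the next
  vertex is \<open>k\<close>, or at \<open>d\<close>, from where the orbit passes through
  \<open>- k\<close> to \<open>-1\<close>. So the orbits of \<open>k\<close> and \<open>-1\<close>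
  decide.\<close>

lemma nbrs_reaches_all:
  assumes k: "reaches nbrs S k" and m1: "reaches nbrs S (-1)" and x: "x \<in> nbrs"
  shows "reaches nbrs S x"
proof -
  have pos: "1 \<le> x \<Longrightarrow> x \<le> k \<Longrightarrow> reaches nbrs S x" for x
  proof (induction "nat x" arbitrary: x rule: less_induct)
    case less
    consider "x < d" | "x = d" | "d < x" by linarith
    then show ?case
    proof cases
      case 1 then show ?thesis using reaches_step[OF nbrs_step(1)] less.prems k by blast
    next
      case 2 then show ?thesis using nbrs_reaches_d m1 less.prems by simp
    next
      case 3
      then have "reaches nbrs S (x - d)" using less.hyps[of "x - d"] less.prems d_pos by simp
      then show ?thesis using nbrs_reaches_desc 3 less.prems by blast
    qed
  qed
  show ?thesis
  proof (cases "x > 0")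
    case True then show ?thesis using pos x by (auto simp: nbrs_def)
  next
    case False
    then have y: "1 \<le> - x" "- x \<le> k" using x by (auto simp: nbrs_def)
    show ?thesis
    proof (cases "- x = k")
      case True
      then have "rst (PC n nbrs) sh x = -1" using nbrs_step(4) y by force
      then show ?thesis using reaches_step m1 by blast
    next
      case False
      then have "rst (PC n nbrs) sh x = k + x" using nbrs_step(3)[of "-x"] y by simp
      then show ?thesis using reaches_step pos[of "k + x"] y False by force
    qed
  qed
qed

text \<open>Modulo \<open>n\<close> these are the \<open>2 * l + 1\<close> consecutive points
  \<open>- j + t * k\<close> with \<open>0 \<le> t \<le> 2 * l\<close> of an orbit of the shift,
  because \<open>2 * k\<close> is congruent to \<open>- d\<close>.\<close>

definition orbit :: "int \<Rightarrow> int set" where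
  "orbit j = {- j - i * d | i. 0 \<le> i \<and> i \<le> l} \<union> {k - j - i * d | i. 0 \<le> i \<and> i < l}"

lemma cadjI: "0 < p \<Longrightarrow> p \<le> k \<Longrightarrow> cadj n k p" "k + d \<le> p \<Longrightarrow> p < n \<Longrightarrow> cadj n k p"
  using n_gt n_eq k_nonneg d_pos by (subst cadj_range; auto)+

text \<open>A positive multiple of \<open>d\<close> carries the difference across the gap to at
  least \<open>k + d\<close>, the others leave it at most \<open>k\<close>. The bound depending on
  \<open>s\<close> keeps it positive: for \<open>s = 0\<close> the difference
  \<open>k - l * d\<close> would be 0.\<close>

lemma alt_adj:
  assumes "0 \<le> i" "0 \<le> i'" "i' \<le> l" "i - i' < l + (if s = 0 then 0 else 1)" "i \<le> l"
  shows "cadj n k (k + (i' - i) * d)"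
proof (cases "i' \<le> i")
  case True
  have "(i' - i) * d \<le> 0" using True d_pos by (simp add: mult_nonpos_nonneg)
  moreover have "0 < k + (i' - i) * d"
  proof (cases "s = 0")
    case True
    then have "(i - i') * d + d \<le> l * d" using assms by (intro mult_d_Suc) simp
    then show ?thesis using k_eq s0 d_pos by (simp add: algebra_simps)
  next
    case False
    have "(i - i') * d \<le> l * d" using assms by (intro mult_d_mono) simp
    then show ?thesis using k_eq s0 False by (simp add: algebra_simps)
  qed
  ultimately show ?thesis by (intro cadjI(1)) linarith+
next
  case False
  then have "d \<le> (i' - i) * d" using mult_d_mono[of 1 "i' - i"] by simp
  moreover have "(i' - i) * d \<le> k" using assms by (intro le_l_k) simp
  ultimately show ?thesis using n_eq d_pos by (intro cadjI(2)) linarith+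
qed

lemma same_adj:
  assumes "0 \<le> i" "0 \<le> i'" "i' \<le> l" "i \<le> l" "i \<noteq> i'"
  shows "cadj n k ((i' - i) * d)"
proof -
  have "\<bar>(i' - i) * d\<bar> = \<bar>i' - i\<bar> * d" using d_pos by (simp add: abs_mult)
  moreover have "\<bar>i' - i\<bar> * d \<le> k" using assms by (intro le_l_k) simp
  ultimately show ?thesis using n_gt d_pos assms by (subst cadj_range) auto
qed

text \<open>The contractibility proofs of this locale let all orbits run into a clique of this
  kind.\<close>

lemma orbit_adj:
  assumes a: "a \<in> orbit j" and b: "b \<in> orbit j" and "a \<noteq> b"
  shows "cadj n k (b - a)"
proof -
  have mixed: "cadj n k ((k - j - i * d) - (- j - i' * d))" if "0 \<le> i" "i < l" "0 \<le> i'" "i' \<le> l" for i i'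
  proof -
    have "cadj n k (k + (i' - i) * d)" using that by (intro alt_adj) auto
    moreover have "(k - j - i * d) - (- j - i' * d) = k + (i' - i) * d" by (simp add: algebra_simps)
    ultimately show ?thesis by simp
  qed
  have mixed': "cadj n k ((- j - i' * d) - (k - j - i * d))" if "0 \<le> i" "i < l" "0 \<le> i'" "i' \<le> l" for i i'
    using mixed[OF that] cadj_uminus[of n k "(k - j - i * d) - (- j - i' * d)"] by (simp only: minus_diff_eq)
  have same: "cadj n k ((c - i' * d) - (c - i * d))" if "0 \<le> i" "i \<le> l" "0 \<le> i'" "i' \<le> l" "i \<noteq> i'" for i i' c
  proof -
    have "cadj n k ((i - i') * d)" using that by (intro same_adj) auto
    moreover have "(c - i' * d) - (c - i * d) = (i - i') * d" by (simp add: algebra_simps)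
    ultimately show ?thesis by simp
  qed
  show ?thesis using a b \<open>a \<noteq> b\<close> unfolding orbit_def
    by (auto intro: mixed mixed' same[where c = "-j"] same[where c = "k - j"])
qed


lemma orbitI:
  "0 \<le> i \<Longrightarrow> i \<le> l \<Longrightarrow> - j - i * d \<in> orbit j" "0 \<le> i \<Longrightarrow> i < l \<Longrightarrow> k - j - i * d \<in> orbit j"
  unfolding orbit_def by blast+

text \<open>A descent by \<open>d\<close> that avoids the multiples of \<open>d\<close> ends
  strictly below \<open>d\<close>, from where the next vertex is \<open>k\<close>.\<close>

lemma reaches_nondiv:
  assumes "reaches nbrs S k" "1 \<le> x" "x \<le> k" "\<not> d dvd x"
  shows "reaches nbrs S x"
  using assms(2-)
proof (induction "nat x" arbitrary: x rule: less_induct)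
  case less
  have "x \<noteq> d" using less.prems by auto
  then consider "x < d" | "d < x" by linarith
  then show ?case
  proof cases
    case 1 then show ?thesis using reaches_step[OF nbrs_step(1)] less.prems assms(1) by blast
  next
    case 2
    have "\<not> d dvd x - d" using less.prems(3) dvd_add[of d "x - d" d] by auto
    then have "reaches nbrs S (x - d)" using less.hyps[of "x - d"] less.prems 2 d_pos by simp
    then show ?thesis using nbrs_reaches_desc 2 less.prems by blast
  qed
qed

text \<open>\<open>orbit (- k)\<close> is the orbit of \<open>k\<close>: every second step descends
  by \<open>d\<close>, down to \<open>s\<close>, and \<open>1 \<le> s < d\<close> sends it back to
  \<open>k\<close>. The other orbit to be checked is that of \<open>-1\<close>. It continues at
  \<open>k - 1\<close>, which is congruent to \<open>s - 1\<close> modulo \<open>d\<close>; this is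
  not 0 because \<open>s \<ge> 2\<close>, so its descent ends at \<open>k\<close> as well.\<close>

lemma link_contractible:
  assumes s2: "2 \<le> s"
  shows "contractible_space (clique_complex_space (residues n (PC n nbrs)) (cedge n sh))"
proof (rule PC_contractible[where S = "orbit (- k)"])
  have k2: "2 \<le> k" using k_eq ld_nonneg s2 by simp
  show "nbrs \<noteq> {}" using k2 by (auto simp: nbrs_def)
  have kin: "k - i * d \<in> orbit (- k)" if "0 \<le> i" "i \<le> l" for i
    using orbitI(1)[OF that, of "-k"] by simp
  have lt: "i * d < k" if "i \<le> l" for i using mult_d_mono[OF that] k_eq s2 by simp
  have neg: "- ((i + 1) * d) + 1 * n = k - (- k) - i * d" for i using n_eq by (simp add: algebra_simps)
  have pos: "0 < (i + 1) * d" if "0 \<le> i" for i using d_pos that by simp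
  show "orbit (- k) \<subseteq> PC n nbrs"
  proof
    fix a assume "a \<in> orbit (- k)"
    then consider i where "a = k - i * d" "0 \<le> i" "i \<le> l" | i where "a = k - (- k) - i * d" "0 \<le> i" "i < l"
      unfolding orbit_def by auto
    then show "a \<in> PC n nbrs"
    proof cases
      case 1
      then have "0 \<le> i * d" using d_pos by simp
      then have "a \<in> nbrs" using 1 lt[of i] by (auto simp: nbrs_def)
      then show ?thesis by (rule PC_I)
    next
      case 2
      then have "- ((i + 1) * d) \<in> nbrs" using pos[of i] lt[of "i + 1"] by (auto simp: nbrs_def)
      then show ?thesis unfolding 2 neg[symmetric] by (rule PC_I')
    qed
  qed
  show "rst (PC n nbrs) sh a \<in> PC n (orbit (- k))" if h: "a \<in> orbit (- k)" for a
  proof -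
    consider i where "a = k - i * d" "0 \<le> i" "i < l" | "a = s" | i where "a = k - (- k) - i * d" "0 \<le> i" "i < l"
    proof -
      from h consider i where "a = k - i * d" "0 \<le> i" "i \<le> l" | i where "a = k - (- k) - i * d" "0 \<le> i" "i < l"
        unfolding orbit_def by auto
      then show thesis
      proof cases
        case (1 i) then show ?thesis using that(1)[of i] that(2) k_eq by (cases "i = l") auto
      qed (use that(3) in blast)
    qed
    then show ?thesis
    proof cases
      case 1
      have "i * d + d \<le> k" using mult_d_Suc[OF 1(3)] k_eq s0 by simp
      moreover have "0 \<le> i * d" using 1 d_pos by simp
      ultimately have "rst (PC n nbrs) sh a = (a - d - k) + 1 * n" using 1 by (intro nbrs_step(2)) auto
      also have "\<dots> = k - (- k) - i * d" unfolding 1 using n_eq by simp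
      finally show ?thesis using orbitI(2)[OF 1(2,3), of "-k"] PC_I by simp
    next
      case 2
      have "rst (PC n nbrs) sh a = k" unfolding 2 using s2 sd k_eq ld_nonneg by (intro nbrs_step(1)) auto
      then show ?thesis using kin[of 0] l0 PC_I by simp
    next
      case 3
      have m: "- ((i + 1) * d) \<in> PC n nbrs" using pos[of i] lt[of "i + 1"] 3 by (intro PC_I) (auto simp: nbrs_def)
      have "rst (PC n nbrs) sh a = rst (PC n nbrs) sh (- ((i + 1) * d)) + 1 * n"
        unfolding 3 neg[symmetric] by (rule rst_shift[OF m])
      also have "\<dots> = k - (i + 1) * d + 1 * n"
        using nbrs_step(3)[of "(i + 1) * d"] pos[of i] lt[of "i + 1"] 3 by simp
      finally show ?thesis using kin[of "i + 1"] 3 PC_I'[of _ _ 1 n] by simp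
    qed
  qed
  show "reaches nbrs (orbit (- k)) a" if "a \<in> nbrs" for a
  proof -
    have rk: "reaches nbrs (orbit (- k)) k" using kin[of 0] l0 by (intro reaches_base PC_I) simp
    have nd: "\<not> d dvd k - 1"
    proof
      assume "d dvd k - 1"
      moreover have "k - 1 = l * d + (s - 1)" using k_eq by simp
      ultimately have "d dvd s - 1" by (simp add: dvd_add_right_iff)
      then show False using s2 sd zdvd_imp_le by fastforce
    qed
    have "reaches nbrs (orbit (- k)) (k - 1)" by (rule reaches_nondiv[OF rk]) (use k2 nd in auto)
    then have "reaches nbrs (orbit (- k)) (- 1)"
      using reaches_step nbrs_step(3)[of 1] k2 by simp
    then show ?thesis using nbrs_reaches_all[OF rk] that by blast
  qed
  show "cadj n k (b - a)" if "a \<in> orbit (- k)" "b \<in> orbit (- k)" "a \<noteq> b" for a b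
    using orbit_adj that by blast
qed

section \<open>A circulant graph without one vertex\<close>

definition punct :: "int set" where "punct = {1..n - 1}"

lemma mem_punct: "x \<in> PC n punct \<longleftrightarrow> \<not> n dvd x"
proof
  assume "x \<in> PC n punct"
  then obtain a m where a: "a \<in> punct" "x = a + m * n" unfolding PC_def by blast
  then have "\<not> n dvd a" using zdvd_imp_le[of n a] by (auto simp: punct_def)
  then show "\<not> n dvd x" using a(2) by (simp add: dvd_add_left_iff)
next
  assume "\<not> n dvd x"
  then have "x mod n \<noteq> 0" by (simp add: dvd_eq_mod_eq_0)
  moreover have "0 \<le> x mod n" "x mod n < n" using n_pos by simp_all
  ultimately have "x mod n \<in> punct" unfolding punct_def by simp
  then have "x mod n + (x div n) * n \<in> PC n punct" by (rule PC_I')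
  then show "x \<in> PC n punct" by simp
qed

lemma not_dvd_range: "z \<noteq> 0 \<Longrightarrow> \<bar>z\<bar> < n \<Longrightarrow> \<not> n dvd z"
  using zdvd_imp_le[of n "\<bar>z\<bar>"] by auto

lemma punct_step:
  assumes k: "1 \<le> k" and x: "\<not> n dvd x"
  shows "\<not> n dvd x + k \<Longrightarrow> rst (PC n punct) sh x = x + k"
    "n dvd x + k \<Longrightarrow> rst (PC n punct) sh x = x + k - 1"
proof -
  show "rst (PC n punct) sh x = x + k" if "\<not> n dvd x + k"
    by (rule rst_eqI) (use that x k mem_punct in auto)
  show "rst (PC n punct) sh x = x + k - 1" if "n dvd x + k"
  proof (rule rst_eqI)
    have "\<not> n dvd 1" using n_gt k not_dvd_range[of 1] by simp
    then have "\<not> n dvd x + k - 1" using dvd_diff[OF that, of "x + k - 1"] by auto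
    then show "x + k - 1 \<in> PC n punct" using mem_punct by simp
    fix y assume "y \<in> PC n punct" "x + k - 1 < y" "y \<le> x + k"
    then have "y = x + k" "\<not> n dvd y" using mem_punct by auto
    then show False using that by simp
  qed (use x k mem_punct in auto)
qed

lemma even_mult: "(2 * a) * k = a * n - a * d"
  using n_eq by (simp add: algebra_simps)

lemma full_turn: "(2 * l + 1) * k = l * n + s"
  using n_eq k_eq by (simp add: algebra_simps)

text \<open>For \<open>s = 1\<close> the shift has a power that moves by 1 modulo \<open>n\<close>,
  so each of its orbits meets the deleted vertex. There the restricted map goes to \<open>-1\<close>
  instead, and \<open>-1\<close> returns to itself through \<open>orbit 1\<close>, whose last point
  \<open>- 1 - l * d = - k\<close> again precedes the deleted vertex.\<close>

lemma punct_contractible: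
  assumes s1: "s = 1"
  shows "contractible_space (clique_complex_space (residues n (PC n punct)) (cedge n sh))"
proof (rule PC_contractible[where S = "orbit 1"])
  have k1: "1 \<le> k" using k_eq ld_nonneg s1 by simp
  show "punct \<noteq> {}" using n_gt k1 by (auto simp: punct_def)
  have r1: "\<not> n dvd - 1 - i * d" if "0 \<le> i" "i \<le> l" for i
  proof (rule not_dvd_range)
    have "0 \<le> i * d" "i * d \<le> l * d" using that d_pos mult_d_mono by auto
    then show "- 1 - i * d \<noteq> 0" "\<bar>- 1 - i * d\<bar> < n" using k_eq s1 n_gt by linarith+
  qed
  have r2: "\<not> n dvd k - 1 - i * d" if "0 \<le> i" "i < l" for i
  proof (rule not_dvd_range)
    have "0 \<le> i * d" "i * d + d \<le> l * d" using that d_pos mult_d_Suc by auto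
    then show "k - 1 - i * d \<noteq> 0" "\<bar>k - 1 - i * d\<bar> < n" using k_eq s1 n_gt d_pos by linarith+
  qed
  show "orbit 1 \<subseteq> PC n punct" unfolding orbit_def using r1 r2 mem_punct by auto
  show "rst (PC n punct) sh a \<in> PC n (orbit 1)" if h: "a \<in> orbit 1" for a
  proof -
    consider i where "a = - 1 - i * d" "0 \<le> i" "i < l" | "a = - k" | i where "a = k - 1 - i * d" "0 \<le> i" "i < l"
    proof -
      from h consider i where "a = - 1 - i * d" "0 \<le> i" "i \<le> l" | i where "a = k - 1 - i * d" "0 \<le> i" "i < l"
        unfolding orbit_def by auto
      then show thesis
      proof cases
        case (1 i) then show ?thesis using that(1)[of i] that(2) k_eq s1 by (cases "i = l") auto
      qed (use that(3) in blast)
    qed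
    then show ?thesis
    proof cases
      case 1
      have e: "a + k = k - 1 - i * d" using 1 by simp
      have na: "\<not> n dvd a" using r1[of i] 1 by simp
      have "\<not> n dvd a + k" unfolding e using r2[of i] 1 by simp
      then have "rst (PC n punct) sh a = a + k" by (rule punct_step(1)[OF k1 na])
      then have "rst (PC n punct) sh a = k - 1 - i * d" using e by simp
      then show ?thesis using orbitI(2)[OF 1(2,3), of 1] PC_I by simp
    next
      case 2
      then have "rst (PC n punct) sh a = - 1" using punct_step(2)[OF k1, of a] not_dvd_range[of a] k1 n_gt by simp
      then show ?thesis using orbitI(1)[of 0 1] l0 PC_I by simp
    next
      case 3
      have e: "a + k = (- 1 - (i + 1) * d) + 1 * n" using 3 n_eq by (simp add: algebra_simps)
      have "\<not> n dvd a + k" using r1[of "i + 1"] 3 unfolding e by (simp add: dvd_add_left_iff)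
      moreover have "\<not> n dvd a" using r2[of i] 3 by simp
      ultimately have "rst (PC n punct) sh a = a + k" by (intro punct_step(1)[OF k1])
      then have "rst (PC n punct) sh a = (- 1 - (i + 1) * d) + 1 * n" using e by simp
      moreover have "(- 1 - (i + 1) * d) + 1 * n \<in> PC n (orbit 1)"
        by (rule PC_I', rule orbitI(1)) (use 3 in auto)
      ultimately show ?thesis by simp
    qed
  qed
  show "reaches punct (orbit 1) a" if a: "a \<in> punct" for a
  proof -
    have nd: "\<not> n dvd a" using mem_punct PC_I[OF a] by blast
    define P where "P = (\<lambda>j::nat. n dvd a + int j * k)"
    have "\<exists>j. P j"
    proof -
      \<comment> \<open>Every \<open>2 * l + 1\<close> steps of the shift amount to moving by 1
        modulo \<open>n\<close>, so \<open>t\<close> such blocks lead from \<open>a\<close> to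
        0.\<close>
      define t where "t = nat ((- a) mod n)"
      have t: "int t = (- a) mod n" using n_pos by (simp add: t_def)
      have "a + int (t * nat (2 * l + 1)) * k = a + int t * ((2 * l + 1) * k)" using l0 by (simp add: algebra_simps)
      also have "\<dots> = (a + int t) + (int t * l) * n" unfolding full_turn s1 by (simp add: algebra_simps)
      finally have "a + int (t * nat (2 * l + 1)) * k = (a + int t) + (int t * l) * n" .
      moreover have "n dvd a + int t" unfolding t by (simp add: dvd_eq_mod_eq_0 mod_simps)
      ultimately show ?thesis unfolding P_def by (intro exI[of _ "t * nat (2 * l + 1)"]) (simp only: dvd_add dvd_triv_right)
    qed
    then have PL: "P (LEAST j. P j)" by (rule LeastI_ex)
    define j where "j = (LEAST j. P j)"
    have least: "\<not> P i" if "i < j" for i using that not_less_Least unfolding j_def by blast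
    have "\<not> P 0" using nd by (simp add: P_def)
    then obtain i where i: "j = Suc i" using PL unfolding j_def[symmetric] by (cases j) auto
    have it: "(rst (PC n punct) sh ^^ m) a = a + int m * k" if "m \<le> i" for m
      using that
    proof (induction m)
      case (Suc m)
      have "\<not> n dvd a + int m * k" "\<not> n dvd (a + int m * k) + k"
        using least[of m] least[of "Suc m"] Suc.prems i unfolding P_def by (auto simp: algebra_simps)
      then show ?case using Suc punct_step(1)[OF k1] by (simp add: algebra_simps)
    qed simp
    have "P (Suc i)" using PL i unfolding j_def by simp
    then have "n dvd (a + int i * k) + k" unfolding P_def by (simp add: algebra_simps)
    moreover have "\<not> n dvd a + int i * k" using least[of i] i unfolding P_def by simp
    ultimately have last: "(rst (PC n punct) sh ^^ j) a = (a + int i * k) + k - 1"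
      using it[of i] punct_step(2)[OF k1] i by simp
    obtain m where "(a + int i * k) + k = n * m" using \<open>n dvd (a + int i * k) + k\<close> by blast
    then have "(rst (PC n punct) sh ^^ j) a = (- 1 - 0 * d) + m * n" using last by (simp add: mult.commute)
    moreover have "(- 1 - 0 * d) + m * n \<in> PC n (orbit 1)" by (rule PC_I', rule orbitI(1)) (use l0 in auto)
    ultimately have "(rst (PC n punct) sh ^^ j) a \<in> PC n (orbit 1)" by simp
    then show ?thesis unfolding reaches_def by blast
  qed
  show "cadj n k (b - a)" if "a \<in> orbit 1" "b \<in> orbit 1" "a \<noteq> b" for a b
    using orbit_adj that by blast
qed

text \<open>A point pushed back to \<open>-1\<close> by the deleted vertex does not meet that vertex
  during the next \<open>2 * l\<close> steps. Depending on the parity of \<open>t\<close>, the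
  product \<open>t * k\<close> is congruent to \<open>- a * d\<close> or to
  \<open>k - a * d\<close>, and subtracting 1 leaves a non-zero number of absolute value below
  \<open>n\<close>.\<close>

lemma mult_k_not_1:
  assumes s: "2 \<le> s" and t: "1 \<le> t" "t \<le> 2 * l" shows "\<not> n dvd t * k - 1"
proof (cases "even t")
  case True
  then obtain a where a: "t = 2 * a" by blast
  have "0 \<le> a * d" "a * d \<le> l * d" using a t d_pos mult_d_mono[of a l] by auto
  then have "\<not> n dvd - a * d - 1" using k_eq n_gt s by (intro not_dvd_range) auto
  moreover have "t * k - 1 = (- a * d - 1) + a * n" unfolding a even_mult by (simp add: algebra_simps)
  ultimately show ?thesis by (metis dvd_add_left_iff dvd_triv_right)
next
  case False
  then obtain a where a: "t = 2 * a + 1" using oddE by blast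
  have b: "0 \<le> a * d" "a * d + d \<le> l * d" using a t d_pos mult_d_Suc[of a l] by auto
  have "\<not> n dvd k - a * d - 1"
    by (rule not_dvd_range) (use b k_eq n_gt s d_pos in linarith)+
  moreover have "t * k - 1 = (k - a * d - 1) + a * n" unfolding a using even_mult[of a] by (simp add: algebra_simps)
  ultimately show ?thesis by (metis dvd_add_left_iff dvd_triv_right)
qed

text \<open>An orbit follows the shift except that it is pushed back by one, at most once in
  \<open>2 * l + 1\<close> steps. It therefore advances by at least \<open>l * n + s - 1\<close>,
  and \<open>s \<ge> 2\<close>.\<close>

lemma punct_rotation:
  assumes s: "2 \<le> s" and x: "x \<in> PC n punct"
  shows "(rst (PC n punct) sh ^^ nat (2 * l + 1)) x > x + l * n"
proof -
  let ?G = "rst (PC n punct) sh"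
  have k1: "1 \<le> k" using k_eq ld_nonneg s by simp
  have ne: "punct \<noteq> {}" using x by (auto simp: PC_def)
  have V: "\<not> n dvd (?G ^^ i) x" for i using cyc_funpow(1)[OF cyc_PC[OF ne] x] mem_punct by blast
  have "(?G ^^ i) x = x + int i * k \<or> (\<exists>j. 1 \<le> j \<and> j \<le> i \<and> n dvd x + int j * k \<and> (?G ^^ i) x = x + int i * k - 1)"
    if "i \<le> nat (2 * l + 1)" for i
    using that
  proof (induction i)
    case (Suc i)
    then consider "(?G ^^ i) x = x + int i * k" |
      j where "1 \<le> j" "j \<le> i" "n dvd x + int j * k" "(?G ^^ i) x = x + int i * k - 1" by fastforce
    then show ?case
    proof cases
      case 1
      show ?thesis
      proof (cases "n dvd (?G ^^ i) x + k")
        case True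
        have "(?G ^^ Suc i) x = (?G ^^ i) x + k - 1" using punct_step(2)[OF k1 V True] by simp
        then have "(?G ^^ Suc i) x = x + int (Suc i) * k - 1" using 1 by (simp add: algebra_simps)
        moreover have "n dvd x + int (Suc i) * k" using True 1 by (simp add: algebra_simps)
        ultimately show ?thesis by (intro disjI2 exI[of _ "Suc i"]) simp
      next
        case False
        have "(?G ^^ Suc i) x = (?G ^^ i) x + k" using punct_step(1)[OF k1 V False] by simp
        then have "(?G ^^ Suc i) x = x + int (Suc i) * k" using 1 by (simp add: algebra_simps)
        then show ?thesis ..
      qed
    next
      case 2
      have "\<not> n dvd (?G ^^ i) x + k"
      proof
        assume "n dvd (?G ^^ i) x + k"
        then have "n dvd (x + int i * k - 1 + k) - (x + int j * k)" using 2 by (metis dvd_diff)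
        moreover have "(x + int i * k - 1 + k) - (x + int j * k) = (int (Suc i) - int j) * k - 1" by (simp add: algebra_simps)
        moreover have "\<not> n dvd (int (Suc i) - int j) * k - 1"
          by (rule mult_k_not_1[OF s]) (use 2 Suc.prems in linarith)+
        ultimately show False by simp
      qed
      then have "(?G ^^ Suc i) x = (?G ^^ i) x + k" using punct_step(1)[OF k1 V] by simp
      then have "(?G ^^ Suc i) x = x + int (Suc i) * k - 1" using 2(4) by (simp add: algebra_simps del: funpow.simps)
      then show ?thesis using 2 by (intro disjI2 exI[of _ j]) simp
    qed
  qed simp
  from this[of "nat (2 * l + 1)"] have "(?G ^^ nat (2 * l + 1)) x \<ge> x + int (nat (2 * l + 1)) * k - 1" by auto
  moreover have "int (nat (2 * l + 1)) * k = l * n + s" using full_turn l0 by simp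
  ultimately show ?thesis using s by simp
qed


section \<open>The cross-polytope in the link\<close>

definition cross :: "int set" where
  "cross = {k - i * d | i. 0 \<le> i \<and> i < l + s} \<union> {- (i * d) | i. 1 \<le> i \<and> i \<le> l}
     \<union> {- 1 - i * d | i. 0 \<le> i \<and> i < l + s} \<union> {k - 1 - i * d | i. 0 \<le> i \<and> i < l}"

lemma crossI:
  "0 \<le> i \<Longrightarrow> i < l + s \<Longrightarrow> k - i * d \<in> cross" "1 \<le> i \<Longrightarrow> i \<le> l \<Longrightarrow> - (i * d) \<in> cross"
  "0 \<le> i \<Longrightarrow> i < l + s \<Longrightarrow> - 1 - i * d \<in> cross" "0 \<le> i \<Longrightarrow> i < l \<Longrightarrow> k - 1 - i * d \<in> cross"
  unfolding cross_def by blast+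

lemma crossE:
  assumes "a \<in> cross"
  obtains (A) i where "a = k - i * d" "0 \<le> i" "i < l + s" | (B) i where "a = - (i * d)" "1 \<le> i" "i \<le> l"
    | (C) i where "a = - 1 - i * d" "0 \<le> i" "i < l + s" | (D) i where "a = k - 1 - i * d" "0 \<le> i" "i < l"
  using assms unfolding cross_def by blast

text \<open>Modulo \<open>n\<close>, the points of types A and B alternate along a chain starting at
  \<open>k\<close>, and those of types C and D along a chain starting at \<open>-1\<close>. For
  \<open>s = 1\<close> each chain closes up to an orbit of length \<open>2 * l + 1\<close>. For
  \<open>s = 0\<close> each chain ends at the start of the other (\<open>- (l * d) = - k\<close>
  goes to \<open>-1\<close>, and \<open>d - 1\<close> goes to \<open>k\<close>), which makes one
  orbit of length \<open>4 * l\<close>.\<close>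

lemma cross_steps:
  assumes s: "s = 0 \<or> s = 1" and d2: "2 \<le> d" and k1: "1 \<le> k"
  defines "G \<equiv> rst (PC n nbrs) sh"
  shows "0 \<le> i \<Longrightarrow> i < l \<Longrightarrow> G (k - i * d) = - ((i + 1) * d) + 1 * n"
    "s = 1 \<Longrightarrow> G (k - l * d) = k"
    "1 \<le> i \<Longrightarrow> i < l + s \<Longrightarrow> G (- (i * d)) = k - i * d"
    "s = 0 \<Longrightarrow> G (- (l * d)) = - 1"
    "0 \<le> i \<Longrightarrow> i < l \<Longrightarrow> G (- 1 - i * d) = k - 1 - i * d"
    "s = 1 \<Longrightarrow> G (- 1 - l * d) = - 1"
    "0 \<le> i \<Longrightarrow> i + 1 < l + s \<Longrightarrow> G (k - 1 - i * d) = (- 1 - (i + 1) * d) + 1 * n"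
    "s = 0 \<Longrightarrow> G (k - 1 - (l - 1) * d) = k"
proof -
  show "G (k - i * d) = - ((i + 1) * d) + 1 * n" if "0 \<le> i" "i < l"
  proof -
    have b: "0 \<le> i * d" "i * d + d \<le> l * d" using that d_pos mult_d_Suc by auto
    have "G (k - i * d) = (k - i * d - d - k) + 1 * n" unfolding G_def by (rule nbrs_step(2)) (use b k_eq s0 in linarith)+
    then show ?thesis by (simp add: algebra_simps)
  qed
  show "G (k - l * d) = k" if "s = 1"
    unfolding G_def by (rule nbrs_step(1)) (use k_eq that d2 ld_nonneg in linarith)+
  show "G (- (i * d)) = k - i * d" if "1 \<le> i" "i < l + s"
  proof -
    have "1 * d \<le> i * d" using that by (intro mult_d_mono)
    moreover have "i * d < k"
    proof (cases "i < l")
      case True then show ?thesis using mult_d_Suc[OF True] k_eq s0 d_pos by linarith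
    next
      case False
      then have "i = l" "s = 1" using that s by auto
      then show ?thesis using k_eq by simp
    qed
    ultimately show ?thesis unfolding G_def using d_pos by (intro nbrs_step(3)) linarith+
  qed
  show "G (- (l * d)) = - 1" if "s = 0" using nbrs_step(4)[OF k1] k_eq that by (simp add: G_def)
  show "G (- 1 - i * d) = k - 1 - i * d" if "0 \<le> i" "i < l"
  proof -
    have b: "0 \<le> i * d" "i * d + d \<le> l * d" using that d_pos mult_d_Suc by auto
    have "G (- (1 + i * d)) = k - (1 + i * d)" unfolding G_def by (rule nbrs_step(3)) (use b k_eq s0 d2 in linarith)+
    then show ?thesis by simp
  qed
  show "G (- 1 - l * d) = - 1" if "s = 1"
  proof -
    have "- 1 - l * d = - k" using k_eq that by simp
    then show ?thesis unfolding G_def using nbrs_step(4)[OF k1] by simp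
  qed
  show "G (k - 1 - i * d) = (- 1 - (i + 1) * d) + 1 * n" if "0 \<le> i" "i + 1 < l + s"
  proof -
    have "i * d + d \<le> l * d" using that s by (intro mult_d_Suc) linarith
    moreover have "i * d + 2 * d \<le> l * d" if "s = 0"
    proof -
      have "(i + 1) * d + d \<le> l * d" using \<open>i + 1 < l + s\<close> that by (intro mult_d_Suc) linarith
      then show ?thesis by (simp add: algebra_simps)
    qed
    ultimately have "i * d + d \<le> k - 1" using k_eq s d2 by auto
    moreover have "0 \<le> i * d" using that d_pos by simp
    ultimately have "G (k - 1 - i * d) = (k - 1 - i * d - d - k) + 1 * n" unfolding G_def by (intro nbrs_step(2)) linarith+
    then show ?thesis by (simp add: algebra_simps)
  qed
  show "G (k - 1 - (l - 1) * d) = k" if "s = 0"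
  proof -
    have "k - 1 - (l - 1) * d = d - 1" using k_eq that by (simp add: algebra_simps)
    moreover have "d \<le> k"
    proof -
      have "l \<noteq> 0" using k1 k_eq that by auto
      then show ?thesis using mult_d_mono[of 1 l] l0 k_eq s0 by simp
    qed
    ultimately show ?thesis unfolding G_def using d2 by (simp add: nbrs_step(1))
  qed
qed

lemma cross_nbrs:
  assumes s: "s = 0 \<or> s = 1" and d2: "2 \<le> d" shows "cross \<subseteq> nbrs"
proof
  fix a assume "a \<in> cross"
  have up: "i * d < l * d \<or> i * d \<le> l * d \<and> s = 1 " if "i < l + s" for i
    using s that mult_d_Suc[of i l] mult_d_mono[of i l] d_pos by linarith
  from \<open>a \<in> cross\<close> show "a \<in> nbrs"
  proof (cases rule: crossE)
    case (A i)
    have "0 \<le> i * d" using A d_pos by simp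
    then have "1 \<le> a" "a \<le> k" using up[OF A(3)] A k_eq s by linarith+
    then show ?thesis by (simp add: nbrs_def)
  next
    case (B i)
    have "1 * d \<le> i * d" "i * d \<le> k" using B mult_d_mono le_l_k by blast+
    then have "- k \<le> a" "a \<le> - 1" using B d_pos by linarith+
    then show ?thesis by (simp add: nbrs_def)
  next
    case (C i)
    have "0 \<le> i * d" using C d_pos by simp
    then have "- k \<le> a" "a \<le> - 1" using up[OF C(3)] C k_eq s by linarith+
    then show ?thesis by (simp add: nbrs_def)
  next
    case (D i)
    have "0 \<le> i * d" "i * d + d \<le> l * d" using D d_pos mult_d_Suc by auto
    then have "1 \<le> a" "a \<le> k" using D k_eq s0 d2 by linarith+
    then show ?thesis by (simp add: nbrs_def)
  qed
qed

text \<open>\<open>cross\<close> contains \<open>k\<close> and \<open>-1\<close>, so every orbit of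
  the link enters it; modulo \<open>n\<close> it is its own image, so nothing of it is
  removed.\<close>

lemma cross_collapse:
  assumes s: "s = 0 \<or> s = 1" and d2: "2 \<le> d" and k1: "1 \<le> k"
  shows "strong_collapse (cedge n sh) (residues n (PC n nbrs)) (residues n (PC n cross))"
proof -
  let ?G = "rst (PC n nbrs) sh"
  note G = cross_steps[OF s d2 k1]
  have ne: "nbrs \<noteq> {}" using k1 by (auto simp: nbrs_def)
  have ls: "0 < l + s" using k1 k_eq s l0 by (cases "l = 0") auto
  have sub: "cross \<subseteq> nbrs" by (rule cross_nbrs[OF s d2])
  have l1: "1 \<le> l" if "s = 0" using ls that by simp
  have kc: "k \<in> cross" using crossI(1)[of 0] ls by simp
  have mc: "- 1 \<in> cross" using crossI(3)[of 0] ls by simp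
  have fwd: "?G a \<in> PC n cross" if "a \<in> cross" for a
    using that
  proof (cases rule: crossE)
    case (A i)
    show ?thesis
    proof (cases "i < l")
      case True
      then show ?thesis using G(1)[of i] A PC_I'[OF crossI(2)[of "i + 1"], of 1] by simp
    next
      case False
      then have "i = l" "s = 1" using A s by auto
      then show ?thesis using G(2) A PC_I[OF kc] by simp
    qed
  next
    case (B i)
    show ?thesis
    proof (cases "i < l + s")
      case True
      then show ?thesis using G(3)[of i] B PC_I[OF crossI(1)[of i]] by simp
    next
      case False
      then have "i = l" "s = 0" using B s by auto
      then show ?thesis using G(4) B PC_I[OF mc] by simp
    qed
  next
    case (C i)
    show ?thesis
    proof (cases "i < l")
      case True
      then show ?thesis using G(5)[of i] C PC_I[OF crossI(4)[of i]] by simp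
    next
      case False
      then have "i = l" "s = 1" using C s by auto
      then show ?thesis using G(6) C PC_I[OF mc] by simp
    qed
  next
    case (D i)
    show ?thesis
    proof (cases "i + 1 < l + s")
      case True
      then show ?thesis using G(7)[of i] D PC_I'[OF crossI(3)[of "i + 1"], of 1] by simp
    next
      case False
      then have "i = l - 1" "s = 0" using D s by auto
      then show ?thesis using G(8) D PC_I[OF kc] by simp
    qed
  qed
  have bwd: "\<exists>b\<in>cross. \<exists>m. ?G b = a + m * n" if "a \<in> cross" for a
    using that
  proof (cases rule: crossE)
    case (A i)
    show ?thesis
    proof (cases "i = 0")
      case True
      show ?thesis
      proof (cases "s = 0")
        case s0: True
        then show ?thesis using G(8) True A crossI(4)[of "l - 1"] l1 by (intro bexI[of _ "k - 1 - (l - 1) * d"] exI[of _ 0]) auto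
      next
        case False
        then show ?thesis using G(2) True A crossI(1)[of l] s l0 by (intro bexI[of _ "k - l * d"] exI[of _ 0]) auto
      qed
    next
      case False
      then show ?thesis using G(3)[of i] A crossI(2)[of i] s by (intro bexI[of _ "- (i * d)"] exI[of _ 0]) auto
    qed
  next
    case (B i)
    then show ?thesis using G(1)[of "i - 1"] crossI(1)[of "i - 1"] s0 by (intro bexI[of _ "k - (i - 1) * d"] exI[of _ 1]) auto
  next
    case (C i)
    show ?thesis
    proof (cases "i = 0")
      case True
      show ?thesis
      proof (cases "s = 0")
        case s0: True
        then show ?thesis using G(4) True C crossI(2)[of l] l1 by (intro bexI[of _ "- (l * d)"] exI[of _ 0]) auto
      next
        case False
        then show ?thesis using G(6) True C crossI(3)[of l] s l0 by (intro bexI[of _ "- 1 - l * d"] exI[of _ 0]) auto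
      qed
    next
      case False
      then show ?thesis using G(7)[of "i - 1"] C crossI(4)[of "i - 1"] s by (intro bexI[of _ "k - 1 - (i - 1) * d"] exI[of _ 1]) auto
    qed
  next
    case (D i)
    then show ?thesis using G(5)[of i] crossI(3)[of i] s0 by (intro bexI[of _ "- 1 - i * d"] exI[of _ 0]) auto
  qed
  have inN: "x \<in> PC n nbrs" if "x \<in> cross" for x using that sub PC_I by blast
  have GA: "?G ` PC n cross = PC n cross"
  proof (intro equalityI subsetI)
    fix y assume "y \<in> ?G ` PC n cross"
    then obtain a m where a: "a \<in> cross" "y = ?G (a + m * n)" unfolding PC_def by blast
    then have "y = ?G a + m * n" using rst_shift inN by blast
    then show "y \<in> PC n cross" using fwd[OF a(1)] shift_mem[OF PC_periodic] by simp
  next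
    fix y assume "y \<in> PC n cross"
    then obtain a m where a: "a \<in> cross" "y = a + m * n" unfolding PC_def by blast
    obtain b i where b: "b \<in> cross" "?G b = a + i * n" using bwd[OF a(1)] by blast
    have "?G (b + (m - i) * n) = y" using rst_shift[OF inN[OF b(1)], of "m - i"] a b by (simp add: algebra_simps)
    then show "y \<in> ?G ` PC n cross" using PC_I'[OF b(1)] by blast
  qed
  have "strong_collapse (cedge n ?G) (residues n (PC n nbrs)) (residues n (PC n cross))"
  proof (rule cyc_collapse_onto[OF cyc_PC[OF ne] PC_periodic GA])
    show "PC n cross \<subseteq> PC n nbrs" using sub unfolding PC_def by blast
    fix x assume "x \<in> PC n nbrs"
    then obtain a m where a: "a \<in> nbrs" "x = a + m * n" unfolding PC_def by blast
    have "reaches nbrs cross a" by (rule nbrs_reaches_all[OF _ _ a(1)]) (use kc mc in \<open>auto intro!: reaches_base PC_I\<close>)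
    then have "reaches nbrs cross x" using reaches_shift[OF PC_I[OF a(1)]] a by simp
    then show "\<exists>i. (?G ^^ i) x \<in> PC n cross" by (simp add: reaches_def)
  qed
  then show ?thesis
    by (rule strong_collapse_cong) (use cedge_rst[OF cyc_sh _ PC_periodic, of nbrs] in auto)
qed


lemma residues_PC: "residues n (PC n X) = (\<lambda>a. a mod n) ` X"
proof (intro equalityI subsetI)
  fix y assume y: "y \<in> residues n (PC n X)"
  then obtain a m where "a \<in> X" "y = a + m * n" unfolding PC_def by blast
  moreover have "y = y mod n" using y by simp
  ultimately have "y = a mod n" by simp
  then show "y \<in> (\<lambda>a. a mod n) ` X" using \<open>a \<in> X\<close> by blast
next
  fix y assume "y \<in> (\<lambda>a. a mod n) ` X"
  then obtain a where a: "a \<in> X" "y = a mod n" by blast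
  have "a mod n = a + (- (a div n)) * n" by (simp add: minus_div_mult_eq_mod[symmetric])
  then have "y \<in> PC n X" using PC_I'[OF a(1)] a(2) by metis
  then show "y \<in> residues n (PC n X)" using a(2) n_pos by simp
qed

lemma cadj_mod: "cadj n k (y mod n - x mod n) \<longleftrightarrow> cadj n k (y - x)"
proof -
  have "y mod n - x mod n = y - x + (x div n - y div n) * n"
    by (simp add: minus_div_mult_eq_mod[symmetric] algebra_simps)
  then show ?thesis using cadj_shift by simp
qed

lemma mod_nbrs: "1 \<le> a \<Longrightarrow> a \<le> k \<Longrightarrow> a mod n = a" "- k \<le> a \<Longrightarrow> a \<le> - 1 \<Longrightarrow> a mod n = a + n"
proof -
  show "1 \<le> a \<Longrightarrow> a \<le> k \<Longrightarrow> a mod n = a" using n_gt k_nonneg by simp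
  assume a: "- k \<le> a" "a \<le> - 1"
  have "(a + n) mod n = a + n" using a n_gt k_nonneg by (intro mod_pos_pos_trivial) auto
  then show "a mod n = a + n" by simp
qed

text \<open>Vertices of equal sign differ by less than \<open>k\<close> and are adjacent. Between
  opposite signs, the non-adjacent differences are those strictly between \<open>k\<close> and
  \<open>k + d\<close>, so \<open>opp\<close> says that every positive vertex misses exactly its
  negative partner.\<close>

lemma cross_join:
  fixes pos neg :: "nat \<Rightarrow> int"
  assumes pos: "\<And>i. i < r \<Longrightarrow> 1 \<le> pos i \<and> pos i \<le> k" and neg: "\<And>i. i < r \<Longrightarrow> - k \<le> neg i \<and> neg i \<le> - 1"
    and inj: "\<And>i j. i < r \<Longrightarrow> j < r \<Longrightarrow> pos i = pos j \<or> neg i = neg j \<Longrightarrow> i = j"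
    and opp: "\<And>i j. i < r \<Longrightarrow> j < r \<Longrightarrow> k < pos i - neg j \<and> pos i - neg j < k + d \<longleftrightarrow> i = j"
    and X: "X = pos ` {..<r} \<union> neg ` {..<r}"
  shows "points_join m (residues n (PC n X)) (cedge n sh) homotopy_equivalent_space
    clique_complex_space (join_verts m r) join_adj"
proof -
  define h where "h = (\<lambda>(i, b). if b then pos i else neg i)"
  have hr: "\<bar>h p\<bar> \<le> k" "h p \<noteq> 0" if "fst p < r" for p
    using pos[OF that] neg[OF that] by (auto simp: h_def split: prod.splits)
  have hinj: "p = q" if "fst p < r" "fst q < r" "h p = h q" for p q
    using pos[OF that(1)] pos[OF that(2)] neg[OF that(1)] neg[OF that(2)] that(3) inj[OF that(1,2)]
    by (cases p; cases q) (auto simp: h_def split: if_splits)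
  have injmod: "inj_on (\<lambda>p. h p mod n) ({..<r} \<times> UNIV)"
  proof (rule inj_onI)
    fix p q assume pq: "p \<in> {..<r} \<times> UNIV" "q \<in> {..<r} \<times> UNIV" "h p mod n = h q mod n"
    then have r: "fst p < r" "fst q < r" by auto
    have "n dvd h p - h q" using pq(3) by (simp add: mod_eq_dvd_iff)
    then have "h p - h q = 0" using not_dvd_range[of "h p - h q"] hr[OF r(1)] hr[OF r(2)] n_gt by (cases "h p - h q = 0") auto
    then show "p = q" using hinj r by simp
  qed
  have img: "(\<lambda>p. h p mod n) ` ({..<r} \<times> UNIV) = residues n (PC n X)"
  proof -
    have "h ` ({..<r} \<times> UNIV) = X"
    proof (intro equalityI subsetI)
      fix x assume "x \<in> X"
      then consider i where "i < r" "x = h (i, True)" | i where "i < r" "x = h (i, False)" unfolding X h_def by auto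
      then show "x \<in> h ` ({..<r} \<times> UNIV)" by cases auto
    qed (auto simp: X h_def)
    then show ?thesis unfolding residues_PC using image_image[of "\<lambda>a. a mod n" h "{..<r} \<times> UNIV"] by simp
  qed
  define g where "g = inv_into ({..<r} \<times> UNIV) (\<lambda>p. h p mod n)"
  have bij: "bij_betw (\<lambda>p. h p mod n) ({..<r} \<times> UNIV) (residues n (PC n X))"
    using injmod img by (simp add: bij_betw_def)
  have gin: "g a \<in> {..<r} \<times> UNIV" "h (g a) mod n = a" if "a \<in> residues n (PC n X)" for a
  proof -
    have "a \<in> (\<lambda>p. h p mod n) ` ({..<r} \<times> UNIV)" using that img by simp
    then show "g a \<in> {..<r} \<times> UNIV" "h (g a) mod n = a"
      unfolding g_def by (rule inv_into_into, rule f_inv_into_f)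
  qed
  have adj0: "cadj n k (h q - h p) \<longleftrightarrow> fst p \<noteq> fst q" if r: "fst p < r" "fst q < r" and pq: "p \<noteq> q" for p q
  proof -
    obtain i b j c where p: "p = (i, b)" "q = (j, c)" by (cases p; cases q) auto
    have ne: "h q - h p \<noteq> 0" using hinj[OF r] pq by auto
    have lt: "\<bar>h q - h p\<bar> < n" using hr[OF r(1)] hr[OF r(2)] n_gt by auto
    note C = cadj_range[OF lt ne n_gt]
    have ij: "i < r" "j < r" using r p by auto
    show ?thesis
    proof (cases "b = c")
      case True
      then have "i \<noteq> j" using pq p by auto
      moreover have "\<bar>h q - h p\<bar> \<le> k" using True p pos[OF ij(1)] pos[OF ij(2)] neg[OF ij(1)] neg[OF ij(2)] by (auto simp: h_def)
      ultimately show ?thesis using C p by auto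
    next
      case False
      then consider "b" "\<not> c" | "\<not> b" "c" by blast
      then show ?thesis
      proof cases
        case 1
        then have "\<bar>h q - h p\<bar> = pos i - neg j" using p pos[OF ij(1)] neg[OF ij(2)] by (auto simp: h_def)
        then show ?thesis using C opp[OF ij] p n_eq by auto
      next
        case 2
        then have "\<bar>h q - h p\<bar> = pos j - neg i" using p pos[OF ij(2)] neg[OF ij(1)] by (auto simp: h_def)
        then show ?thesis using C opp[OF ij(2,1)] p n_eq by auto
      qed
    qed
  qed
  show ?thesis
  proof (rule points_join_cross[of g])
    show "bij_betw g (residues n (PC n X)) ({..<r} \<times> UNIV)"
      unfolding g_def by (rule bij_betw_inv_into[OF bij])
    fix a b assume ab: "a \<in> residues n (PC n X)" "b \<in> residues n (PC n X)" "a \<noteq> b"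
    have "cadj n k (b - a) \<longleftrightarrow> cadj n k (h (g b) - h (g a))"
      using cadj_mod[of "h (g b)" "h (g a)"] gin(2)[OF ab(1)] gin(2)[OF ab(2)] by simp
    also have "\<dots> \<longleftrightarrow> fst (g a) \<noteq> fst (g b)"
      using gin[OF ab(1)] gin[OF ab(2)] ab(3) by (intro adj0) auto
    finally show "cedge n sh a b \<or> cedge n sh b a \<longleftrightarrow> fst (g a) \<noteq> fst (g b)" unfolding cadj_iff .
  qed simp
qed

lemma mult_d_gap: "m * d = 0 \<or> d \<le> m * d \<or> m * d \<le> - d"
proof -
  consider "m = 0" | "1 \<le> m" | "m \<le> -1" by linarith
  then show ?thesis using mult_d_mono[of 1 m] mult_d_mono[of m "-1"] by cases simp_all
qed

lemma cross_points_join: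
  assumes s: "s = 0 \<or> s = 1" and d2: "2 \<le> d"
  shows "points_join m (residues n (PC n cross)) (cedge n sh) homotopy_equivalent_space
    clique_complex_space (join_verts m (nat (2 * l + s))) join_adj"
proof (rule cross_join)
  \<comment> \<open>The pairs are \<open>(k - q * d, - 1 - q * d)\<close> with difference
    \<open>k + 1\<close>, and \<open>(k - 1 - q * d, - ((q + 1) * d))\<close> with difference
    \<open>k + d - 1\<close>. Any other difference is a non-zero multiple of \<open>d\<close> away
    from one of these, or is \<open>k\<close> plus a multiple of \<open>d\<close>; it misses the
    open gap from \<open>k\<close> to \<open>k + d\<close>.\<close>
  define pos where "pos = (\<lambda>q::nat. if int q < l + s then k - int q * d else k - 1 - (int q - (l + s)) * d)"
  define neg where "neg = (\<lambda>q::nat. if int q < l + s then - 1 - int q * d else - ((int q - (l + s) + 1) * d))"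
  have ls: "0 \<le> l + s" using l0 s0 by simp
  have pc: "pos i \<in> cross" "neg i \<in> cross" if "i < nat (2 * l + s)" for i
    using that crossI(1)[of "int i"] crossI(2)[of "int i - (l + s) + 1"] crossI(3)[of "int i"] crossI(4)[of "int i - (l + s)"]
    by (auto simp: pos_def neg_def)
  have c1: "(k < k + 1 + p \<and> k + 1 + p < k + d) \<longleftrightarrow> p = 0" if "p = 0 \<or> d \<le> p \<or> p \<le> - d" for p using that d2 by auto
  have c2: "\<not> (k < k + p \<and> k + p < k + d)" if "p = 0 \<or> d \<le> p \<or> p \<le> - d" for p using that d2 by auto
  have c3: "(k < k + p + (d - 1) \<and> k + p + (d - 1) < k + d) \<longleftrightarrow> p = 0" if "p = 0 \<or> d \<le> p \<or> p \<le> - d" for p using that d2 by auto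
  have z': "(int j - int i) * d = 0 \<longleftrightarrow> i = j" for i j using d_pos by auto
  have opp: "k < pos i - neg j \<and> pos i - neg j < k + d \<longleftrightarrow> i = j" for i j
  proof -
    consider "int i < l + s" "int j < l + s" | "int i < l + s" "\<not> int j < l + s"
      | "\<not> int i < l + s" "int j < l + s" | "\<not> int i < l + s" "\<not> int j < l + s" by blast
    then show ?thesis
    proof cases
      case 1
      then have "pos i - neg j = k + 1 + (int j - int i) * d" by (simp add: pos_def neg_def algebra_simps)
      then show ?thesis using c1[OF mult_d_gap, of "int j - int i"] z' by (simp only:)
    next
      case 2
      then have "pos i - neg j = k + (int j - (l + s) + 1 - int i) * d" by (simp add: pos_def neg_def algebra_simps)
      moreover have "i \<noteq> j" using 2 by auto
      ultimately show ?thesis using c2[OF mult_d_gap, of "int j - (l + s) + 1 - int i"] by (simp only: simp_thms)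
    next
      case 3
      then have "pos i - neg j = k + (int j - (int i - (l + s))) * d" by (simp add: pos_def neg_def algebra_simps)
      moreover have "i \<noteq> j" using 3 by auto
      ultimately show ?thesis using c2[OF mult_d_gap, of "int j - (int i - (l + s))"] by (simp only: simp_thms)
    next
      case 4
      then have "pos i - neg j = k + (int j - int i) * d + (d - 1)" by (simp add: pos_def neg_def algebra_simps)
      then show ?thesis using c3[OF mult_d_gap, of "int j - int i"] z' by (simp only:)
    qed
  qed
  show "k < pos i - neg j \<and> pos i - neg j < k + d \<longleftrightarrow> i = j" for i j by (rule opp)
  show "i = j" if "pos i = pos j \<or> neg i = neg j" for i j
    using that opp[of i j] opp[of j i] opp[of i i] opp[of j j] by auto
  have sub: "cross \<subseteq> nbrs" by (rule cross_nbrs[OF s d2])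
  have k_lt: "k < pos i - neg i" for i using opp[of i i] by auto
  show "1 \<le> pos i \<and> pos i \<le> k" "- k \<le> neg i \<and> neg i \<le> - 1" if "i < nat (2 * l + s)" for i
    using pc[OF that] sub k_lt[of i] by (auto simp: nbrs_def subset_iff)
  show "cross = pos ` {..<nat (2 * l + s)} \<union> neg ` {..<nat (2 * l + s)}"
  proof (intro equalityI subsetI)
    fix a assume "a \<in> cross"
    then show "a \<in> pos ` {..<nat (2 * l + s)} \<union> neg ` {..<nat (2 * l + s)}"
    proof (cases rule: crossE)
      case (A i)
      then have "a = pos (nat i)" "nat i < nat (2 * l + s)" using l0 by (auto simp: pos_def)
      then show ?thesis by blast
    next
      case (B i)
      then have "a = neg (nat (i - 1 + (l + s)))" "nat (i - 1 + (l + s)) < nat (2 * l + s)" using ls by (auto simp: neg_def)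
      then show ?thesis by blast
    next
      case (C i)
      then have "a = neg (nat i)" "nat i < nat (2 * l + s)" using l0 by (auto simp: neg_def)
      then show ?thesis by blast
    next
      case (D i)
      then have "a = pos (nat (i + (l + s)))" "nat (i + (l + s)) < nat (2 * l + s)" using ls by (auto simp: pos_def)
      then show ?thesis by blast
    qed
  qed (use pc in auto)
qed

lemma image_mod_nbrs:
  assumes "1 \<le> q"
  shows "(\<lambda>a. a mod n) ` {1..k} = {1..k}" "(\<lambda>a. a mod n) ` {- k..- q} = {n - k..n - q}"
proof -
  have "(\<lambda>a. a mod n) ` {1..k} = id ` {1..k}" by (rule image_cong) (use mod_nbrs(1) in auto)
  then show "(\<lambda>a. a mod n) ` {1..k} = {1..k}" by simp
  have "(\<lambda>a. a mod n) ` {- k..- q} = (\<lambda>a. a + n) ` {- k..- q}"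
    by (rule image_cong) (use mod_nbrs(2) assms in auto)
  then show "(\<lambda>a. a mod n) ` {- k..- q} = {n - k..n - q}" by (simp add: add.commute)
qed

lemma residues_nbrs_eq: "residues n (PC n nbrs) = {1..k} \<union> {n - k..n - 1}"
  unfolding residues_PC nbrs_def image_Un using image_mod_nbrs[of 1] by simp

lemma residues_nbrs: "residues n (PC n nbrs) = {u \<in> {0..<n}. u \<noteq> 0 \<and> (cedge n sh u 0 \<or> cedge n sh 0 u)}"
  unfolding residues_nbrs_eq cadj_iff
proof (rule set_eqI)
  fix u
  show "u \<in> {1..k} \<union> {n - k..n - 1} \<longleftrightarrow> u \<in> {u \<in> {0..<n}. u \<noteq> 0 \<and> cadj n k (0 - u)}"
  proof (cases "0 < u \<and> u < n")
    case True
    then have "cadj n k (0 - u) \<longleftrightarrow> u \<le> k \<or> n - k \<le> u" using cadj_range[of "0 - u" n k] n_gt by simp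
    then show ?thesis using True by auto
  next
    case False then show ?thesis using n_gt k_nonneg by auto
  qed
qed

lemma circulant_odd_sphere:
  assumes s1: "s = 1"
  shows "clique_complex_space {0..<n} (cedge n sh) homotopy_equivalent_space
    clique_complex_space (join_verts 2 (nat (2 * l + 1))) join_adj"
proof -
  have k1: "1 \<le> k" using k_eq ld_nonneg s1 by simp
  have d2: "2 \<le> d" using sd s1 by simp
  have punct: "residues n (PC n punct) = {0..<n} - {0}"
  proof -
    have "(\<lambda>a. a mod n) ` punct = id ` punct" by (rule image_cong) (auto simp: punct_def)
    then show ?thesis unfolding residues_PC by (auto simp: punct_def)
  qed
  have "clique_complex_space {0..<n} (cedge n sh) homotopy_equivalent_space points_join 2 (residues n (PC n nbrs)) (cedge n sh)"
    unfolding residues_nbrs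
  proof (rule suspension_equiv[OF _ _ refl])
    show "contractible_space (clique_complex_space ({0..<n} - {0}) (cedge n sh))"
      using punct_contractible[OF s1] punct by simp
    have "1 \<in> {0..<n} - {0}" using n_gt k1 by simp
    then show "{0..<n} - {0} \<noteq> {}" by blast
  qed (use n_pos in auto)
  also have "\<dots> homotopy_equivalent_space points_join 2 (residues n (PC n cross)) (cedge n sh)"
    by (rule points_join_strong_collapse[OF cross_collapse]) (use s1 d2 k1 in auto)
  also have "\<dots> homotopy_equivalent_space clique_complex_space (join_verts 2 (nat (2 * l + 1))) join_adj"
    using cross_points_join[of 2] s1 d2 by simp
  finally show ?thesis .
qed


text \<open>For \<open>s = 0\<close>, where the non-neighbours of a vertex \<open>v\<close> are \<open>w j = v + k + j\<close> with \<open>1 \<le> j < d\<close>, both links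
  needed for \<open>multi_suspension_equiv\<close> are of this form: \<open>gapset j 1\<close> in the coordinate with \<open>v = 0\<close>, and
  \<open>gapset (d - j) j\<close> in the coordinate with \<open>w j = 0\<close>.\<close>

definition gapset :: "int \<Rightarrow> int \<Rightarrow> int set" where
  "gapset p q = {1..k} \<union> {k + p} \<union> {- k..- q}"

lemma gapset_bounds: "1 \<le> q \<Longrightarrow> 1 \<le> p \<Longrightarrow> a \<in> gapset p q \<Longrightarrow> - k \<le> a \<and> a \<le> k + p"
  using k_nonneg by (auto simp: gapset_def)

lemma gapset_gap:
  assumes q: "1 \<le> q" and p: "1 \<le> p" and qp: "q \<le> d - p" and y: "y \<in> PC n (gapset p q)"
  shows "\<not> (k < y \<and> y < k + p)" "\<not> (k + p < y \<and> y < k + d)" "\<not> (- q < y \<and> y < 1)"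
proof -
  have "\<not> (k < y \<and> y < k + p) \<and> \<not> (k + p < y \<and> y < k + d) \<and> \<not> (- q < y \<and> y < 1)"
  proof (rule PC_cases[OF y n_pos])
    assume "y \<in> gapset p q"
    then consider "1 \<le> y" "y \<le> k" | "y = k + p" | "- k \<le> y" "y \<le> - q" by (auto simp: gapset_def)
    then show ?thesis using q p qp k_nonneg by cases linarith+
  next
    fix a assume "a \<in> gapset p q" "a + n \<le> y"
    then have "k + d \<le> y" using gapset_bounds[OF q p, of a] n_eq by linarith
    then show ?thesis using q p qp k_nonneg by linarith
  next
    fix a assume "a \<in> gapset p q" "y \<le> a - n"
    then have "y \<le> p - k - d" using gapset_bounds[OF q p, of a] n_eq by linarith
    then show ?thesis using q p qp k_nonneg by linarith
  qed
  then show "\<not> (k < y \<and> y < k + p)" "\<not> (k + p < y \<and> y < k + d)" "\<not> (- q < y \<and> y < 1)" by blast+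
qed

text \<open>In contrast to the link, the additional vertex \<open>k + p\<close> catches the steps
  from \<open>p\<close> up to \<open>d - 1\<close>, while those from below \<open>p\<close> fall
  back to \<open>k\<close>; and \<open>- k\<close> goes to \<open>- q\<close>, the last vertex left
  before 0.\<close>

lemma gapset_step:
  assumes "1 \<le> q" "1 \<le> p" "q \<le> d - p" "s = 0" "1 \<le> l"
  defines "G \<equiv> rst (PC n (gapset p q)) sh"
  shows "1 \<le> x \<Longrightarrow> x < p \<Longrightarrow> G x = k"
    "p \<le> x \<Longrightarrow> x < d \<Longrightarrow> G x = k + p"
    "d \<le> x \<Longrightarrow> x \<le> k \<Longrightarrow> G x = (x - d - k) + 1 * n"
    "q \<le> y \<Longrightarrow> y < k \<Longrightarrow> G (- y) = k - y"
    "G (- k) = - q"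
    "G (k + p) = (p - d) + 1 * n"
proof -
  have dk: "d \<le> k" using mult_d_mono[OF assms(5)] k_eq assms(4) by simp
  have pd: "p < d" using assms by simp
  note gap = gapset_gap[OF assms(1,2,3)]
  have I: "x \<in> PC n (gapset p q)" if "1 \<le> x \<and> x \<le> k \<or> x = k + p \<or> - k \<le> x \<and> x \<le> - q" for x
    by (rule PC_I) (use that in \<open>auto simp: gapset_def\<close>)
  show "G x = k" if "1 \<le> x" "x < p" unfolding G_def
  proof (rule rst_eqI)
    fix y assume "y \<in> PC n (gapset p q)" "k < y" "y \<le> x + k"
    then show False using gap(1)[of y] that by auto
  qed (use that dk pd in \<open>auto intro!: I\<close>)
  show "G x = k + p" if "p \<le> x" "x < d" unfolding G_def
  proof (rule rst_eqI)
    fix y assume "y \<in> PC n (gapset p q)" "k + p < y" "y \<le> x + k"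
    then show False using gap(2)[of y] that by auto
  qed (use that dk assms in \<open>auto intro!: I\<close>)
  show "G x = (x - d - k) + 1 * n" if "d \<le> x" "x \<le> k" unfolding G_def
  proof (rule rst_eqI)
    show "x - d - k + 1 * n \<in> PC n (gapset p q)" by (rule PC_I') (use that assms in \<open>auto simp: gapset_def\<close>)
  qed ((rule I)?, use that n_eq k_nonneg d_pos in linarith)+
  show "G (- y) = k - y" if "q \<le> y" "y < k" unfolding G_def
    by (rule rst_eqI) (use that assms in \<open>auto intro!: I\<close>)
  show "G (- k) = - q" unfolding G_def
  proof (rule rst_eqI)
    fix y assume "y \<in> PC n (gapset p q)" "- q < y" "y \<le> - k + k"
    then show False using gap(3)[of y] by auto
  qed (use assms dk in \<open>auto intro!: I\<close>)
  show "G (k + p) = (p - d) + 1 * n" unfolding G_def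
  proof (rule rst_eqI)
    show "p - d + 1 * n \<in> PC n (gapset p q)" by (rule PC_I') (use assms dk in \<open>auto simp: gapset_def\<close>)
  qed ((rule I)?, use n_eq dk k_nonneg pd in linarith)+
qed

text \<open>Since \<open>(2 * l + 1) * k = l * n\<close>, the clique \<open>orbit (- p)\<close> is a
  closed orbit of the shift, and it lies in the graph. Everything runs into it: vertices of residue
  at least \<open>p\<close> modulo \<open>d\<close> descend to \<open>k + p\<close>;
  \<open>- q\<close> goes to \<open>k - q\<close>, whose residue is \<open>d - q \<ge> p\<close>;
  multiples of \<open>d\<close> descend through \<open>- k\<close> to \<open>- q\<close>;
  \<open>k\<close> is one of them, and the remaining descents end at \<open>k\<close>.\<close>

lemma gapset_contractible:
  assumes q: "1 \<le> q" and p: "1 \<le> p" and qp: "q \<le> d - p" and s: "s = 0" and l1: "1 \<le> l"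
  shows "contractible_space (clique_complex_space (residues n (PC n (gapset p q))) (cedge n sh))"
proof (rule PC_contractible[where S = "orbit (- p)"])
  let ?T = "gapset p q" and ?S = "orbit (- p)"
  have dk: "d \<le> k" using mult_d_mono[OF l1] k_eq s by simp
  have k: "k = l * d" using k_eq s by simp
  note G = gapset_step[OF q p qp s l1]
  show "?T \<noteq> {}" by (auto simp: gapset_def)
  have o1: "p - i * d \<in> ?S" if "0 \<le> i" "i \<le> l" for i using orbitI(1)[OF that, of "-p"] by simp
  have o2: "k + p - i * d \<in> ?S" if "0 \<le> i" "i < l" for i using orbitI(2)[OF that, of "-p"] by simp
  have oE: thesis if "a \<in> ?S" "a = p \<Longrightarrow> thesis" "a = k + p \<Longrightarrow> thesis"
    "\<And>i. a = p - i * d \<Longrightarrow> 1 \<le> i \<Longrightarrow> i \<le> l \<Longrightarrow> thesis"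
    "\<And>i. a = k + p - i * d \<Longrightarrow> 1 \<le> i \<Longrightarrow> i < l \<Longrightarrow> thesis" for a thesis
  proof -
    from that(1) consider i where "a = p - i * d" "0 \<le> i" "i \<le> l" | i where "a = k + p - i * d" "0 \<le> i" "i < l"
      unfolding orbit_def by auto
    then show thesis
    proof cases
      case (1 i) then show ?thesis using that(2) that(4)[OF 1(1)] by (cases "i = 0") simp_all
    next
      case (2 i) then show ?thesis using that(3) that(5)[OF 2(1)] by (cases "i = 0") simp_all
    qed
  qed
  have b1: "d \<le> i * d" "i * d \<le> k" if "1 \<le> i" "i \<le> l" for i using mult_d_mono[OF that(1)] mult_d_mono[OF that(2)] k by auto
  have b2: "i * d + d \<le> k" if "i < l" for i using mult_d_Suc[OF that] k by simp
  show "?S \<subseteq> PC n ?T"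
  proof
    fix a assume "a \<in> ?S"
    then have "a \<in> ?T"
    proof (rule oE)
      show "a = p \<Longrightarrow> a \<in> ?T" "a = k + p \<Longrightarrow> a \<in> ?T" using p q qp dk by (auto simp: gapset_def)
      fix i assume a: "a = p - i * d" "1 \<le> i" "i \<le> l"
      have "- k \<le> a" "a \<le> - q" using b1[OF a(2,3)] a(1) p qp by linarith+
      then show "a \<in> ?T" by (simp add: gapset_def)
    next
      fix i assume a: "a = k + p - i * d" "1 \<le> i" "i < l"
      have "1 \<le> a" "a \<le> k" using b1[of i] b2[of i] a p q qp d_pos by linarith+
      then show "a \<in> ?T" by (simp add: gapset_def)
    qed
    then show "a \<in> PC n ?T" by (rule PC_I)
  qed
  show "rst (PC n ?T) sh a \<in> PC n ?S" if "a \<in> ?S" for a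
    using that
  proof (rule oE)
    assume "a = p"
    then have "rst (PC n ?T) sh a = k + p" using G(2)[of p] qp q by simp
    then show ?thesis using o2[of 0] l1 PC_I by simp
  next
    assume "a = k + p"
    then have "rst (PC n ?T) sh a = (p - 1 * d) + 1 * n" using G(6) by simp
    then show ?thesis using PC_I'[OF o1[of 1], of 1] l1 by simp
  next
    fix i assume a: "a = p - i * d" "1 \<le> i" "i \<le> l"
    have "rst (PC n ?T) sh (- (i * d - p)) = k - (i * d - p)" by (rule G(4)) (use b1[OF a(2,3)] p qp in linarith)+
    then have r: "rst (PC n ?T) sh a = k + p - i * d" using a(1) by simp
    show ?thesis
    proof (cases "i = l")
      case True
      then have "rst (PC n ?T) sh a = p - 0 * d" using r k by simp
      then show ?thesis using PC_I[OF o1[of 0]] l0 by simp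
    next
      case False
      then show ?thesis using r PC_I[OF o2[of i]] a by simp
    qed
  next
    fix i assume a: "a = k + p - i * d" "1 \<le> i" "i < l"
    have "rst (PC n ?T) sh a = (a - d - k) + 1 * n" by (rule G(3)) (use b1[of i] b2[of i] a p q qp in linarith)+
    moreover have "a - d - k = p - (i + 1) * d" using a by (simp add: algebra_simps)
    ultimately show ?thesis using PC_I'[OF o1[of "i + 1"], of 1] a by simp
  qed
  have down: "reaches ?T ?S x" if "d < x" "x \<le> k" "reaches ?T ?S (x - d)" for x
  proof -
    have "rst (PC n ?T) sh (- (k + d - x)) = k - (k + d - x)" by (rule G(4)) (use that qp p in linarith)+
    moreover have "- (k + d - x) = x - d - k" "k - (k + d - x) = x - d" by simp_all
    ultimately have 1: "rst (PC n ?T) sh (x - d - k) = x - d" by (simp only:)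
    have "x - d - k \<in> ?T" using that qp p by (auto simp: gapset_def)
    then have "reaches ?T ?S (x - d - k + 1 * n)"
      using reaches_shift[OF PC_I] reaches_step[OF 1 that(3)] by blast
    then show ?thesis using reaches_step[OF G(3)[of x]] that by simp
  qed
  have kp: "reaches ?T ?S (k + p)" using o2[of 0] l1 by (intro reaches_base PC_I) simp
  have ph1: "p \<le> x mod d \<Longrightarrow> 1 \<le> x \<Longrightarrow> x \<le> k \<Longrightarrow> reaches ?T ?S x" for x
  proof (induction "nat x" arbitrary: x rule: less_induct)
    case less
    consider "x < d" | "x = d" | "d < x" by linarith
    then show ?case
    proof cases
      case 1
      then have "x mod d = x" using less.prems by simp
      then show ?thesis using reaches_step[OF G(2)[of x] kp] less.prems 1 by simp
    next
      case 2 then show ?thesis using less.prems p by simp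
    next
      case 3
      have "(x - d) mod d = x mod d" by simp
      then have "reaches ?T ?S (x - d)" using less.hyps[of "x - d"] less.prems 3 d_pos by simp
      then show ?thesis using down 3 less.prems by blast
    qed
  qed
  have rq: "reaches ?T ?S (- q)"
  proof -
    have qk: "q < k" using qp p dk by linarith
    have "k - q = (d - q) + (l - 1) * d" using k by (simp add: algebra_simps)
    then have "(k - q) mod d = (d - q) mod d" by (simp only: mod_mult_self1)
    also have "\<dots> = d - q" using q qp p by (intro mod_pos_pos_trivial) linarith+
    finally have "reaches ?T ?S (k - q)" using ph1[of "k - q"] qk q qp by simp
    then show ?thesis using reaches_step[OF G(4)[of q]] qk by simp
  qed
  have ph2: "d dvd x \<Longrightarrow> 1 \<le> x \<Longrightarrow> x \<le> k \<Longrightarrow> reaches ?T ?S x" for x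
  proof (induction "nat x" arbitrary: x rule: less_induct)
    case less
    have "d \<le> x" using less.prems by (intro zdvd_imp_le) auto
    then consider "x = d" | "d < x" by linarith
    then show ?case
    proof cases
      case 1
      have "- k \<in> ?T" using qp p dk by (auto simp: gapset_def)
      then have "reaches ?T ?S (- k + 1 * n)" using reaches_shift[OF PC_I] reaches_step[OF G(5) rq] by blast
      then show ?thesis using reaches_step[OF G(3)[of x]] 1 dk by simp
    next
      case 2
      have "d dvd x - d" using less.prems by simp
      then have "reaches ?T ?S (x - d)" using less.hyps[of "x - d"] less.prems 2 d_pos by simp
      then show ?thesis using down 2 less.prems by blast
    qed
  qed
  have rk: "reaches ?T ?S k" using ph2[of k] k dk d_pos by simp
  have ph3: "1 \<le> x \<Longrightarrow> x \<le> k \<Longrightarrow> reaches ?T ?S x" for x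
  proof (induction "nat x" arbitrary: x rule: less_induct)
    case less
    consider "x < p" | "p \<le> x" "x < d" | "x = d" | "d < x" by linarith
    then show ?case
    proof cases
      case 1 then show ?thesis using reaches_step[OF G(1)[of x] rk] less.prems by simp
    next
      case 2 then show ?thesis using reaches_step[OF G(2)[of x] kp] by simp
    next
      case 3 then show ?thesis using ph2 less.prems by simp
    next
      case 4
      then have "reaches ?T ?S (x - d)" using less.hyps[of "x - d"] less.prems d_pos by simp
      then show ?thesis using down 4 less.prems by blast
    qed
  qed
  show "reaches ?T ?S a" if h: "a \<in> ?T" for a
  proof -
    consider "1 \<le> a" "a \<le> k" | "a = k + p" | "a = - k" | "- k < a" "a \<le> - q"
      using h by (fastforce simp: gapset_def)
    then show ?thesis
    proof cases
      case 4
      have "rst (PC n ?T) sh (- (- a)) = k - (- a)" by (rule G(4)) (use 4 in linarith)+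
      then have "rst (PC n ?T) sh a = k + a" by simp
      moreover have "reaches ?T ?S (k + a)" using ph3[of "k + a"] 4 q by simp
      ultimately show ?thesis by (rule reaches_step)
    qed (use ph3 kp reaches_step[OF G(5) rq] in auto)
  qed
  show "cadj n k (b - a)" if "a \<in> ?S" "b \<in> ?S" "a \<noteq> b" for a b using orbit_adj that by blast
qed

lemma residues_translate:
  "clique_complex_space (residues n (PC n X)) (cedge n sh) homotopy_equivalent_space
   clique_complex_space ((\<lambda>a. (a + c) mod n) ` X) (cedge n sh)"
proof (rule clique_complex_iso[of "\<lambda>x. (x + c) mod n"])
  have "inj_on (\<lambda>x. (x + c) mod n) {0..<n}"
  proof (rule inj_onI)
    fix x y assume xy: "x \<in> {0..<n}" "y \<in> {0..<n}" "(x + c) mod n = (y + c) mod n"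
    then have "n dvd x - y" by (simp add: mod_eq_dvd_iff)
    moreover have "\<bar>x - y\<bar> < n" using xy(1,2) by (simp add: abs_less_iff)
    ultimately show "x = y" using not_dvd_range[of "x - y"] by fastforce
  qed
  moreover have "(\<lambda>x. (x + c) mod n) ` residues n (PC n X) = (\<lambda>a. (a + c) mod n) ` X"
    unfolding residues_PC image_image by (simp add: mod_add_left_eq)
  ultimately show "bij_betw (\<lambda>x. (x + c) mod n) (residues n (PC n X)) ((\<lambda>a. (a + c) mod n) ` X)"
    unfolding bij_betw_def by (metis Int_lower2 inj_on_subset)
  show "cedge n sh u v \<or> cedge n sh v u \<longleftrightarrow> cedge n sh ((u + c) mod n) ((v + c) mod n) \<or> cedge n sh ((v + c) mod n) ((u + c) mod n)" for u v
    unfolding cadj_iff cadj_mod by simp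
qed simp

lemma circulant_even_spheres:
  assumes s: "s = 0" and l1: "1 \<le> l" and d2: "2 \<le> d"
  shows "clique_complex_space {0..<n} (cedge n sh) homotopy_equivalent_space
    clique_complex_space (join_verts (nat d) (nat (2 * l))) join_adj"
proof -
  define L where "L = residues n (PC n nbrs)"
  have Leq: "L = {1..k} \<union> {n - k..n - 1}" unfolding L_def by (rule residues_nbrs_eq)
  define w where "w = (\<lambda>j::nat. k + int j)"
  define q where "q = nat (d - 1)"
  have q: "int q = d - 1" using d2 by (simp add: q_def)
  have dk: "d \<le> k" using mult_d_mono[OF l1] k_eq s by simp
  have wimg: "w ` {i..j} = {k + int i..k + int j}" for i j
  proof (intro equalityI subsetI)
    fix x assume "x \<in> {k + int i..k + int j}"
    then have "x = w (nat (x - k))" "nat (x - k) \<in> {i..j}" by (auto simp: w_def)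
    then show "x \<in> w ` {i..j}" by blast
  qed (auto simp: w_def)
  have nk: "n - k = k + d" using n_eq by simp
  have adj: "cedge n sh a b \<or> cedge n sh b a \<longleftrightarrow> \<bar>b - a\<bar> \<le> k \<or> k + d \<le> \<bar>b - a\<bar>"
    if "a \<in> {0..<n}" "b \<in> {0..<n}" "a \<noteq> b" for a b
  proof -
    have "\<bar>b - a\<bar> < n" "b - a \<noteq> 0" using that by auto
    then show ?thesis unfolding cadj_iff using cadj_range n_gt nk by simp
  qed
  have jd: "1 \<le> int j" "int j < d" if "j \<in> {1..q}" for j using that q by auto
  have main: "clique_complex_space (insert 0 (L \<union> w ` {1..q})) (cedge n sh) homotopy_equivalent_space points_join (Suc q) L (cedge n sh)"
  proof (rule multi_suspension_equiv)
    show "finite L" by (simp add: L_def)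
    show "0 \<notin> L" "0 \<notin> w ` {1..q}" using n_gt k_nonneg nk d_pos unfolding Leq wimg by auto
    show "inj_on w {1..q}" by (auto simp: w_def inj_on_def)
    show "w ` {1..q} \<inter> L = {}" unfolding wimg Leq nk using q by auto
    show "cedge n sh 0 a \<or> cedge n sh a 0" if "a \<in> L" for a
      using that unfolding L_def residues_nbrs by blast
    show "\<not> cedge n sh 0 (w j) \<and> \<not> cedge n sh (w j) 0" if "j \<in> {1..q}" for j
    proof -
      have "w j \<notin> L" using jd[OF that] unfolding Leq nk w_def by auto
      moreover have "w j \<in> {0..<n}" "w j \<noteq> 0" using jd[OF that] n_eq k_nonneg by (auto simp: w_def)
      ultimately show ?thesis unfolding L_def residues_nbrs by blast
    qed
    show "contractible_space (clique_complex_space (insert (w j) L) (cedge n sh))" if "j \<in> {1..q}" for j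
    proof -
      have "residues n (PC n (gapset (int j) 1)) = insert (w j) L"
        unfolding residues_PC gapset_def image_Un image_mod_nbrs[of 1, simplified] Leq w_def
        using jd[OF that] n_eq k_nonneg by auto
      then show ?thesis using gapset_contractible[of 1 "int j"] jd[OF that] s l1 by simp
    qed
    show "contractible_space (clique_complex_space (insert 0 {a \<in> L \<union> w ` {j<..q}. cedge n sh a (w j) \<or> cedge n sh (w j) a}) (cedge n sh))"
      if "j \<in> {1..q}" for j
    proof -
      define c where "c = w j"
      \<comment> \<open>Measured from \<open>w j = k + j\<close>, the vertex \<open>v = 0\<close>
        sits at \<open>k + (d - j)\<close>. The vertices \<open>w i\<close> with
        \<open>i < j\<close>, just before \<open>w j\<close>, are already exchanged, so the nearest
        one left on that side is at \<open>- j\<close>.\<close>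
      define T where "T = gapset (d - int j) (int j)"
      have wjq: "w ` {j<..q} = {k + int j + 1..k + d - 1}"
      proof -
        have "{j<..q} = {Suc j..q}" by auto
        then show ?thesis using wimg[of "Suc j" q] q by (simp add: algebra_simps)
      qed
      have img: "(\<lambda>a. (a + c) mod n) ` T = {k + int j + 1..2 * k + int j} \<union> {0} \<union> {int j..k}"
      proof -
        have "(\<lambda>a. (a + c) mod n) ` {1..k} = (\<lambda>a. a + c) ` {1..k}"
          by (rule image_cong) (use jd[OF that] n_eq k_nonneg in \<open>auto simp: c_def w_def\<close>)
        moreover have "(\<lambda>a. (a + c) mod n) ` {- k..- int j} = (\<lambda>a. a + c) ` {- k..- int j}"
          by (rule image_cong) (use jd[OF that] n_eq k_nonneg in \<open>auto simp: c_def w_def\<close>)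
        moreover have "(k + (d - int j) + c) mod n = 0" using n_eq by (simp add: c_def w_def)
        ultimately show ?thesis unfolding T_def gapset_def image_Un
          by (simp add: c_def w_def algebra_simps)
      qed
      have "(\<lambda>a. (a + c) mod n) ` T = insert 0 {a \<in> L \<union> w ` {j<..q}. cedge n sh a (w j) \<or> cedge n sh (w j) a}"
      proof (rule set_eqI)
        fix a
        have U: "a \<in> L \<union> w ` {j<..q} \<longleftrightarrow> (1 \<le> a \<and> a \<le> k) \<or> (k + int j + 1 \<le> a \<and> a \<le> n - 1)"
          unfolding Leq wjq nk using jd[OF that] n_eq k_nonneg by auto
        have A: "cedge n sh a (w j) \<or> cedge n sh (w j) a \<longleftrightarrow> \<bar>w j - a\<bar> \<le> k \<or> k + d \<le> \<bar>w j - a\<bar>" if "a \<in> L \<union> w ` {j<..q}"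
          by (rule adj) (use that jd[OF \<open>j \<in> {1..q}\<close>] U n_eq k_nonneg in \<open>auto simp: w_def\<close>)
        show "a \<in> (\<lambda>a. (a + c) mod n) ` T \<longleftrightarrow> a \<in> insert 0 {a \<in> L \<union> w ` {j<..q}. cedge n sh a (w j) \<or> cedge n sh (w j) a}"
        proof (cases "a \<in> L \<union> w ` {j<..q}")
          case True
          then show ?thesis unfolding img using A[OF True] U jd[OF that] n_eq k_nonneg by (auto simp: w_def)
        next
          case False
          then show ?thesis unfolding img using U jd[OF that] n_eq k_nonneg by auto
        qed
      qed
      moreover have "contractible_space (clique_complex_space (residues n (PC n T)) (cedge n sh))"
        unfolding T_def by (rule gapset_contractible) (use jd[OF that] s l1 in auto)
      ultimately show ?thesis using residues_translate[of T c] homotopy_equivalent_space_contractibility by metis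
    qed
  qed
  have all: "insert 0 (L \<union> w ` {1..q}) = {0..<n}" unfolding Leq wimg nk using q n_eq k_nonneg dk by auto
  have "Suc q = nat d" using d2 by (simp add: q_def)
  then have "clique_complex_space {0..<n} (cedge n sh) homotopy_equivalent_space points_join (nat d) L (cedge n sh)"
    using main all by simp
  also have "\<dots> homotopy_equivalent_space points_join (nat d) (residues n (PC n cross)) (cedge n sh)"
    unfolding L_def by (rule points_join_strong_collapse[OF cross_collapse]) (use s d2 dk in auto)
  also have "\<dots> homotopy_equivalent_space clique_complex_space (join_verts (nat d) (nat (2 * l))) join_adj"
    using cross_points_join[of "nat d"] s d2 by simp
  finally show ?thesis .
qed

end

section \<open>Homotopy types from rotation numbers\<close>

lemma periodic_enum:
  fixes n :: int and xs :: "int list"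
  assumes n: "0 < n" and per: "\<forall>x. x + n \<in> V \<longleftrightarrow> x \<in> V"
    and xs: "sorted_wrt (<) xs" "set xs = residues n V" "xs \<noteq> []"
  defines "e \<equiv> (\<lambda>i. xs ! nat (i mod int (length xs)) + (i div int (length xs)) * n)"
  shows "strict_mono e" "range e = V" "e (i + int (length xs)) = e i + n"
    "a < length xs \<Longrightarrow> e (int a) = xs ! a"
proof -
  let ?N = "int (length xs)"
  have N: "0 < ?N" using xs(3) by simp
  have idx: "nat (i mod ?N) < length xs" for i using N by (simp add: nat_less_iff)
  have bd: "0 \<le> xs ! nat (i mod ?N)" "xs ! nat (i mod ?N) < n" for i
    using nth_mem[OF idx[of i]] xs(2) by auto
  show "strict_mono e"
  proof (rule strict_monoI)
    fix i j :: int assume ij: "i < j"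
    have le: "i div ?N \<le> j div ?N" using ij N by (intro zdiv_mono1) auto
    show "e i < e j"
    proof (cases "i div ?N = j div ?N")
      case True
      then have "i mod ?N < j mod ?N" using ij by (metis add_less_cancel_left mult_div_mod_eq)
      moreover have "0 \<le> i mod ?N" using N by simp
      ultimately have "nat (i mod ?N) < nat (j mod ?N)" by linarith
      then have "xs ! nat (i mod ?N) < xs ! nat (j mod ?N)" using sorted_wrt_nth_less[OF xs(1)] idx by blast
      then show ?thesis using True by (simp add: e_def)
    next
      case False
      then have "i div ?N + 1 \<le> j div ?N" using le by simp
      then have "(i div ?N + 1) * n \<le> (j div ?N) * n" using n by (intro mult_right_mono) auto
      then show ?thesis using bd(2)[of i] bd(1)[of j] unfolding e_def by (simp add: algebra_simps)
    qed
  qed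
  show "range e = V"
  proof (intro equalityI subsetI)
    fix x assume "x \<in> range e"
    then obtain i where x: "x = e i" by blast
    have "xs ! nat (i mod ?N) \<in> V" using nth_mem[OF idx[of i]] xs(2) by auto
    then show "x \<in> V" unfolding x e_def using shift_mem[OF per] by simp
  next
    fix x assume "x \<in> V"
    then have "x mod n \<in> set xs" using mod_mem[OF per] n xs(2) by simp
    then obtain a where a: "a < length xs" "xs ! a = x mod n" by (metis in_set_conv_nth)
    have "e (int a + (x div n) * ?N) = x"
    proof -
      have "(int a + (x div n) * ?N) mod ?N = int a" "(int a + (x div n) * ?N) div ?N = x div n" using a N by auto
      then show ?thesis unfolding e_def using a by simp
    qed
    then show "x \<in> range e" by (metis rangeI)
  qed
  show "e (i + ?N) = e i + n" using N by (simp add: e_def algebra_simps)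
  show "a < length xs \<Longrightarrow> e (int a) = xs ! a" by (simp add: e_def)
qed

lemma strict_mono_shift:
  fixes e :: "int \<Rightarrow> int"
  assumes "\<And>i. e (i + N) = e i + n" shows "e (i + m * N) = e i + m * n"
proof (induction m rule: int_induct[of _ 0])
  case (step1 m) then show ?case using assms[of "i + m * N"] by (simp add: algebra_simps)
next
  case (step2 m) then show ?case using assms[of "i + (m - 1) * N"] by (simp add: algebra_simps)
qed simp

text \<open>By monotonicity one period has to cover \<open>N\<close> values with \<open>N\<close>
  arguments, so surjectivity gives injectivity on every period; then consecutive integers go to
  consecutive integers.\<close>

lemma periodic_surj_translation:
  fixes g :: "int \<Rightarrow> int"
  assumes N: "0 < N" and mono: "mono g" and surj: "surj g" and per: "\<And>i. g (i + N) = g i + N"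
  shows "g i = i + g 0"
proof -
  have inj: "inj_on g {i..<i + N}" for i
  proof (rule eq_card_imp_inj_on)
    have "{g i..<g i + N} \<subseteq> g ` {i..<i + N}"
    proof
      fix z assume z: "z \<in> {g i..<g i + N}"
      obtain u where u: "z = g u" using surj by (metis surjD)
      have "u < i + N" using z u per[of i] monoD[OF mono, of "i + N" u] by (cases "u < i + N") auto
      show "z \<in> g ` {i..<i + N}"
      proof (cases "i \<le> u")
        case True then show ?thesis using u \<open>u < i + N\<close> by auto
      next
        case False
        then have "z = g i" using z u monoD[OF mono, of u i] by auto
        then show ?thesis using N by auto
      qed
    qed
    then have "card {g i..<g i + N} \<le> card (g ` {i..<i + N})" by (intro card_mono) auto
    moreover have "card (g ` {i..<i + N}) \<le> card {i..<i + N}" by (rule card_image_le) simp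
    ultimately show "card (g ` {i..<i + N}) = card {i..<i + N}" by simp
  qed simp
  have less: "g i < g (i + 1)" for i
  proof (cases "N = 1")
    case True then show ?thesis using per[of i] by simp
  next
    case False
    then have "g i \<noteq> g (i + 1)" using inj_onD[OF inj[of i], of i "i + 1"] N by auto
    then show ?thesis using monoD[OF mono, of i "i + 1"] by simp
  qed
  have step: "g (i + 1) = g i + 1" for i
  proof -
    obtain u where u: "g u = g i + 1" using surj by (metis surjD)
    then have "i < u" using monoD[OF mono, of u i] by (cases "i < u") auto
    then have "g (i + 1) \<le> g u" by (intro monoD[OF mono]) simp
    then show ?thesis using u less[of i] by simp
  qed
  show ?thesis
  proof (induction i rule: int_induct[of _ 0])
    case (step1 i) then show ?case using step[of i] by simp
  next
    case (step2 i) then show ?case using step[of "i - 1"] by simp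
  qed simp
qed

text \<open>In the numbering of the vertices by their order, a surjective \<open>F\<close> becomes a
  translation by some \<open>k\<close>; the bound \<open>2 * k < N\<close> is the condition
  \<open>F (F x) < x + n\<close>.\<close>

lemma cyc_surj_circulant:
  assumes c: "cyc n V F" and surj: "F ` V = V"
  obtains N k e where "0 < N" "0 \<le> k" "2 * k < N" "N = int (card (residues n V))" "strict_mono e"
    "\<forall>i. e (i + N) = e i + n" "\<forall>i. F (e i) = e (i + k)" "range e = V"
    "clique_complex_space (residues n V) (cedge n F) homotopy_equivalent_space clique_complex_space {0..<N} (cedge N (\<lambda>x. x + k))"
proof -
  define xs where "xs = sorted_list_of_set (residues n V)"
  have n: "0 < n" and per: "\<forall>x. x + n \<in> V \<longleftrightarrow> x \<in> V" using cycD[OF c] by auto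
  obtain v where "v \<in> V" using cycD(2)[OF c] by blast
  then have "v mod n \<in> residues n V" using mod_mem[OF per] n by simp
  then have ne: "residues n V \<noteq> {}" by blast
  have xs: "sorted_wrt (<) xs" "set xs = residues n V" "xs \<noteq> []" using ne by (auto simp: xs_def)
  define N where "N = int (length xs)"
  have N: "0 < N" using xs(3) by (simp add: N_def)
  have Ncard: "N = int (card (residues n V))" by (simp add: N_def xs_def)
  define e where "e = (\<lambda>i. xs ! nat (i mod N) + (i div N) * n)"
  have E: "strict_mono e" "range e = V" "\<And>i. e (i + N) = e i + n" "\<And>a. a < length xs \<Longrightarrow> e (int a) = xs ! a"
    unfolding e_def N_def by (fact periodic_enum[OF n per xs])+
  have eN: "e (i + m * N) = e i + m * n" for i m by (rule strict_mono_shift[where e = e], rule E(3))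
  have elt: "e i < e j \<longleftrightarrow> i < j" "e i \<le> e j \<longleftrightarrow> i \<le> j" "e i = e j \<longleftrightarrow> i = j" for i j
    using strict_mono_less[OF E(1)] strict_mono_less_eq[OF E(1)] strict_mono_eq[OF E(1)] by auto
  have eV: "e i \<in> V" for i using E(2) by blast
  have "\<exists>j. e j = F (e i)" for i
  proof -
    have "F (e i) \<in> range e" using cycD(4)[OF c eV] E(2) by simp
    then show ?thesis by auto
  qed
  then obtain g where g: "\<And>i. e (g i) = F (e i)" by metis
  have gper: "g (i + N) = g i + N" for i
  proof -
    have "e (g (i + N)) = F (e i + 1 * n)" using g E(3) by simp
    also have "\<dots> = F (e i) + n" using cyc_shift[OF c eV, of i 1] by simp
    also have "\<dots> = e (g i + N)" using g E(3) by simp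
    finally show ?thesis by (simp add: elt)
  qed
  have gm: "mono g"
  proof (rule monoI)
    fix i j :: int assume "i \<le> j"
    then have "F (e i) \<le> F (e j)" using cycD(7)[OF c eV eV] elt by simp
    then show "g i \<le> g j" by (simp add: g[symmetric] elt)
  qed
  have gs: "surj g"
  proof (rule surjI)
    show "g (SOME i. F (e i) = e j) = j" for j
    proof -
      have "e j \<in> F ` V" using surj eV by simp
      then obtain x where "x \<in> V" "e j = F x" by blast
      then have "\<exists>i. F (e i) = e j" using E(2) by auto
      then have "F (e (SOME i. F (e i) = e j)) = e j" by (rule someI_ex)
      then have "e (g (SOME i. F (e i) = e j)) = e j" unfolding g .
      then show ?thesis unfolding elt(3) .
    qed
  qed
  have gi: "g i = i + g 0" for i by (rule periodic_surj_translation[OF N gm gs gper])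
  define k where "k = g 0"
  have Fe: "F (e i) = e (i + k)" for i using g[of i] gi[of i] by (simp add: k_def)
  have k0: "0 \<le> k" using cycD(5)[OF c eV, of 0] Fe[of 0] elt by simp
  have k2: "2 * k < N"
  proof -
    have "F (F (e 0)) < e 0 + n" by (rule cycD(6)[OF c eV])
    then have "e (k + k) < e (0 + N)" using Fe E(3)[of 0] by simp
    then show ?thesis using elt by simp
  qed
  have "clique_complex_space {0..<N} (cedge N (\<lambda>x. x + k)) homotopy_equivalent_space clique_complex_space (residues n V) (cedge n F)"
  proof (rule clique_complex_iso[of e])
    have "e ` {0..<N} = set xs"
    proof (intro equalityI subsetI)
      fix x assume "x \<in> e ` {0..<N}"
      then obtain i where i: "0 \<le> i" "i < N" "x = e i" by auto
      then have "x = xs ! nat i" using E(4)[of "nat i"] by (simp add: N_def)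
      then show "x \<in> set xs" using i by (simp add: N_def nth_mem nat_less_iff)
    next
      fix x assume "x \<in> set xs"
      then obtain a where "a < length xs" "x = xs ! a" by (metis in_set_conv_nth)
      then have "x = e (int a)" "int a \<in> {0..<N}" using E(4) by (auto simp: N_def)
      then show "x \<in> e ` {0..<N}" by blast
    qed
    then show "bij_betw e {0..<N} (residues n V)"
      using xs(2) elt by (auto simp: bij_betw_def inj_on_def)
    have edge: "cedge N (\<lambda>x. x + k) u v \<longleftrightarrow> cedge n F (e u) (e v)" for u v
    proof -
      have "e v + m * n = e (v + m * N)" for m using eN by simp
      then show ?thesis unfolding cedge_def Fe by (simp add: elt)
    qed
    then show "cedge N (\<lambda>x. x + k) u v \<or> cedge N (\<lambda>x. x + k) v u \<longleftrightarrow> cedge n F (e u) (e v) \<or> cedge n F (e v) (e u)" for u v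
      by simp
  qed simp
  then show ?thesis using that[OF N k0 k2 Ncard E(1) _ _ E(2)] E(3) Fe homotopy_equivalent_space_sym by blast
qed

lemma shift_funpow: "((\<lambda>x. x + k) ^^ m) x = x + int m * (k::int)"
  by (induction m) (auto simp: algebra_simps)

text \<open>The period, the vertex set and the map all vary in the induction: once \<open>F\<close>
  is onto, the argument continues in a circulant graph with a period of its own, and deletes a
  vertex there.\<close>

theorem cyc_odd_sphere:
  assumes "cyc n V F" and "\<And>x. x \<in> V \<Longrightarrow> (F ^^ (2 * l + 1)) x > x + int l * n"
    and "\<And>x. x \<in> V \<Longrightarrow> (F ^^ (2 * l + 3)) x < x + (int l + 1) * n"
  shows "clique_complex_space (residues n V) (cedge n F) homotopy_equivalent_space
    clique_complex_space (join_verts 2 (2 * l + 1)) join_adj"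
  using assms
proof (induction "card (residues n V)" arbitrary: n V F rule: less_induct)
  case less
  note c = less.prems(1)
  have n: "0 < n" and per: "\<forall>x. x + n \<in> V \<longleftrightarrow> x \<in> V" using cycD[OF c] by auto
  show ?case
  proof (cases "F ` V = V")
    case False
    note I = cyc_image[OF c]
    have sub: "F ` V \<subseteq> V" using cycD(4)[OF c] by blast
    then obtain x where x: "x \<in> V" "x \<notin> F ` V" using False by blast
    have "residues n (F ` V) \<subset> residues n V"
    proof
      show "residues n (F ` V) \<subseteq> residues n V" using sub by blast
      have "x mod n \<in> residues n V" using x mod_mem[OF per] n by simp
      moreover have "x mod n \<notin> residues n (F ` V)" using x mod_mem[OF cycD(3)[OF I(1)]] by simp
      ultimately show "residues n (F ` V) \<noteq> residues n V" by blast
    qed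
    then have "card (residues n (F ` V)) < card (residues n V)" by (intro psubset_card_mono) auto
    then have "clique_complex_space (residues n (F ` V)) (cedge n F) homotopy_equivalent_space
        clique_complex_space (join_verts 2 (2 * l + 1)) join_adj"
      by (rule less.hyps[OF _ I(1)]) (use less.prems(2,3) sub in blast)+
    then show ?thesis using strong_collapse_equiv[OF I(2)] homotopy_eqv_trans by auto
  next
    case True
    obtain N k e where N: "0 < N" "0 \<le> k" "2 * k < N" "N = int (card (residues n V))" "strict_mono e"
      and e': "\<forall>i. e (i + N) = e i + n" "\<forall>i. F (e i) = e (i + k)" "range e = V"
      and eq: "clique_complex_space (residues n V) (cedge n F) homotopy_equivalent_space clique_complex_space {0..<N} (cedge N (\<lambda>x. x + k))"
      by (rule cyc_surj_circulant[OF c True])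
    note e = e'(1)[rule_format] e'(2)[rule_format] e'(3)
    have Fm: "(F ^^ m) (e i) = e (i + int m * k)" for m i by (induction m) (auto simp: e(2) algebra_simps)
    have e0: "e 0 \<in> V" using e(3) by blast
    have eN: "e (i + m * N) = e i + m * n" for i m by (rule strict_mono_shift[where e = e], rule e(1))
    have elt: "e i < e j \<longleftrightarrow> i < j" for i j using strict_mono_less[OF N(5)] .
    have "e (0 + int l * N) < e (0 + int (2 * l + 1) * k)" using less.prems(2)[OF e0] Fm[of "2 * l + 1" 0] eN[of 0 "int l"] by simp
    then have A: "int l * N < int (2 * l + 1) * k" using elt by simp
    have "e (0 + int (2 * l + 3) * k) < e (0 + (int l + 1) * N)" using less.prems(3)[OF e0] Fm[of "2 * l + 3" 0] eN[of 0 "int l + 1"] by simp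
    then have B: "int (2 * l + 3) * k < (int l + 1) * N" using elt by simp
    define d where "d = N - 2 * k"
    \<comment> \<open>The inequalities \<open>A\<close> and \<open>B\<close> state exactly
      \<open>0 < s\<close> and \<open>s < d\<close>.\<close>
    define s where "s = k - int l * d"
    have s: "0 < s" "s < d" using A B unfolding s_def d_def by (auto simp: algebra_simps)
    interpret circulant N k d "int l" s
      by unfold_locales (use s in \<open>auto simp: d_def s_def\<close>)
    have nl: "nat (2 * int l + 1) = 2 * l + 1" by simp
    show ?thesis
    proof (cases "s = 1")
      case True
      show ?thesis using homotopy_eqv_trans[OF eq circulant_odd_sphere[OF True]] unfolding nl .
    next
      case False
      then have s2: "2 \<le> s" using s by simp
      let ?W = "PC N punct"
      let ?G = "rst ?W (\<lambda>x. x + k)"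
      have k1: "1 \<le> k" using k_eq ld_nonneg s2 by simp
      have pun: "residues N ?W = {0..<N} - {0}"
      proof -
        have "(\<lambda>a. a mod N) ` punct = id ` punct" by (rule image_cong) (auto simp: punct_def)
        then show ?thesis unfolding residues_PC by (auto simp: punct_def)
      qed
      have 1: "clique_complex_space {0..<N} (cedge N (\<lambda>x. x + k)) homotopy_equivalent_space
          clique_complex_space (residues N ?W) (cedge N (\<lambda>x. x + k))"
        unfolding pun
      proof (rule clique_complex_remove_vertex[OF _ _ residues_nbrs])
        have "1 \<in> {1..k} \<union> {N - k..N - 1}" using k1 by simp
        then show "residues N (PC N nbrs) \<noteq> {}" unfolding residues_nbrs_eq by blast
        show "contractible_space (clique_complex_space (residues N (PC N nbrs)) (cedge N (\<lambda>x. x + k)))"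
          by (rule link_contractible[OF s2])
      qed (use N in auto)
      have pne: "punct \<noteq> {}" using k1 N(3) by (auto simp: punct_def)
      have cW: "cyc N ?W ?G" by (rule cyc_PC[OF pne])
      have 2: "clique_complex_space (residues N ?W) (cedge N ?G) homotopy_equivalent_space
          clique_complex_space (residues N ?W) (cedge N (\<lambda>x. x + k))"
        by (rule clique_complex_cong) (use cedge_rst[OF cyc_sh _ PC_periodic, of punct] in auto)
      have 3: "clique_complex_space (residues N ?W) (cedge N ?G) homotopy_equivalent_space
          clique_complex_space (join_verts 2 (2 * l + 1)) join_adj"
      proof (rule less.hyps[OF _ cW])
        show "card (residues N ?W) < card (residues n V)" unfolding pun using N(1) N(4)[symmetric] by simp
        show "(?G ^^ (2 * l + 1)) x > x + int l * N" if "x \<in> ?W" for x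
          using punct_rotation[OF s2 that] unfolding nl .
        show "(?G ^^ (2 * l + 3)) x < x + (int l + 1) * N" if "x \<in> ?W" for x
        proof -
          have "?W \<noteq> {}" using that by blast
          then have "(?G ^^ (2 * l + 3)) x \<le> ((\<lambda>x. x + k) ^^ (2 * l + 3)) x"
            by (intro rst_funpow_le[OF cyc_sh _ _ PC_periodic that]) auto
          also have "\<dots> = x + int (2 * l + 3) * k" by (rule shift_funpow)
          finally show ?thesis using B by simp
        qed
      qed
      note eq
      also note 1
      also note homotopy_equivalent_space_sym[THEN iffD1, OF 2]
      also note 3
      finally show ?thesis .
    qed
  qed
qed

lemma strong_collapse_cone:
  assumes "finite V" "c \<in> V" "\<And>u. u \<in> V \<Longrightarrow> u \<noteq> c \<Longrightarrow> E u c \<or> E c u"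
  shows "strong_collapse E V {c}"
proof -
  have "strong_collapse E V (V - U)" if "finite U" "U \<subseteq> V - {c}" for U
    using that
  proof (induction U rule: finite_induct)
    case empty then show ?case by (simp add: strong_collapse_refl)
  next
    case (insert u U)
    have "V - insert u U = (V - U) - {u}" by auto
    then show ?case
      using strong_collapse_step[of E V "V - U" u c] insert assms(2,3) by auto
  qed
  from this[of "V - {c}"] show ?thesis using assms(1,2) by (simp add: Diff_Diff_Int)
qed

text \<open>\<open>rot\<close> amounts to \<open>s = 0\<close>, that is \<open>k = l * d\<close>.
  For \<open>l = 0\<close> there are \<open>d\<close> isolated points. For \<open>d = 1\<close> the
  graph is complete and both complexes are cones, in accordance with a wedge of no spheres.\<close>

theorem circulant_wedge:
  fixes n k :: int
  assumes k: "0 \<le> k" "2 * k < n" and rot: "(2 * int l + 1) * k = int l * n"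
  shows "clique_complex_space {0..<n} (cedge n (\<lambda>x. x + k)) homotopy_equivalent_space
    wedge_spheres (nat (n - 2 * k - 1)) (2 * l)"
proof -
  define d where "d = n - 2 * k"
  have d: "0 < d" using k by (simp add: d_def)
  have kd: "k = int l * d" using rot by (simp add: d_def algebra_simps)
  have m: "Suc (nat (n - 2 * k - 1)) = nat d" using d by (simp add: d_def)
  interpret circulant n k d "int l" 0
    by (unfold_locales; use d kd d_def in linarith)
  have "clique_complex_space {0..<n} (cedge n (\<lambda>x. x + k)) homotopy_equivalent_space
    clique_complex_space (join_verts (nat d) (2 * l)) join_adj"
  proof -
    consider "l = 0" | "l \<ge> 1" "d \<ge> 2" | "d = 1" using d by linarith
    then show ?thesis
    proof cases
      case 1
      then have k0: "k = 0" and nd: "n = d" using kd by (auto simp: d_def)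
      have no: "\<not> cedge n (\<lambda>x. x + k) u v" for u v unfolding cedge_def k0 by auto
      show ?thesis
      proof (rule clique_complex_iso[of "\<lambda>x. Inl (nat x)"])
        show "bij_betw (\<lambda>x. Inl (nat x)) {0..<n} (join_verts (nat d) (2 * l))"
          unfolding 1 nd by (rule bij_betwI[where g = "\<lambda>v. case v of Inl i \<Rightarrow> int i | Inr _ \<Rightarrow> 0"]) (auto simp: join_verts_def)
      qed (use no in auto)
    next
      case 2
      have "nat (2 * int l) = 2 * l" by simp
      then show ?thesis using circulant_even_spheres[of] 2 by simp
    next
      case 3
      have 1: "strong_collapse (cedge n (\<lambda>x. x + k)) {0..<n} {0}"
      proof (rule strong_collapse_cone)
        fix u assume "u \<in> {0..<n}" "u \<noteq> 0"
        then have "\<bar>0 - u\<bar> < n" "0 - u \<noteq> 0" by auto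
        then show "cedge n (\<lambda>x. x + k) u 0 \<or> cedge n (\<lambda>x. x + k) 0 u"
          unfolding cadj_iff using cadj_range[of "0 - u" n k] n_gt n_eq 3 by auto
      qed (use n_pos in auto)
      have 2: "strong_collapse join_adj (join_verts (nat d) (2 * l)) {Inl 0}"
        by (rule strong_collapse_cone) (use 3 in \<open>auto simp: join_verts_def\<close>)
      have 3: "clique_complex_space {0} (cedge n (\<lambda>x. x + k)) homotopy_equivalent_space clique_complex_space {Inl 0} join_adj"
        by (rule clique_complex_iso[of "\<lambda>_. Inl 0"]) (auto simp: bij_betw_def)
      note strong_collapse_equiv[OF 1 finite_atLeastLessThan_int]
      also note 3
      also note homotopy_equivalent_space_sym[THEN iffD1, OF strong_collapse_equiv[OF 2 finite_join_verts]]
      finally show ?thesis .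
    qed
  qed
  then show ?thesis using homotopy_eqv_trans[OF _ join_homotopy_equivalent_wedge[of "nat (n - 2 * k - 1)" "2 * l"]] m by simp
qed

section \<open>Cyclic graphs as periodic maps\<close>

lemma cbetw_antisym: "cbetw i j k \<Longrightarrow> \<not> cbetw i k j"
  unfolding cbetw_def by linarith

lemma cbetw_total: "i \<noteq> j \<Longrightarrow> j \<noteq> k \<Longrightarrow> i \<noteq> k \<Longrightarrow> cbetw i j k \<or> cbetw i k j"
  unfolding cbetw_def by linarith

lemma cbetw_mod:
  fixes x y z n :: int
  assumes "0 < n" "x < y" "y < z" "z < x + n"
  shows "cbetw (nat (x mod n)) (nat (y mod n)) (nat (z mod n))"
proof -
  define a where "a = x mod n"
  define b where "b = y - (x div n) * n"
  define c where "c = z - (x div n) * n"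
  have a: "0 \<le> a" "a < n" using assms by (auto simp: a_def)
  have x: "x = a + (x div n) * n" by (simp add: a_def)
  have o: "a < b" "b < c" "c < a + n" using assms x by (auto simp: b_def c_def)
  have m: "y mod n = b mod n" "z mod n = c mod n"
    by (simp_all add: b_def c_def mod_diff_right_eq[symmetric, of y "x div n * n"] mod_diff_right_eq[symmetric, of z "x div n * n"])
  have red: "w mod n = (if w < n then w else w - n)" if "0 \<le> w" "w < 2 * n" for w
  proof (cases "w < n")
    case False
    have "w mod n = (w - n) mod n" by simp
    also have "\<dots> = w - n" using that False by (intro mod_pos_pos_trivial) auto
    finally show ?thesis using False by simp
  qed (use that in simp)
  have "b mod n = (if b < n then b else b - n)" "c mod n = (if c < n then c else c - n)"
    using red a o by auto
  then show ?thesis unfolding m a_def[symmetric] cbetw_def using a o by (auto simp: nat_less_iff)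
qed

lemma ctri_upt: "ctri [0..<q] a b c \<longleftrightarrow> a < q \<and> b < q \<and> c < q \<and> cbetw a b c"
proof
  assume "a < q \<and> b < q \<and> c < q \<and> cbetw a b c"
  then show "ctri [0..<q] a b c" unfolding ctri_def
    by (intro exI[of _ a] exI[of _ b] exI[of _ c] conjI) auto
qed (auto simp: ctri_def)

text \<open>An interval of a cyclic order contains one of the two arcs between any two of its
  points, so \<open>c\<close> and \<open>z\<close>, taken from different arcs, cannot both be
  missing.\<close>

lemma subinterval_sep:
  assumes "subinterval [0..<q] A" "a \<in> A" "b \<in> A" "c \<notin> A" "z \<notin> A" "c < q" "z < q" "cbetw a c b" "cbetw b z a"
  shows False
proof -
  have "A \<noteq> {}" using assms(2) by blast
  then consider i j where "i \<le> j" "j < q" "A = {[0..<q] ! t | t. i \<le> t \<and> t \<le> j}"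
    | i j where "i < j" "j < q" "A = {[0..<q] ! t | t. (j \<le> t \<and> t < q) \<or> t \<le> i}"
    using assms(1) unfolding subinterval_def length_upt diff_zero by blast
  then show False
  proof cases
    case (1 i j)
    have m: "t \<in> A \<longleftrightarrow> i \<le> t \<and> t \<le> j" for t using 1 by (auto intro!: exI[of _ t])
    have "i \<le> a" "a \<le> j" "i \<le> b" "b \<le> j" "c < i \<or> j < c" "z < i \<or> j < z"
      using m[of a] m[of b] m[of c] m[of z] assms(2-5) by auto
    then show False using assms(8,9) unfolding cbetw_def by presburger
  next
    case (2 i j)
    have m: "t \<in> A \<longleftrightarrow> j \<le> t \<or> t \<le> i" if "t < q" for t using 2 that by (auto intro!: exI[of _ t])
    have "a < q" "b < q" using 2 assms(2,3) by auto
    then have "j \<le> a \<or> a \<le> i" "j \<le> b \<or> b \<le> i" "i < c" "c < j" "i < z" "z < j"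
      using m[of a] m[of b] m[OF assms(6)] m[OF assms(7)] assms(2-5) by (auto simp: not_le)
    then show False using assms(8,9) 2(1) unfolding cbetw_def by presburger
  qed
qed

locale cgraph =
  fixes vs :: "'a list" and E :: "'a \<Rightarrow> 'a \<Rightarrow> bool"
  assumes cg: "cyclic_graph vs E" and ne: "vs \<noteq> []"
begin

definition n :: int where "n = int (length vs)"
definition P :: "int \<Rightarrow> 'a" where "P x = vs ! nat (x mod n)"

lemma n_pos: "0 < n" using ne by (simp add: n_def)

lemma dist: "distinct vs" and dig: "digraph (set vs) E" using cg by (auto simp: cyclic_graph_def)

lemma idx: "nat (x mod n) < length vs" using n_pos by (simp add: n_def nat_less_iff)

lemma P_cong: "x mod n = y mod n \<Longrightarrow> P x = P y" by (simp add: P_def)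

lemma P_shift [simp]: "P (x + m * n) = P x" "P (x + n) = P x" by (simp_all add: P_def)

lemma P_mod [simp]: "P (x mod n) = P x" by (simp add: P_def)

lemma P_eq: "P x = P y \<longleftrightarrow> x mod n = y mod n"
proof
  assume "P x = P y"
  then have "nat (x mod n) = nat (y mod n)" using nth_eq_iff_index_eq[OF dist idx idx] by (simp add: P_def)
  moreover have "0 \<le> x mod n" "0 \<le> y mod n" using n_pos by auto
  ultimately show "x mod n = y mod n" by linarith
qed (rule P_cong)

lemma P_in: "P x \<in> set vs" using idx by (simp add: P_def)

lemma P_nat: "P (int i) = vs ! (i mod length vs)"
  by (simp add: P_def n_def flip: zmod_int)

lemma P_surj: "v \<in> set vs \<Longrightarrow> \<exists>x. 0 \<le> x \<and> x < n \<and> P x = v"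
proof -
  assume "v \<in> set vs"
  then obtain i where "i < length vs" "vs ! i = v" by (metis in_set_conv_nth)
  then show ?thesis using P_nat[of i] by (intro exI[of _ "int i"]) (auto simp: n_def)
qed

lemma P_diff: "0 < z \<Longrightarrow> z < n \<Longrightarrow> P (x + z) \<noteq> P x"
proof
  assume z: "0 < z" "z < n" "P (x + z) = P x"
  then have "n dvd (x + z) - x" unfolding P_eq mod_eq_dvd_iff by blast
  then show False using z zdvd_imp_le[of n z] by simp
qed

lemma E_irrefl: "\<not> E v v" and E_asym: "E v w \<Longrightarrow> \<not> E w v" and E_in: "E v w \<Longrightarrow> v \<in> set vs \<and> w \<in> set vs"
  using dig unfolding digraph_def by blast+

lemma E_step:
  assumes "E (P x) (P y)" shows "P y = P (x + 1) \<or> (E (P x) (P (y - 1)) \<and> E (P (x + 1)) (P y))"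
proof -
  let ?m = "length vs"
  define i j where "i = nat (x mod n)" and "j = nat (y mod n)"
  have ij: "i < ?m" "j < ?m" using idx by (auto simp: i_def j_def)
  have Px: "P x = vs ! i" "P y = vs ! j" by (auto simp: P_def i_def j_def)
  have ii: "int i = x mod n" "int j = y mod n" using n_pos by (auto simp: i_def j_def)
  have "P (x + 1) = P (int (i + 1))" by (rule P_cong) (simp add: ii mod_simps add.commute)
  then have 1: "P (x + 1) = vs ! ((i + 1) mod ?m)" by (simp only: P_nat)
  have "P (y - 1) = P (int (j + ?m - 1))"
  proof (rule P_cong)
    have "1 \<le> j + ?m" using ne by (simp add: Suc_le_eq)
    then have "int (j + ?m - 1) = int (j + ?m) - int 1" by (rule of_nat_diff)
    then have "int (j + ?m - 1) = int j - 1 + n" by (simp add: n_def)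
    then show "(y - 1) mod n = int (j + ?m - 1) mod n" by (simp add: ii mod_simps)
  qed
  then have 2: "P (y - 1) = vs ! ((j + ?m - 1) mod ?m)" by (simp only: P_nat)
  have "j = (i + 1) mod ?m \<or> (E (vs ! i) (vs ! ((j + ?m - 1) mod ?m)) \<and> E (vs ! ((i + 1) mod ?m)) (vs ! j))"
    using cg ij assms unfolding cyclic_graph_def Let_def Px by blast
  then show ?thesis unfolding 1 2 Px by blast
qed

definition D :: "int \<Rightarrow> int" where "D x = Max (insert 0 {m\<in>{1..<n}. E (P x) (P (x + m))})"

lemma D_finite: "finite (insert 0 {m\<in>{1..<n}. E (P x) (P (x + m))})"
  by (rule finite_subset[of _ "{0..<n}"]) (use n_pos in auto)

lemma D_in: "D x = 0 \<or> (1 \<le> D x \<and> D x < n \<and> E (P x) (P (x + D x)))"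
proof -
  have "D x \<in> insert 0 {m\<in>{1..<n}. E (P x) (P (x + m))}" unfolding D_def by (rule Max_in[OF D_finite]) simp
  then show ?thesis by auto
qed

lemma D_ge: "1 \<le> m \<Longrightarrow> m < n \<Longrightarrow> E (P x) (P (x + m)) \<Longrightarrow> m \<le> D x"
  unfolding D_def by (rule Max_ge[OF D_finite]) auto

lemma D_bounds: "0 \<le> D x" "D x < n" using D_in[of x] n_pos by auto

lemma E_desc:
  assumes "E (P x) (P (x + m))" "2 \<le> m" "m < n"
  shows "E (P x) (P (x + (m - 1)))" "E (P (x + 1)) (P (x + 1 + (m - 1)))"
proof -
  have "P (x + m) \<noteq> P (x + 1)" using P_diff[of "m - 1" "x + 1"] assms by (simp add: algebra_simps)
  then show "E (P x) (P (x + (m - 1)))" "E (P (x + 1)) (P (x + 1 + (m - 1)))"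
    using E_step[OF assms(1)] by (auto simp: algebra_simps)
qed

text \<open>The out-neighbours form an interval directly after the vertex, so its last element
  determines all edges.\<close>

lemma E_down: "1 \<le> m \<Longrightarrow> m \<le> D x \<Longrightarrow> E (P x) (P (x + m))"
proof (induction "nat (D x - m)" arbitrary: m)
  case 0
  then have "m = D x" by simp
  then show ?case using D_in[of x] 0 by auto
next
  case (Suc t)
  then have "E (P x) (P (x + (m + 1)))" using Suc.hyps(1)[of "m + 1"] by simp
  then show ?case using E_desc(1)[of x "m + 1"] Suc D_bounds[of x] by simp
qed

definition F :: "int \<Rightarrow> int" where "F x = x + D x"

lemma F_step: "F x \<le> F (x + 1)"
proof (cases "D x \<ge> 2")
  case True
  then have "E (P (x + 1)) (P (x + 1 + (D x - 1)))" using E_desc(2)[of x "D x"] D_in[of x] by auto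
  then have "D x - 1 \<le> D (x + 1)" using True D_bounds[of x] by (intro D_ge) auto
  then show ?thesis by (simp add: F_def)
next
  case False then show ?thesis using D_bounds(1)[of "x + 1"] by (simp add: F_def)
qed

lemma F_mono: "x \<le> y \<Longrightarrow> F x \<le> F y"
proof (induction y rule: int_ge_induct)
  case (step y) then show ?case using F_step[of y] by simp
qed simp

lemma D_shift: "D (x + n) = D x"
proof -
  have "P (x + n + m) = P (x + m)" for m using P_shift(2)[of "x + m"] by (simp add: algebra_simps)
  then show ?thesis by (simp add: D_def)
qed

lemma cyc_F: "cyc n UNIV F"
  unfolding cyc_def
proof (intro conjI ballI)
  show "F (x + n) = F x + n" for x by (simp add: F_def D_shift)
  show "F (F x) < x + n" for x
  proof (cases "D x = 0")
    case True then show ?thesis using D_bounds[of x] by (simp add: F_def)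
  next
    case False
    then have e: "1 \<le> D x" "D x < n" "E (P x) (P (x + D x))" using D_in[of x] by auto
    \<comment> \<open>Otherwise the out-interval of \<open>F x\<close> would come round to
      \<open>x\<close>, giving an edge opposite to the one from \<open>x\<close> to
      \<open>F x\<close>.\<close>
    have "D (x + D x) < n - D x"
    proof (rule ccontr)
      assume "\<not> D (x + D x) < n - D x"
      then have "E (P (x + D x)) (P (x + D x + (n - D x)))" using e by (intro E_down) auto
      then show False using E_asym[OF e(3)] by (simp add: algebra_simps)
    qed
    then show ?thesis by (simp add: F_def)
  qed
qed (use n_pos F_mono D_bounds in \<open>auto simp: F_def\<close>)

lemma cedge_F: "cedge n F x y \<longleftrightarrow> E (P x) (P y)"
proof
  assume "cedge n F x y"
  then obtain m where m: "x < y + m * n" "y + m * n \<le> F x" unfolding cedge_def by blast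
  then have "E (P x) (P (x + (y + m * n - x)))" by (intro E_down) (auto simp: F_def)
  then show "E (P x) (P y)" by simp
next
  assume e: "E (P x) (P y)"
  define t where "t = (y - x) mod n"
  have yt: "y + (- ((y - x) div n)) * n = x + t" by (simp add: t_def minus_div_mult_eq_mod[symmetric] algebra_simps)
  then have Pt: "P (x + t) = P y" using P_shift(1)[of y] by metis
  have "0 \<le> t" "t < n" using n_pos by (auto simp: t_def)
  moreover have "t \<noteq> 0" using Pt e E_irrefl by auto
  ultimately have "t \<le> D x" using D_ge[of t x] e Pt by simp
  then show "cedge n F x y" unfolding cedge_def using yt \<open>0 \<le> t\<close> \<open>t \<noteq> 0\<close>
    by (intro exI[of _ "- ((y - x) div n)"]) (auto simp: F_def)
qed

lemma space_equiv: "clique_complex_space (set vs) E homotopy_equivalent_space clique_complex_space {0..<n} (cedge n F)"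
proof -
  have "clique_complex_space {0..<n} (cedge n F) homotopy_equivalent_space clique_complex_space (set vs) E"
  proof (rule clique_complex_iso[of P])
    have "inj_on P {0..<n}" by (rule inj_onI) (simp add: P_eq)
    moreover have "P ` {0..<n} = set vs" using P_in P_surj by (force simp: image_iff)
    ultimately show "bij_betw P {0..<n} (set vs)" by (simp add: bij_betw_def)
  qed (simp_all add: cedge_F)
  then show ?thesis using homotopy_equivalent_space_sym by blast
qed

section \<open>Cyclic homomorphisms and their lifts to the integers\<close>

lemma ctri_P: "ctri vs (P x) (P y) (P z) \<longleftrightarrow> cbetw (nat (x mod n)) (nat (y mod n)) (nat (z mod n))"
proof
  assume "ctri vs (P x) (P y) (P z)"
  then obtain i j k where "i < length vs" "j < length vs" "k < length vs" "vs ! i = P x" "vs ! j = P y" "vs ! k = P z" "cbetw i j k"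
    unfolding ctri_def by blast
  moreover from this have "i = nat (x mod n)" "j = nat (y mod n)" "k = nat (z mod n)"
    using nth_eq_iff_index_eq[OF dist] idx unfolding P_def by blast+
  ultimately show "cbetw (nat (x mod n)) (nat (y mod n)) (nat (z mod n))" by simp
next
  assume "cbetw (nat (x mod n)) (nat (y mod n)) (nat (z mod n))"
  then show "ctri vs (P x) (P y) (P z)" unfolding ctri_def P_def using idx by blast
qed

text \<open>Over one period, \<open>h\<close> records the position of the value relative to the
  value at \<open>i0\<close>, reduced to a single turn. If \<open>h\<close> decreased, three values
  would be in the wrong cyclic order, or, when it returns to 0, a fibre would be split.\<close>

lemma hom_lift:
  assumes mon: "cyclic_monotone [0..<q] vs f" and ab: "a < q" "b < q" "f a \<noteq> f b"
  obtains \<phi> where "mono \<phi>" "\<forall>t. \<phi> (t + int q) = \<phi> t + n" "\<forall>t. P (\<phi> t) = f (nat (t mod int q))"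
proof -
  define Q where "Q = int q"
  have Q: "0 < Q" using ab by (simp add: Q_def)
  define f' where "f' = (\<lambda>t. f (nat (t mod Q)))"
  have iq: "nat (t mod Q) < q" for t using Q by (simp add: Q_def nat_less_iff)
  have f'_in: "f' t \<in> set vs" for t using mon iq unfolding cyclic_monotone_def f'_def by force
  have f'_per: "f' (t + Q) = f' t" for t by (simp add: f'_def)
  \<comment> \<open>A place where a new fibre begins. Counted from there, the first fibre does not
    wrap around the end of the period.\<close>
  have "\<exists>i. f' (i - 1) \<noteq> f' i"
  proof (rule ccontr)
    assume "\<not> ?thesis"
    then have st: "f' (i - 1) = f' i" for i by blast
    have "f' i = f' 0" for i
    proof (induction i rule: int_induct[of _ 0])
      case (step1 i) then show ?case using st[of "i + 1"] by simp
    next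
      case (step2 i) then show ?case using st[of i] by simp
    qed simp
    from this[of "int a"] this[of "int b"] show False using ab by (simp add: f'_def Q_def)
  qed
  then obtain i0 where i0: "f' (i0 - 1) \<noteq> f' i0" by blast
  define g where "g = (\<lambda>t. SOME x. 0 \<le> x \<and> x < n \<and> P x = f' t)"
  have g: "P (g t) = f' t" for t
    using someI_ex[OF P_surj[OF f'_in[of t]]] by (simp add: g_def)
  define h where "h = (\<lambda>t. (g (i0 + t) - g i0) mod n)"
  have h0: "h 0 = 0" by (simp add: h_def)
  have hb: "0 \<le> h t" "h t < n" for t using n_pos by (auto simp: h_def)
  have Ph: "P (g i0 + h t) = f' (i0 + t)" for t
    unfolding g[symmetric] by (rule P_cong) (simp add: h_def mod_simps)
  have cb: "cbetw (nat (x mod Q)) (nat (y mod Q)) (nat (z mod Q))" if "x < y" "y < z" "z < x + Q" for x y z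
    using cbetw_mod[OF Q that] .
  have hmono: "h t \<le> h t'" if t: "0 \<le> t" "t < t'" "t' < Q" for t t'
  proof (rule ccontr)
    assume lt: "\<not> h t \<le> h t'"
    then have t0: "0 < t" using h0 hb(1)[of t'] t by (cases "t = 0") auto
    have c1: "cbetw (nat (i0 mod Q)) (nat ((i0 + t) mod Q)) (nat ((i0 + t') mod Q))" using t t0 by (intro cb) auto
    show False
    proof (cases "h t' = 0")
      case False
      then have "0 < h t'" using hb(1)[of t'] by simp
      then have "cbetw (nat (g i0 mod n)) (nat ((g i0 + h t') mod n)) (nat ((g i0 + h t) mod n))"
        using lt hb(2)[of t] by (intro cbetw_mod[OF n_pos]) auto
      then have "ctri vs (f' i0) (f' (i0 + t')) (f' (i0 + t))" using ctri_P g Ph by metis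
      then have "ctri [0..<q] (nat (i0 mod Q)) (nat ((i0 + t') mod Q)) (nat ((i0 + t) mod Q))"
        using mon iq unfolding cyclic_monotone_def f'_def by auto
      then show False using cbetw_antisym[OF c1] by (simp add: ctri_upt)
    next
      case True
      then have eq: "f' (i0 + t') = f' i0" using Ph[of t'] g[of i0] by simp
      have neq: "f' (i0 + t) \<noteq> f' i0" using P_diff[of "h t" "g i0"] Ph[of t] g[of i0] lt True hb by auto
      \<comment> \<open>The fibre contains \<open>i0\<close> and \<open>i0 + t'\<close>, but neither
        \<open>i0 + t\<close> nor the point before \<open>i0\<close>, which lie on different arcs
        between them.\<close>
      have z: "f' (i0 + Q - 1) \<noteq> f' i0" using i0 f'_per[of "i0 - 1"] by (simp add: algebra_simps)
      have "t' \<noteq> Q - 1" using eq z by (auto simp: algebra_simps)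
      then have c2: "cbetw (nat ((i0 + t') mod Q)) (nat ((i0 + Q - 1) mod Q)) (nat ((i0 + Q) mod Q))"
        using t t0 by (intro cb) auto
      have "subinterval [0..<q] {s \<in> set [0..<q]. f s = f' i0}" using mon f'_in unfolding cyclic_monotone_def by blast
      then show False
        by (rule subinterval_sep[where a = "nat (i0 mod Q)" and b = "nat ((i0 + t') mod Q)"
              and c = "nat ((i0 + t) mod Q)" and z = "nat ((i0 + Q - 1) mod Q)"])
          (use iq eq neq z c1 c2 in \<open>auto simp: f'_def\<close>)
    qed
  qed
  define \<phi> where "\<phi> = (\<lambda>t. g i0 + h ((t - i0) mod Q) + ((t - i0) div Q) * n)"
  have "mono \<phi>"
  proof (rule monoI)
    fix s t :: int assume st: "s \<le> t"
    let ?u = "s - i0" and ?v = "t - i0"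
    have le: "?u div Q \<le> ?v div Q" using st Q by (intro zdiv_mono1) auto
    show "\<phi> s \<le> \<phi> t"
    proof (cases "?u div Q = ?v div Q")
      case True
      have "Q * (?u div Q) = Q * (?v div Q)" using True by simp
      then have "?u mod Q \<le> ?v mod Q" using st mult_div_mod_eq[of Q ?u] mult_div_mod_eq[of Q ?v] by linarith
      then have "h (?u mod Q) \<le> h (?v mod Q)" using hmono[of "?u mod Q" "?v mod Q"] Q by (cases "?u mod Q = ?v mod Q") auto
      then show ?thesis using True by (simp add: \<phi>_def)
    next
      case False
      then have "(?u div Q + 1) * n \<le> (?v div Q) * n" using le n_pos by (intro mult_right_mono) auto
      then show ?thesis using hb(2)[of "?u mod Q"] hb(1)[of "?v mod Q"] unfolding \<phi>_def by (simp add: algebra_simps)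
    qed
  qed
  moreover have "\<phi> (t + int q) = \<phi> t + n" for t
  proof -
    have "(t + Q - i0) = (t - i0) + Q" by simp
    then have "(t + Q - i0) mod Q = (t - i0) mod Q" "(t + Q - i0) div Q = (t - i0) div Q + 1" using Q by (simp_all only: mod_add_self2 div_add_self2)
    then show ?thesis unfolding \<phi>_def Q_def[symmetric] by (simp add: algebra_simps)
  qed
  moreover have "P (\<phi> t) = f (nat (t mod int q))" for t
  proof -
    have "P (\<phi> t) = f' (i0 + (t - i0) mod Q)" unfolding \<phi>_def using Ph by simp
    also have "\<dots> = f' t" unfolding f'_def by (simp add: mod_simps)
    finally show ?thesis by (simp add: f'_def Q_def)
  qed
  ultimately show ?thesis using that by blast
qed

lemma F_ge: "x \<le> F x" using D_bounds by (simp add: F_def)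

lemma F_gtI: "x \<le> y \<Longrightarrow> y < x + n \<Longrightarrow> P x = P y \<or> E (P x) (P y) \<Longrightarrow> y \<le> F x"
  using D_ge[of "y - x" x] P_diff[of "y - x" x] F_ge[of x] by (cases "x = y") (auto simp: F_def)

lemma per_mult:
  assumes "\<forall>t. \<phi> (t + Q) = \<phi> t + (n::int)" shows "\<phi> (t + m * Q) = \<phi> t + m * n"
  by (rule strict_mono_shift) (use assms in blast)

text \<open>The lift satisfies \<open>\<phi> (t + p) \<le> F (\<phi> t)\<close>, and
  \<open>q\<close> such steps lead from \<open>\<phi> 0\<close> to
  \<open>\<phi> (q * p) = \<phi> 0 + p * n\<close>. For \<open>p = 0\<close> the source has no
  directed cycle, so \<open>f\<close> may be constant and have no lift.\<close>

lemma hom_rot: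
  assumes hom: "cyclic_hom [0..<q] (Cnk q p) vs E f" and pq: "2 * p < q"
  shows "\<exists>x. x + int p * n \<le> (F ^^ q) x"
proof (cases "p = 0")
  case True
  have "0 \<le> (F ^^ m) 0" for m by (induction m) (use F_ge order_trans in auto)
  then show ?thesis using True by (intro exI[of _ 0]) simp
next
  case False
  have mon: "cyclic_monotone [0..<q] vs f" and gh: "graph_hom (Cnk q p) E f" using hom by (auto simp: cyclic_hom_def)
  define Q where "Q = int q"
  have Q: "0 < Q" using pq by (simp add: Q_def)
  have Cn: "Cnk q p (nat (t mod Q)) (nat ((t + u) mod Q))" if "0 < u" "u \<le> int p" for t u
  proof -
    define i where "i = nat (t mod Q)"
    define j where "j = nat ((t + u) mod Q)"
    have ij: "int i = t mod Q" "int j = (t + u) mod Q" using Q by (auto simp: i_def j_def)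
    have lt: "i < q" "j < q" using Q by (auto simp: i_def j_def Q_def nat_less_iff)
    have "int ((j + q - i) mod q) = (int j + Q - int i) mod Q" using lt by (simp add: zmod_int of_nat_diff Q_def)
    also have "\<dots> = (((t + u) mod Q - t mod Q) + Q) mod Q" unfolding ij by (simp add: algebra_simps)
    also have "\<dots> = (t + u - t) mod Q" by (simp only: mod_add_self2 mod_diff_eq)
    also have "\<dots> = u" using that pq by (simp add: Q_def)
    finally show ?thesis using lt that unfolding Cnk_def i_def[symmetric] j_def[symmetric] by auto
  qed
  have "has_dcycle (set [0..<q]) (Cnk q p)"
    unfolding has_dcycle_def
  proof (intro exI[of _ "[0..<q]"] conjI allI impI)
    fix i assume "i < length [0..<q]"
    then have i: "i < q" by simp
    have "Cnk q p (nat (int i mod Q)) (nat ((int i + 1) mod Q))" using Cn[of 1 "int i"] False by simp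
    moreover have "nat (int i mod Q) = i" "nat ((int i + 1) mod Q) = (i + 1) mod q"
      using i by (simp_all add: Q_def nat_mod_as_int add.commute)
    ultimately show "Cnk q p ([0..<q] ! i) ([0..<q] ! ((i + 1) mod length [0..<q]))" using i by simp
  qed (use pq in auto)
  then obtain a b where ab: "a < q" "b < q" "f a \<noteq> f b" using hom by (auto simp: cyclic_hom_def)
  obtain \<phi> where phi: "mono \<phi>" "\<forall>t. \<phi> (t + int q) = \<phi> t + n" "\<forall>t. P (\<phi> t) = f (nat (t mod int q))"
    by (rule hom_lift[OF mon ab])
  have per: "\<phi> (t + m * Q) = \<phi> t + m * n" for t m by (rule per_mult) (use phi(2) in \<open>simp add: Q_def\<close>)
  have edge: "P (\<phi> t) = P (\<phi> (t + u)) \<or> E (P (\<phi> t)) (P (\<phi> (t + u)))" if "0 < u" "u \<le> int p" for t u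
    using gh Cn[OF that, of t] phi(3) unfolding graph_hom_def Q_def by metis
  have le: "\<phi> (t + int p) \<le> F (\<phi> t)" for t
  proof -
    have 1: "\<phi> t \<le> \<phi> (t + int p)" using monoD[OF phi(1)] by simp
    have 2: "\<phi> (t + int p) \<le> \<phi> t + n" using monoD[OF phi(1), of "t + int p" "t + 1 * Q"] per[of t 1] pq by (simp add: Q_def)
    \<comment> \<open>A step of length \<open>p\<close> might go once round and end at the same
      vertex, where the homomorphism condition is void. But then the last \<open>u\<close> whose
      value lies strictly inside that turn has edges to and from \<open>P (\<phi> t)\<close>; and if
      there is no such value, \<open>f\<close> is constant.\<close>
    have "\<phi> (t + int p) \<noteq> \<phi> t + n"
    proof
      assume eq: "\<phi> (t + int p) = \<phi> t + n"
      have ex: "\<exists>v. t < v \<and> v < t + int p \<and> \<phi> t < \<phi> v \<and> \<phi> v < \<phi> t + n"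
      proof (rule ccontr)
        assume no: "\<not> ?thesis"
        have "\<phi> v = \<phi> t \<or> \<phi> v = \<phi> t + n" if v: "t \<le> v" "v < t + Q" for v
        proof (cases "v < t + int p")
          case True
          then show ?thesis using no v monoD[OF phi(1), of t v] monoD[OF phi(1), of v "t + int p"] eq by (cases "v = t") force+
        next
          case False
          then show ?thesis using v monoD[OF phi(1), of "t + int p" v] monoD[OF phi(1), of v "t + 1 * Q"] per[of t 1] eq by auto
        qed
        then have c: "P (\<phi> v) = P (\<phi> t)" if "t \<le> v" "v < t + Q" for v using that by force
        have "f i = P (\<phi> t)" if i: "i < q" for i
        proof -
          define v where "v = t + (int i - t) mod Q"
          have "t \<le> v" "v < t + Q" using Q by (auto simp: v_def)
          then have "P (\<phi> v) = P (\<phi> t)" by (rule c)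
          moreover have "v mod Q = int i" using i unfolding v_def by (simp add: mod_simps Q_def)
          ultimately show ?thesis using phi(3) by (simp add: Q_def)
        qed
        then show False using ab by metis
      qed
      define S where "S = {v. t < v \<and> v < t + int p \<and> \<phi> t < \<phi> v \<and> \<phi> v < \<phi> t + n}"
      have fin: "finite S" by (rule finite_subset[of _ "{t..t + int p}"]) (auto simp: S_def)
      define u where "u = Max S"
      have "S \<noteq> {}" using ex unfolding S_def by blast
      then have u: "u \<in> S" unfolding u_def by (rule Max_in[OF fin])
      have "u + 1 \<notin> S" using Max_ge[OF fin, of "u + 1"] unfolding u_def[symmetric] by auto
      moreover have "\<phi> u \<le> \<phi> (u + 1)" "\<phi> (u + 1) \<le> \<phi> (t + int p)" using u by (auto intro!: monoD[OF phi(1)] simp: S_def)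
      ultimately have u1: "\<phi> (u + 1) = \<phi> t + n" using u eq by (cases "u + 1 = t + int p") (auto simp: S_def)
      have d: "P (\<phi> u) \<noteq> P (\<phi> t)" using P_diff[of "\<phi> u - \<phi> t" "\<phi> t"] u by (auto simp: S_def)
      have "E (P (\<phi> u)) (P (\<phi> t))" using edge[of 1 u] u1 False d by simp
      moreover have "E (P (\<phi> t)) (P (\<phi> u))" using edge[of "u - t" t] u d by (auto simp: S_def)
      ultimately show False using E_asym by blast
    qed
    then show ?thesis using 1 2 edge[of "int p" t] False by (intro F_gtI) auto
  qed
  have "\<phi> (int m * int p) \<le> (F ^^ m) (\<phi> 0)" for m
  proof (induction m)
    case (Suc m)
    have "\<phi> (int (Suc m) * int p) = \<phi> (int m * int p + int p)" by (simp add: algebra_simps)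
    also have "\<dots> \<le> F (\<phi> (int m * int p))" by (rule le)
    also have "\<dots> \<le> F ((F ^^ m) (\<phi> 0))" by (rule F_mono[OF Suc])
    finally show ?case by simp
  qed simp
  from this[of q] have "\<phi> 0 + int p * n \<le> (F ^^ q) (\<phi> 0)" using per[of 0 "int p"] by (simp add: Q_def mult.commute)
  then show ?thesis by blast
qed

end

lemma cbetw_rot: "cbetw i j k \<longleftrightarrow> cbetw j k i"
  unfolding cbetw_def by linarith

lemma cbetw_distinct: "cbetw i j k \<Longrightarrow> i \<noteq> j \<and> j \<noteq> k \<and> i \<noteq> k"
  unfolding cbetw_def by linarith

lemma subinterval_convex:
  assumes A: "A \<subseteq> {..<q}" and conv: "\<And>a b c. a \<in> A \<Longrightarrow> c \<in> A \<Longrightarrow> a \<le> b \<Longrightarrow> b \<le> c \<Longrightarrow> b \<in> A"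
  shows "subinterval [0..<q] A"
proof (cases "A = {}")
  case False
  have fin: "finite A" using A finite_subset by blast
  have mem: "Min A \<in> A" "Max A \<in> A" using fin False by auto
  have "A = {[0..<q] ! t | t. Min A \<le> t \<and> t \<le> Max A}"
  proof (intro equalityI subsetI)
    fix x assume x: "x \<in> A"
    then have "x < q" "Min A \<le> x" "x \<le> Max A" using A fin by auto
    then show "x \<in> {[0..<q] ! t | t. Min A \<le> t \<and> t \<le> Max A}" by (intro CollectI exI[of _ x]) simp
  next
    fix x assume "x \<in> {[0..<q] ! t | t. Min A \<le> t \<and> t \<le> Max A}"
    then obtain t where t: "x = [0..<q] ! t" "Min A \<le> t" "t \<le> Max A" by blast
    have "t \<in> A" using conv[OF mem t(2,3)] .
    then show "x \<in> A" using t A by auto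
  qed
  moreover have "Min A \<le> Max A" "Max A < q" using mem A fin by auto
  ultimately show ?thesis unfolding subinterval_def by (intro disjI2 disjI1 exI[of _ "Min A"] exI[of _ "Max A"]) simp
qed (simp add: subinterval_def)

lemma subinterval_cut:
  assumes "i < j" "j < q" shows "subinterval [0..<q] {t. t < q \<and> (t \<le> i \<or> j \<le> t)}"
proof -
  have "{t. t < q \<and> (t \<le> i \<or> j \<le> t)} = {[0..<q] ! t | t. (j \<le> t \<and> t < q) \<or> t \<le> i}"
  proof (intro equalityI subsetI)
    fix x assume "x \<in> {t. t < q \<and> (t \<le> i \<or> j \<le> t)}"
    then show "x \<in> {[0..<q] ! t | t. (j \<le> t \<and> t < q) \<or> t \<le> i}" by (intro CollectI exI[of _ x]) auto
  qed (use assms in auto)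
  then show ?thesis using assms unfolding subinterval_def by (intro disjI2 exI[of _ i] exI[of _ j]) simp
qed

context cgraph begin

text \<open>An edge of the source is a step of length at most \<open>p\<close>, which stays inside
  the out-interval. Fibres and cyclic order behave well since one period of \<open>\<phi>\<close>
  makes exactly one turn.\<close>

lemma lift_hom:
  assumes mono: "mono \<phi>" and per: "\<forall>t. \<phi> (t + int q) = \<phi> t + n" and le: "\<And>t. \<phi> (t + int p) \<le> F (\<phi> t)"
    and pq: "2 * p < q"
  shows "cyclic_hom [0..<q] (Cnk q p) vs E (\<lambda>i. P (\<phi> (int i)))"
proof -
  have q: "0 < q" using pq by simp
  have per0: "\<phi> (int q) = \<phi> 0 + n" using per[rule_format, of 0] by simp
  have rng: "\<phi> 0 \<le> \<phi> (int i)" "\<phi> (int i) \<le> \<phi> 0 + n" if "i < q" for i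
    using monoD[OF mono, of 0 "int i"] monoD[OF mono, of "int i" "int q"] per0 that by auto
  have "cyclic_monotone [0..<q] vs (\<lambda>i. P (\<phi> (int i)))"
    unfolding cyclic_monotone_def
  proof (intro conjI ballI impI)
    show "(\<lambda>i. P (\<phi> (int i))) ` set [0..<q] \<subseteq> set vs" using P_in by auto
  next
    fix v assume "v \<in> set vs"
    then obtain x where x: "P x = v" using P_surj by blast
    define y where "y = \<phi> 0 + (x - \<phi> 0) mod n"
    have y: "\<phi> 0 \<le> y" "y < \<phi> 0 + n" using n_pos by (auto simp: y_def)
    have Py: "P y = v" using x P_cong[of y x] by (simp add: y_def mod_simps)
    define A where "A = {s \<in> set [0..<q]. P (\<phi> (int s)) = v}"
    have A: "s \<in> A \<longleftrightarrow> s < q \<and> (\<phi> (int s) = y \<or> (y = \<phi> 0 \<and> \<phi> (int s) = \<phi> 0 + n))" for s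
    proof (cases "s < q")
      case True
      have "P (\<phi> (int s)) = v \<longleftrightarrow> \<phi> (int s) = y \<or> (y = \<phi> 0 \<and> \<phi> (int s) = \<phi> 0 + n)"
      proof
        assume "P (\<phi> (int s)) = v"
        then have "P (\<phi> (int s)) = P y" using Py by simp
        then have "n dvd \<phi> (int s) - y" unfolding P_eq mod_eq_dvd_iff .
        then obtain m where "\<phi> (int s) - y = n * m" by (rule dvdE)
        then have m: "\<phi> (int s) = y + n * m" by simp
        have "n * (-1) < n * m" "n * m \<le> n * 1" using rng[OF True] y m by linarith+
        then have "-1 < m" "m \<le> 1" using n_pos mult_less_cancel_left_pos[OF n_pos] mult_le_cancel_left_pos[OF n_pos] by blast+
        then consider "m = 0" | "m = 1" by linarith
        then show "\<phi> (int s) = y \<or> (y = \<phi> 0 \<and> \<phi> (int s) = \<phi> 0 + n)" using m rng[OF True] y by cases auto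
      qed (use Py in auto)
      then show ?thesis using True by (simp add: A_def)
    qed (simp add: A_def)
    have sub: "A \<subseteq> {..<q}" using A by auto
    have "subinterval [0..<q] A"
    proof (cases "\<exists>t<q. \<phi> (int t) = \<phi> 0 + n \<and> y = \<phi> 0")
      case False
      show ?thesis
      proof (rule subinterval_convex[OF sub])
        fix a b c assume abc: "a \<in> A" "c \<in> A" "a \<le> b" "b \<le> c"
        then have "\<phi> (int a) = y" "\<phi> (int c) = y" "c < q" using A False by auto
        moreover have "\<phi> (int a) \<le> \<phi> (int b)" "\<phi> (int b) \<le> \<phi> (int c)" using abc by (auto intro!: monoD[OF mono])
        ultimately show "b \<in> A" using A abc by auto
      qed
    next
      case True
      \<comment> \<open>Values over one period run from \<open>\<phi> 0\<close> to at most
        \<open>\<phi> 0 + n\<close>, and these two are the same vertex. Only its fibre can consist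
        of an initial and a final segment.\<close>
      then have y0: "y = \<phi> 0" by blast
      define B where "B = {t. t < q \<and> \<phi> (int t) = \<phi> 0 + n}"
      define C where "C = {t. t < q \<and> \<phi> (int t) = \<phi> 0}"
      have fin: "finite B" "finite C" by (auto simp: B_def C_def)
      have ne: "B \<noteq> {}" "C \<noteq> {}" using True q unfolding B_def C_def by (blast, force intro: exI[of _ 0])
      define j where "j = Min B"
      define i where "i = Max C"
      have j: "j < q" "\<phi> (int j) = \<phi> 0 + n" using Min_in[OF fin(1) ne(1)] by (auto simp: j_def B_def)
      have i: "i < q" "\<phi> (int i) = \<phi> 0" using Max_in[OF fin(2) ne(2)] by (auto simp: i_def C_def)
      have ij: "i < j" using i j n_pos monoD[OF mono, of "int j" "int i"] by (cases "i < j") auto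
      have "A = {t. t < q \<and> (t \<le> i \<or> j \<le> t)}"
      proof (rule set_eqI)
        fix t
        have "\<phi> (int t) = \<phi> 0 \<longleftrightarrow> t \<le> i" if t: "t < q"
        proof
          assume "\<phi> (int t) = \<phi> 0"
          then show "t \<le> i" unfolding i_def using t by (intro Max_ge[OF fin(2)]) (simp add: C_def)
        next
          assume "t \<le> i"
          then show "\<phi> (int t) = \<phi> 0" using monoD[OF mono, of "int t" "int i"] i rng[OF t] by simp
        qed
        moreover have "\<phi> (int t) = \<phi> 0 + n \<longleftrightarrow> j \<le> t" if t: "t < q"
        proof
          assume "\<phi> (int t) = \<phi> 0 + n"
          then show "j \<le> t" unfolding j_def using t by (intro Min_le[OF fin(1)]) (simp add: B_def)
        next
          assume "j \<le> t"
          then show "\<phi> (int t) = \<phi> 0 + n" using monoD[OF mono, of "int j" "int t"] j rng[OF t] by simp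
        qed
        ultimately show "t \<in> A \<longleftrightarrow> t \<in> {t. t < q \<and> (t \<le> i \<or> j \<le> t)}" using A[of t] y0 by auto
      qed
      then show ?thesis using subinterval_cut[OF ij j(1)] by simp
    qed
    then show "subinterval [0..<q] {s \<in> set [0..<q]. P (\<phi> (int s)) = v}" by (simp add: A_def)
  next
    fix a b c assume abc: "a \<in> set [0..<q]" "b \<in> set [0..<q]" "c \<in> set [0..<q]"
      and tri: "ctri vs (P (\<phi> (int a))) (P (\<phi> (int b))) (P (\<phi> (int c)))"
    define m where "m = (\<lambda>t::nat. nat (\<phi> (int t) mod n))"
    have cb: "cbetw (m a) (m b) (m c)" using tri unfolding ctri_P m_def .
    then have dis: "m a \<noteq> m b" "m b \<noteq> m c" "m a \<noteq> m c" using cbetw_distinct by blast+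
    have lt: "\<phi> (int x) < \<phi> (int y)" if "x < y" "m x \<noteq> m y" for x y
    proof -
      have "\<phi> (int x) \<le> \<phi> (int y)" using that by (intro monoD[OF mono]) simp
      moreover have "\<phi> (int x) \<noteq> \<phi> (int y)" using that by (auto simp: m_def)
      ultimately show ?thesis by simp
    qed
    have srt: "cbetw (m x) (m y) (m z)" if "x < y" "y < z" "z < q" "m x \<noteq> m y" "m y \<noteq> m z" "m x \<noteq> m z" for x y z
    proof -
      have "\<phi> (int z) \<le> \<phi> (int x + int q)" using that by (intro monoD[OF mono]) simp
      then have "\<phi> (int z) \<le> \<phi> (int x) + n" using per by simp
      moreover have "\<phi> (int z) \<noteq> \<phi> (int x) + n" using that(6) by (auto simp: m_def)
      ultimately have "\<phi> (int z) < \<phi> (int x) + n" by simp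
      then show ?thesis unfolding m_def using cbetw_mod[OF n_pos lt[OF that(1,4)] lt[OF that(2,5)]] by simp
    qed
    have "cbetw a b c"
    proof (rule ccontr)
      assume "\<not> cbetw a b c"
      moreover have "a \<noteq> b" "b \<noteq> c" "a \<noteq> c" using dis by auto
      ultimately have "cbetw a c b" using cbetw_total by blast
      then consider "a < c" "c < b" | "b < a" "a < c" | "c < b" "b < a" unfolding cbetw_def by blast
      then have "cbetw (m a) (m c) (m b)"
      proof cases
        case 1 then show ?thesis using srt[of a c b] dis abc by auto
      next
        case 2 then show ?thesis using srt[of b a c] dis abc cbetw_rot by auto
      next
        case 3 then show ?thesis using srt[of c b a] dis abc cbetw_rot by auto
      qed
      then show False using cbetw_antisym[OF cb] by blast
    qed
    then show "ctri [0..<q] a b c" using abc by (simp add: ctri_upt)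
  qed
  moreover have "graph_hom (Cnk q p) E (\<lambda>i. P (\<phi> (int i)))"
    unfolding graph_hom_def
  proof (intro allI impI)
    fix i j assume C: "Cnk q p i j"
    define u where "u = (j + q - i) mod q"
    have ij: "i < q" "j < q" and u: "0 < u" "u \<le> p" using C by (auto simp: Cnk_def u_def)
    have "u = j - i \<and> i \<le> j \<or> u = j + q - i \<and> j < i"
    proof (cases "i \<le> j")
      case True
      then have "j + q - i = (j - i) + q" by simp
      then have "u = (j - i) mod q" by (simp only: u_def mod_add_self2)
      moreover have "(j - i) mod q = j - i" by (rule mod_less) (use ij in simp)
      ultimately show ?thesis using True by (simp only: simp_thms)
    qed (use ij in \<open>simp add: u_def\<close>)
    then have Pj: "P (\<phi> (int j)) = P (\<phi> (int i + int u))"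
    proof
      assume "u = j + q - i \<and> j < i"
      then have "int i + int u = int j + int q" using ij by auto
      then show ?thesis using per by simp
    qed auto
    have 1: "\<phi> (int i) \<le> \<phi> (int i + int u)" by (intro monoD[OF mono]) simp
    have 2: "\<phi> (int i + int u) \<le> F (\<phi> (int i))"
      using monoD[OF mono, of "int i + int u" "int i + int p"] le[of "int i"] u by simp
    show "P (\<phi> (int i)) = P (\<phi> (int j)) \<or> E (P (\<phi> (int i))) (P (\<phi> (int j)))"
    proof (cases "\<phi> (int i) = \<phi> (int i + int u)")
      case True then show ?thesis using Pj by simp
    next
      case False
      then have "cedge n F (\<phi> (int i)) (\<phi> (int i + int u))" unfolding cedge_def using 1 2 by (intro exI[of _ 0]) simp
      then show ?thesis unfolding cedge_F Pj ..
    qed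
  qed
  moreover have "\<exists>a\<in>set [0..<q]. \<exists>b\<in>set [0..<q]. P (\<phi> (int a)) \<noteq> P (\<phi> (int b))" if "has_dcycle (set [0..<q]) (Cnk q p)"
  proof (rule ccontr)
    assume no: "\<not> ?thesis"
    have same: "P (\<phi> (int a)) = P (\<phi> (int b))" if "a < q" "b < q" for a b
    proof (rule ccontr)
      assume "P (\<phi> (int a)) \<noteq> P (\<phi> (int b))"
      moreover have "a \<in> set [0..<q]" "b \<in> set [0..<q]" using that by auto
      ultimately show False using no by blast
    qed
    have "p \<noteq> 0"
    proof
      assume "p = 0"
      then have "\<not> Cnk q p i j" for i j by (auto simp: Cnk_def)
      then show False using that unfolding has_dcycle_def by (metis length_greater_0_conv)
    qed
    \<comment> \<open>If all vertices coincide, every unit step, being shorter than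
      \<open>n\<close>, is 0, against the full turn after \<open>q\<close> steps.\<close>
    have "\<phi> (int i) = \<phi> 0" if "i \<le> q" for i
      using that
    proof (induction i)
      case (Suc i)
      have "i < q" using Suc.prems by simp
      have P: "P (\<phi> (int (Suc i))) = P (\<phi> (int i))"
      proof (cases "Suc i < q")
        case True then show ?thesis using same \<open>i < q\<close> by blast
      next
        case False
        then have "int (Suc i) = 0 + int q" using Suc.prems by simp
        then have "\<phi> (int (Suc i)) = \<phi> 0 + n" using per0 by simp
        then have "P (\<phi> (int (Suc i))) = P (\<phi> 0)" by (simp only: P_shift)
        moreover have "P (\<phi> (int 0)) = P (\<phi> (int i))" using same q \<open>i < q\<close> by blast
        ultimately show ?thesis by simp
      qed
      have "\<phi> (int i) \<le> \<phi> (int (Suc i))" by (intro monoD[OF mono]) simp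
      moreover have "\<phi> (int (Suc i)) \<le> F (\<phi> (int i))"
        using monoD[OF mono, of "int (Suc i)" "int i + int p"] le[of "int i"] \<open>p \<noteq> 0\<close> by simp
      moreover have "F (\<phi> (int i)) < \<phi> (int i) + n" using cycD(8)[OF cyc_F] by simp
      ultimately have "\<phi> (int (Suc i)) = \<phi> (int i)"
        using P P_diff[of "\<phi> (int (Suc i)) - \<phi> (int i)" "\<phi> (int i)"] by (cases "\<phi> (int (Suc i)) = \<phi> (int i)") auto
      then show ?case using Suc by simp
    qed simp
    from this[of q] show False using per0 n_pos by simp
  qed
  ultimately show ?thesis unfolding cyclic_hom_def by blast
qed

text \<open>The orbit points \<open>(F ^^ a) x\<close> with \<open>a < q\<close> are assigned to the
  times \<open>a * p\<close> modulo \<open>q\<close>: \<open>T a\<close> is the step function that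
  moves on to the next lift of \<open>(F ^^ a) x\<close> at those times, and \<open>\<phi>\<close>
  is the largest of them. By construction \<open>T (a + 1) (t + p) = F (T a t)\<close>.\<close>

lemma rot_hom:
  assumes x: "x + int p * n \<le> (F ^^ q) x" and pq: "2 * p < q"
  shows "\<exists>f. cyclic_hom [0..<q] (Cnk q p) vs E f"
proof -
  define T where "T = (\<lambda>a j. (F ^^ a) x + ((j - int a * int p) div int q) * n)"
  define \<phi> where "\<phi> = (\<lambda>j. Max ((\<lambda>a. T a j) ` {..<q}))"
  have q: "0 < q" using pq by simp
  have fin: "finite ((\<lambda>a. T a j) ` {..<q})" "(\<lambda>a. T a j) ` {..<q} \<noteq> {}" for j using q by auto
  have ge: "T a j \<le> \<phi> j" if "a < q" for a j unfolding \<phi>_def using that fin by (intro Max_ge) auto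
  have leI: "\<phi> j \<le> z" if "\<And>a. a < q \<Longrightarrow> T a j \<le> z" for j z unfolding \<phi>_def using that fin by (auto intro!: Max.boundedI)
  have Tq: "T a (j + int q) = T a j + n" for a j
  proof -
    have "j + int q - int a * int p = (j - int a * int p) + int q" by simp
    then have "(j + int q - int a * int p) div int q = (j - int a * int p) div int q + 1"
      using q by (simp only: div_add_self2)
    then show ?thesis by (simp add: T_def algebra_simps)
  qed
  have "mono \<phi>"
  proof (rule monoI)
    fix i j :: int assume ij: "i \<le> j"
    show "\<phi> i \<le> \<phi> j"
    proof (rule leI)
      fix a assume a: "a < q"
      have "(i - int a * int p) div int q \<le> (j - int a * int p) div int q" using ij q by (intro zdiv_mono1) auto
      then have "T a i \<le> T a j" unfolding T_def using n_pos by (simp add: mult_right_mono)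
      then show "T a i \<le> \<phi> j" using ge[OF a, of j] by simp
    qed
  qed
  moreover have "\<phi> (t + int q) = \<phi> t + n" for t
  proof (rule antisym)
    show "\<phi> (t + int q) \<le> \<phi> t + n" by (rule leI) (use Tq ge in auto)
    have "\<phi> t \<le> \<phi> (t + int q) - n"
    proof (rule leI)
      fix a assume "a < q" then show "T a t \<le> \<phi> (t + int q) - n" using ge[of a "t + int q"] Tq[of a t] by simp
    qed
    then show "\<phi> t + n \<le> \<phi> (t + int q)" by simp
  qed
  moreover have "\<phi> (t + int p) \<le> F (\<phi> t)" for t
  proof (rule leI)
    fix a assume a: "a < q"
    have Fsh: "F (y + m * n) = F y + m * n" for y m using cyc_shift[OF cyc_F] by simp
    show "T a (t + int p) \<le> F (\<phi> t)"
    proof (cases a)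
      case 0
      \<comment> \<open>Index 0 has to follow index \<open>q - 1\<close>. This is where the
        assumption on \<open>x\<close> enters: after \<open>q\<close> steps the orbit has passed
        \<open>x + p * n\<close>.\<close>
      define m where "m = (t + int p) div int q"
      have "T a (t + int p) = x + m * n" by (simp add: T_def 0 m_def)
      also have "\<dots> \<le> (F ^^ q) x + (m - int p) * n" using x by (simp add: algebra_simps)
      also have "\<dots> = F ((F ^^ (q - 1)) x + (m - int p) * n)"
      proof -
        have "(F ^^ q) x = F ((F ^^ (q - 1)) x)" using q by (metis Suc_diff_1 funpow.simps(2) comp_apply)
        then show ?thesis using Fsh by simp
      qed
      also have "(F ^^ (q - 1)) x + (m - int p) * n = T (q - 1) t"
      proof -
        have "t - int (q - 1) * int p = (t + int p) + (- int p) * int q" using q by (simp add: of_nat_diff algebra_simps)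
        then have "(t - int (q - 1) * int p) div int q = - int p + (t + int p) div int q" using q by (simp only: div_mult_self1)
        then show ?thesis by (simp add: T_def m_def)
      qed
      also have "F (T (q - 1) t) \<le> F (\<phi> t)" using q by (intro F_mono ge) simp
      finally show ?thesis .
    next
      case (Suc b)
      have "t + int p - int a * int p = t - int b * int p" using Suc by (simp add: algebra_simps)
      then have "T a (t + int p) = (F ^^ a) x + ((t - int b * int p) div int q) * n" unfolding T_def by (simp only:)
      then have "T a (t + int p) = F (T b t)" using Fsh Suc by (simp add: T_def)
      also have "\<dots> \<le> F (\<phi> t)" using a Suc by (intro F_mono ge) simp
      finally show ?thesis .
    qed
  qed
  ultimately show ?thesis using lift_hom[of \<phi> q p] pq by blast
qed

section \<open>Rotation estimates and the winding fraction\<close>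

lemma funpow_ge:
  assumes "x + p * n \<le> (F ^^ q) x" shows "x + int N * p * n \<le> (F ^^ (q * N)) x"
proof (induction N)
  case (Suc N)
  have "x + int (Suc N) * p * n = (x + p * n) + (int N * p) * n" by (simp add: algebra_simps)
  also have "\<dots> \<le> (F ^^ q) x + (int N * p) * n" using assms by simp
  also have "\<dots> = (F ^^ q) (x + (int N * p) * n)" using cyc_funpow(2)[OF cyc_F] by simp
  also have "\<dots> \<le> (F ^^ q) ((F ^^ (q * N)) x)" using Suc by (intro cyc_funpow_mono[OF cyc_F]) auto
  finally show ?case by (simp add: funpow_add)
qed simp

lemma funpow_le:
  assumes "(F ^^ q) x \<le> x + p * n" shows "(F ^^ (q * N)) x \<le> x + int N * p * n"
proof (induction N)
  case (Suc N)
  have "(F ^^ (q * Suc N)) x = (F ^^ q) ((F ^^ (q * N)) x)" by (simp add: funpow_add)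
  also have "\<dots> \<le> (F ^^ q) (x + (int N * p) * n)" using Suc by (intro cyc_funpow_mono[OF cyc_F]) auto
  also have "\<dots> = (F ^^ q) x + (int N * p) * n" using cyc_funpow(2)[OF cyc_F] by simp
  also have "\<dots> \<le> x + p * n + (int N * p) * n" using assms by simp
  finally show ?case by (simp add: algebra_simps)
qed simp

text \<open>In \<open>q * b * N\<close> iterations \<open>x\<close> gains at least
  \<open>b * N * p\<close> turns, and any translate of \<open>y\<close> gains at most
  \<open>q * N * a\<close>. Monotonicity keeps a translate of \<open>y\<close> that starts beyond
  \<open>x\<close> ahead of it, which fails for large \<open>N\<close> if
  \<open>p * b > a * q\<close>.\<close>

lemma rot_compare:
  assumes x: "x + p * n \<le> (F ^^ q) x" and y: "(F ^^ b) y \<le> y + a * n"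
  shows "p * int b \<le> a * int q"
proof (rule ccontr)
  assume "\<not> ?thesis"
  then have gt: "1 \<le> p * int b - a * int q" by simp
  \<comment> \<open>A number of turns that moves \<open>y\<close> past \<open>x\<close>; since
    \<open>n \<ge> 1\<close>, as many as \<open>x - y\<close> suffice.\<close>
  define m where "m = max 0 (x - y)"
  have "m * 1 \<le> m * n" using n_pos by (intro mult_left_mono) (auto simp: m_def)
  then have xy: "x \<le> y + m * n" by (simp add: m_def)
  have "int N \<le> y + m * n - x" for N
  proof -
    have "x + int (b * N) * p * n \<le> (F ^^ (q * (b * N))) x" by (rule funpow_ge[OF x])
    also have "\<dots> \<le> (F ^^ (q * (b * N))) (y + m * n)" by (rule cyc_funpow_mono[OF cyc_F _ _ xy]) auto
    also have "\<dots> = (F ^^ (b * (q * N))) y + m * n" using cyc_funpow(2)[OF cyc_F] by (simp add: ac_simps)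
    also have "\<dots> \<le> y + int (q * N) * a * n + m * n" using funpow_le[OF y, of "q * N"] by simp
    finally have "int N * n * (p * int b - a * int q) \<le> y + m * n - x" by (simp add: algebra_simps)
    moreover have "int N * n * 1 \<le> int N * n * (p * int b - a * int q)" using gt n_pos by (intro mult_left_mono) auto
    moreover have "int N * 1 \<le> int N * n" using n_pos by (intro mult_left_mono) auto
    ultimately show ?thesis by simp
  qed
  from this[of "nat (y + m * n - x) + 1"] show False using xy by simp
qed

abbreviation wfset :: "real set" where
  "wfset \<equiv> {real k / real n | n k. 2 * k < n \<and> (\<exists>f. cyclic_hom [0..<n] (Cnk n k) vs E f)}"

lemma wfset_bdd: "bdd_above wfset"
proof (rule bdd_aboveI)
  fix r assume "r \<in> wfset"
  then obtain q p :: nat where "r = real p / real q" "2 * p < q" by blast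
  then show "r \<le> 1" by (simp add: divide_le_eq)
qed

lemma wf_upper: "2 * p < q \<Longrightarrow> cyclic_hom [0..<q] (Cnk q p) vs E f \<Longrightarrow> real p / real q \<le> winding_fraction vs E"
  unfolding winding_fraction_def by (rule cSup_upper[OF _ wfset_bdd]) blast

lemma wf_gtE:
  assumes "r < winding_fraction vs E"
  obtains p q x where "2 * p < q" "r < real p / real q" "x + int p * n \<le> (F ^^ q) x"
proof -
  \<comment> \<open>The pair \<open>q = 1\<close>, \<open>p = 0\<close> shows that the supremum is
    taken over a non-empty set.\<close>
  have "0 + int 0 * n \<le> (F ^^ 1) 0" using F_ge by simp
  then have "\<exists>f. cyclic_hom [0..<1] (Cnk 1 0) vs E f" by (rule rot_hom) simp
  then have "real 0 / real 1 \<in> wfset" by (intro CollectI exI[of _ 1] exI[of _ 0] conjI) simp_all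
  then have "wfset \<noteq> {}" by blast
  then obtain y where "y \<in> wfset" "r < y" using assms less_cSup_iff[OF _ wfset_bdd] unfolding winding_fraction_def by blast
  then obtain q p f where "r < real p / real q" "2 * p < q" "cyclic_hom [0..<q] (Cnk q p) vs E f" by blast
  then show ?thesis using hom_rot that by blast
qed

text \<open>If the lower inequality fails at a single \<open>x\<close>, \<open>rot_compare\<close>
  bounds every \<open>p/q\<close> by \<open>l/(2l+1)\<close>. If the upper one fails at a single
  \<open>x\<close>, \<open>rot_hom\<close> provides a homomorphism that attains
  \<open>(l+1)/(2l+3)\<close>. The suspension of the cross-polytope is then a wedge with one
  summand.\<close>

lemma odd_sphere:
  assumes "real l / real (2 * l + 1) < winding_fraction vs E" "winding_fraction vs E < real (l + 1) / real (2 * l + 3)"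
  shows "clique_complex_space (set vs) E homotopy_equivalent_space nsphere (2 * l + 1)"
proof -
  have A: "x + int l * n < (F ^^ (2 * l + 1)) x" for x
  proof (rule ccontr)
    assume "\<not> ?thesis"
    then have y: "(F ^^ (2 * l + 1)) x \<le> x + int l * n" by simp
    obtain p q z where pq: "2 * p < q" "real l / real (2 * l + 1) < real p / real q" "z + int p * n \<le> (F ^^ q) z"
      by (rule wf_gtE[OF assms(1)])
    have "int p * int (2 * l + 1) \<le> int l * int q" by (rule rot_compare[OF pq(3) y])
    then have "real_of_int (int p * int (2 * l + 1)) \<le> real_of_int (int l * int q)" by (simp only: of_int_le_iff)
    then have "real p * real (2 * l + 1) \<le> real l * real q" by (simp only: of_int_mult of_int_of_nat_eq)
    then have "real p / real q \<le> real l / real (2 * l + 1)" using pq(1) by (simp add: divide_simps mult.commute)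
    then show False using pq(2) by simp
  qed
  have B: "(F ^^ (2 * l + 3)) x < x + (int l + 1) * n" for x
  proof (rule ccontr)
    assume "\<not> ?thesis"
    then have "x + int (l + 1) * n \<le> (F ^^ (2 * l + 3)) x" by (simp add: algebra_simps)
    then obtain f where "cyclic_hom [0..<2 * l + 3] (Cnk (2 * l + 3) (l + 1)) vs E f" using rot_hom by force
    then have "real (l + 1) / real (2 * l + 3) \<le> winding_fraction vs E" by (intro wf_upper) auto
    then show False using assms(2) by simp
  qed
  have "clique_complex_space {0..<n} (cedge n F) homotopy_equivalent_space clique_complex_space (join_verts 2 (2 * l + 1)) join_adj"
    using cyc_odd_sphere[OF cyc_F A B] by simp
  note homotopy_eqv_trans[OF space_equiv this]
  also have "clique_complex_space (join_verts 2 (2 * l + 1)) join_adj homotopy_equivalent_space wedge_spheres 1 (2 * l + 1)"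
    using join_homotopy_equivalent_wedge[of 1 "2 * l + 1"] unfolding Suc_1 .
  also note wedge_one_homotopy_equivalent_nsphere
  finally show ?thesis .
qed

end

lemma Cnk_cedge:
  assumes ij: "i < n" "j < n" and k: "2 * k < n"
  shows "Cnk n k i j \<longleftrightarrow> cedge (int n) (\<lambda>x. x + int k) (int i) (int j)"
proof -
  define u where "u = (int j - int i) mod int n"
  have n: "0 < int n" using ij by simp
  have u: "0 \<le> u" "u < int n" using n by (auto simp: u_def)
  have "int ((j + n - i) mod n) = (int j + int n - int i) mod int n" using ij by (simp add: zmod_int of_nat_diff)
  also have "\<dots> = ((int j - int i) + int n) mod int n" by (simp add: algebra_simps)
  also have "\<dots> = u" by (simp add: u_def)
  finally have "Cnk n k i j \<longleftrightarrow> 0 < u \<and> u \<le> int k" using ij by (auto simp: Cnk_def)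
  moreover have "0 < u \<and> u \<le> int k \<longleftrightarrow> cedge (int n) (\<lambda>x. x + int k) (int i) (int j)"
  proof
    assume "0 < u \<and> u \<le> int k"
    moreover have "int j + (- ((int j - int i) div int n)) * int n = int i + u"
      by (simp add: u_def minus_div_mult_eq_mod[symmetric] algebra_simps)
    ultimately show "cedge (int n) (\<lambda>x. x + int k) (int i) (int j)" unfolding cedge_def
      by (intro exI[of _ "- ((int j - int i) div int n)"]) simp
  next
    assume "cedge (int n) (\<lambda>x. x + int k) (int i) (int j)"
    then obtain m where m: "int i < int j + m * int n" "int j + m * int n \<le> int i + int k" unfolding cedge_def by blast
    have "u = (int j - int i + m * int n) mod int n" by (simp add: u_def)
    also have "\<dots> = int j - int i + m * int n" using m k by (intro mod_pos_pos_trivial) auto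
    finally show "0 < u \<and> u \<le> int k" using m by simp
  qed
  ultimately show ?thesis by simp
qed

context cgraph begin

section \<open>Dismantlings seen through the periodic map\<close>

definition pos :: "'a list \<Rightarrow> int set" where "pos ws = {x. P x \<in> set ws}"

lemma pos_periodic: "\<forall>x. x + n \<in> pos ws \<longleftrightarrow> x \<in> pos ws" by (simp add: pos_def)

lemma filter_indices:
  assumes ws: "ws = filter (\<lambda>v. v \<in> set ws) vs"
  obtains js where "sorted_wrt (<) js" "length js = length ws" "set js = {j. j < length vs \<and> vs ! j \<in> set ws}"
    "\<forall>a<length ws. js ! a < length vs \<and> vs ! (js ! a) = ws ! a"
proof -
  define js where "js = filter (\<lambda>j. vs ! j \<in> set ws) [0..<length vs]"
  have "map ((!) vs) js = filter (\<lambda>v. v \<in> set ws) (map ((!) vs) [0..<length vs])"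
    unfolding js_def filter_map by (simp add: comp_def)
  then have m: "map ((!) vs) js = ws" using ws by (simp add: map_nth)
  have len: "length js = length ws" using arg_cong[OF m, of length] by simp
  have set: "set js = {j. j < length vs \<and> vs ! j \<in> set ws}" by (auto simp: js_def)
  have "js ! a < length vs \<and> vs ! (js ! a) = ws ! a" if "a < length ws" for a
  proof -
    have "js ! a \<in> set js" using that len by simp
    moreover have "map ((!) vs) js ! a = ws ! a" using m by simp
    ultimately show ?thesis using that len set by simp
  qed
  moreover have "sorted_wrt (<) js" unfolding js_def by (intro sorted_wrt_filter) simp
  ultimately show ?thesis using that len set by blast
qed

lemma enum_pos:
  assumes ws: "ws = filter (\<lambda>v. v \<in> set ws) vs" "ws \<noteq> []"
  obtains e where "strict_mono e" "range e = pos ws" "\<forall>i. e (i + int (length ws)) = e i + n"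
    "\<forall>a<length ws. P (e (int a)) = ws ! a"
proof -
  obtain js where js: "sorted_wrt (<) js" "length js = length ws" "set js = {j. j < length vs \<and> vs ! j \<in> set ws}"
    "\<forall>a<length ws. js ! a < length vs \<and> vs ! (js ! a) = ws ! a"
    by (rule filter_indices[OF ws(1)])
  define xs where "xs = map int js"
  have xs: "sorted_wrt (<) xs" using js(1) by (simp add: xs_def sorted_wrt_map)
  have set: "set xs = residues n (pos ws)"
  proof (intro equalityI subsetI)
    fix x assume "x \<in> set xs"
    then obtain j where "x = int j" "j < length vs" "vs ! j \<in> set ws" using js(3) by (auto simp: xs_def)
    then show "x \<in> residues n (pos ws)" using P_nat[of j] by (simp add: pos_def n_def)
  next
    fix x assume x: "x \<in> residues n (pos ws)"
    then have "nat x < length vs" "vs ! nat x \<in> set ws" by (auto simp: pos_def P_def n_def)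
    then have "nat x \<in> set js" using js(3) by simp
    moreover have "x = int (nat x)" using x by simp
    ultimately show "x \<in> set xs" unfolding xs_def by (metis image_eqI list.set_map)
  qed
  have ne: "xs \<noteq> []" using js(2) ws(2) by (auto simp: xs_def)
  have len: "length xs = length ws" using js(2) by (simp add: xs_def)
  define e where "e = (\<lambda>i. xs ! nat (i mod int (length xs)) + (i div int (length xs)) * n)"
  have E: "strict_mono e" "range e = pos ws" "\<And>i. e (i + int (length xs)) = e i + n" "\<And>a. a < length xs \<Longrightarrow> e (int a) = xs ! a"
    unfolding e_def by (fact periodic_enum[OF n_pos pos_periodic xs set ne])+
  have "P (e (int a)) = ws ! a" if "a < length ws" for a
  proof -
    have "e (int a) = int (js ! a)" using E(4)[of a] that len js(2) by (simp add: xs_def)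
    then show ?thesis using P_nat[of "js ! a"] js(4) that by simp
  qed
  then show ?thesis using that[OF E(1,2)] E(3) len by auto
qed

text \<open>Dismantling deletes only vertices that are not values of \<open>F\<close> on the current
  set. Hence the original \<open>F\<close> remains a self-map of what is left and no restricted map
  is needed.\<close>

definition dism_inv :: "'a list \<Rightarrow> bool" where
  "dism_inv ws \<longleftrightarrow> ws = filter (\<lambda>v. v \<in> set ws) vs \<and> ws \<noteq> [] \<and> cyc n (pos ws) F \<and>
     strong_collapse (cedge n F) {0..<n} (residues n (pos ws))"

lemma dism_inv_vs: "dism_inv vs"
proof -
  have "pos vs = UNIV" using P_in by (auto simp: pos_def)
  then show ?thesis unfolding dism_inv_def using ne cyc_F by (simp add: strong_collapse_refl)
qed

text \<open>A dominated vertex \<open>x\<close> with successor \<open>y\<close> is not a value of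
  \<open>F\<close>. Suppose \<open>x = F z\<close>. The edge from \<open>x\<close> to
  \<open>y\<close> excludes \<open>z = x\<close>. Otherwise domination gives an edge from
  \<open>z\<close> to \<open>y\<close>, so a lift of \<open>y\<close> lies after \<open>z\<close>
  and not after \<open>x\<close>; as \<open>y\<close> itself comes after \<open>x\<close>, that lift
  is at most \<open>y - n\<close>. Then \<open>z + n \<le> F z\<close>, which is impossible.\<close>

lemma dism_inv_step:
  assumes inv: "dism_inv ws" and st: "dismantle_step E ws us"
  shows "dism_inv us"
proof -
  let ?V = "pos ws" and ?m = "length ws"
  have ws: "ws = filter (\<lambda>v. v \<in> set ws) vs" "ws \<noteq> []" and c: "cyc n ?V F"
    and sc: "strong_collapse (cedge n F) {0..<n} (residues n ?V)"
    using inv by (auto simp: dism_inv_def)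
  have dw: "distinct ws" using ws(1) dist by (metis distinct_filter)
  obtain i where dom: "dominated ws E i" and us: "us = take i ws @ drop (Suc i) ws" using st unfolding dismantle_step_def by blast
  have i: "i < ?m" and nb: "in_nbhd ws E (ws ! ((i + 1) mod ?m)) = insert (ws ! i) (in_nbhd ws E (ws ! i))"
    using dom by (auto simp: dominated_def)
  obtain e where e: "strict_mono e" "range e = ?V" "\<forall>i. e (i + int ?m) = e i + n" "\<forall>a<?m. P (e (int a)) = ws ! a"
    by (rule enum_pos[OF ws])
  have eN: "e (t + u * int ?m) = e t + u * n" for t u by (rule strict_mono_shift[where e = e]) (use e(3) in blast)
  have elt: "e a < e b \<longleftrightarrow> a < b" "e a \<le> e b \<longleftrightarrow> a \<le> b" for a b
    using strict_mono_less[OF e(1)] strict_mono_less_eq[OF e(1)] by auto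
  have m: "0 < int ?m" using i by linarith
  define x where "x = e (int i)"
  define y where "y = e (int i + 1)"
  have xV: "x \<in> ?V" using e(2) by (auto simp: x_def)
  have Px: "P x = ws ! i" using e(4) i by (simp add: x_def)
  have Py: "P y = ws ! ((i + 1) mod ?m)"
  proof (cases "i + 1 < ?m")
    case True
    then have "P (e (int (i + 1))) = ws ! (i + 1)" using e(4) by blast
    then show ?thesis using True by (simp add: y_def add.commute)
  next
    case False
    then have "?m = i + 1" using i by simp
    then have "y = e 0 + n" using e(3)[rule_format, of 0] by (simp add: y_def add.commute)
    then have "P y = P (e (int 0))" by simp
    also have "\<dots> = ws ! 0" by (rule e(4)[rule_format]) (use m in linarith)
    finally show ?thesis using \<open>?m = i + 1\<close> by simp
  qed
  have exy: "cedge n F x y"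
  proof -
    have "ws ! i \<in> in_nbhd ws E (ws ! ((i + 1) mod ?m))" using nb by simp
    then show ?thesis unfolding cedge_F Px Py by (simp add: in_nbhd_def)
  qed
  have xF: "x \<notin> F ` ?V"
  proof
    assume "x \<in> F ` ?V"
    then obtain z where z: "z \<in> ?V" "x = F z" by blast
    then obtain j where j: "z = e j" using e(2) by blast
    show False
    proof (cases "z = x")
      case True
      then have "F x = x" using z by simp
      then show False using exy unfolding cedge_def by auto
    next
      case False
      then have "z < x" using cycD(5)[OF c z(1)] z(2) by simp
      then have "cedge n F z x" unfolding cedge_def using z(2) by (intro exI[of _ 0]) simp
      then have "P z \<in> in_nbhd ws E (ws ! i)" using z(1) unfolding cedge_F Px by (simp add: in_nbhd_def pos_def)
      then have "P z \<in> in_nbhd ws E (P y)" using nb Py by simp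
      then have "cedge n F z y" unfolding cedge_F by (simp add: in_nbhd_def)
      then obtain t where t: "z < y + t * n" "y + t * n \<le> x" unfolding cedge_def z(2)[symmetric] by blast
      have yt: "y + t * n = e (int i + 1 + t * int ?m)" using eN by (simp add: y_def)
      have 1: "int i + 1 + t * int ?m \<le> int i" using t(2) unfolding yt x_def elt(2) .
      have 2: "j < int i + 1 + t * int ?m" using t(1) unfolding yt j elt(1) .
      have "t \<le> -1"
      proof (rule ccontr)
        assume "\<not> t \<le> -1"
        then have "0 \<le> t * int ?m" by simp
        then show False using 1 by simp
      qed
      then have "t * int ?m \<le> -1 * int ?m" by (intro mult_right_mono) auto
      then have "j + int ?m \<le> int i" using 2 by simp
      then have "e (j + int ?m) \<le> x" unfolding x_def elt(2) .
      then have "z + n \<le> F z" using e(3) j z(2) by simp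
      then show False using cycD(8)[OF c z(1)] by simp
    qed
  qed
  have split: "ws = take i ws @ ws ! i # drop (Suc i) ws" using i by (rule id_take_nth_drop)
  have "distinct (take i ws @ ws ! i # drop (Suc i) ws)" using dw split by simp
  then have ni: "ws ! i \<notin> set us" unfolding us by auto
  have "set ws = insert (ws ! i) (set us)" using arg_cong[OF split, of set] unfolding us by simp
  then have su: "set us = set ws - {ws ! i}" using ni by blast
  have fil: "us = filter (\<lambda>v. v \<in> set us) vs"
  proof -
    have "filter (\<lambda>v. v \<in> set us) vs = filter (\<lambda>v. v \<noteq> ws ! i) (filter (\<lambda>v. v \<in> set ws) vs)"
      unfolding su filter_filter by (rule filter_cong) auto
    also have "\<dots> = filter (\<lambda>v. v \<noteq> ws ! i) ws" using ws(1) by simp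
    also have "\<dots> = filter (\<lambda>v. v \<noteq> ws ! i) (take i ws @ ws ! i # drop (Suc i) ws)" using split by simp
    also have "\<dots> = filter (\<lambda>v. v \<noteq> ws ! i) us" unfolding us by simp
    also have "\<dots> = us" using ni by (intro filter_True) auto
    finally show ?thesis by simp
  qed
  have sub: "pos us \<subseteq> ?V" unfolding pos_def su by auto
  have Fsub: "F ` ?V \<subseteq> pos us"
  proof
    fix w assume "w \<in> F ` ?V"
    then have wV: "w \<in> ?V" and wF: "w \<in> F ` ?V" using cycD(4)[OF c] by auto
    have "P w \<noteq> ws ! i"
    proof
      assume "P w = ws ! i"
      then have "w mod n = x mod n" using Px P_eq[of w x] by simp
      then have "x \<in> F ` ?V" using wF mod_mem[OF cycD(3)[OF cyc_image(1)[OF c]]] by metis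
      then show False using xF by blast
    qed
    then show "w \<in> pos us" using wV su by (simp add: pos_def)
  qed
  have c': "cyc n (pos us) F" by (rule cyc_subset[OF c sub Fsub pos_periodic])
  moreover have "us \<noteq> []" using cycD(2)[OF c'] by (auto simp: pos_def)
  moreover have "strong_collapse (cedge n F) {0..<n} (residues n (pos us))"
    using strong_collapse_trans[OF cyc_collapse[OF c sub Fsub pos_periodic] sc] .
  ultimately show ?thesis unfolding dism_inv_def using fil by blast
qed

lemma dism_inv_dismantles: "dismantles vs E ws \<Longrightarrow> dism_inv ws"
  unfolding dismantles_def
  by (induction rule: rtranclp_induct) (use dism_inv_vs dism_inv_step in blast)+

text \<open>The isomorphism determines the winding fraction: its inverse is a homomorphism from
  \<open>C_N^k\<close>, whence \<open>k/N\<close> is a lower bound, and on the lift of this inverse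
  \<open>F\<close> advances by no more than \<open>k\<close> positions, which makes it an upper
  bound. So \<open>k/N = l/(2l+1)\<close>, the hypothesis of \<open>circulant_wedge\<close>.\<close>

lemma even_spheres:
  assumes wf: "winding_fraction vs E = real l / real (2 * l + 1)" and dis: "dismantles_to_Cnk vs E N k"
  shows "clique_complex_space (set vs) E homotopy_equivalent_space wedge_spheres (N - 2 * k - 1) (2 * l)"
proof -
  obtain ws f where "dismantles vs E ws" and kN: "2 * k < N" and bij: "bij_betw f (set ws) {0..<N}"
    and mon: "cyclic_monotone ws [0..<N] f" and edge: "\<forall>v\<in>set ws. \<forall>w\<in>set ws. E v w \<longleftrightarrow> Cnk N k (f v) (f w)"
    using dis unfolding dismantles_to_Cnk_def iso_Cnk_def by blast
  then have "dism_inv ws" using dism_inv_dismantles by blast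
  then have ws: "ws = filter (\<lambda>v. v \<in> set ws) vs" "ws \<noteq> []" and c: "cyc n (pos ws) F"
    and sc: "strong_collapse (cedge n F) {0..<n} (residues n (pos ws))" by (auto simp: dism_inv_def)
  have wsvs: "set ws \<subseteq> set vs" using arg_cong[OF ws(1), of set] by auto
  define g where "g = inv_into (set ws) f"
  have g: "g i \<in> set ws" "f (g i) = i" if "i < N" for i
  proof -
    have "i \<in> f ` set ws" using bij that by (simp add: bij_betw_def)
    then show "g i \<in> set ws" "f (g i) = i" unfolding g_def by (rule inv_into_into, rule f_inv_into_f)
  qed
  have gf: "g (f v) = v" if "v \<in> set ws" for v using bij that by (simp add: g_def bij_betw_def)
  have fN: "f v < N" if "v \<in> set ws" for v using bij that by (auto simp: bij_betw_def)
  have ginj: "g i = g j \<longleftrightarrow> i = j" if "i < N" "j < N" for i j using g(2) that by metis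
  have gE: "E (g i) (g j) \<longleftrightarrow> Cnk N k i j" if "i < N" "j < N" for i j using edge g that by simp
  \<comment> \<open>The isomorphism is cyclic monotone with respect to \<open>ws\<close>. As
    \<open>ws\<close> lists its elements in the order of \<open>vs\<close>, cyclic triples of
    \<open>ws\<close> remain cyclic triples in \<open>vs\<close>.\<close>
  have up: "ctri vs a b d" if tri: "ctri ws a b d" for a b d
  proof -
    obtain js where js: "sorted_wrt (<) js" "length js = length ws" "set js = {j. j < length vs \<and> vs ! j \<in> set ws}"
      "\<forall>a<length ws. js ! a < length vs \<and> vs ! (js ! a) = ws ! a"
      by (rule filter_indices[OF ws(1)])
    obtain i j h where ijh: "i < length ws" "j < length ws" "h < length ws" "ws ! i = a" "ws ! j = b" "ws ! h = d" "cbetw i j h"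
      using tri unfolding ctri_def by blast
    have lt: "js ! p < js ! q" if "p < q" "q < length ws" for p q using sorted_wrt_nth_less[OF js(1) that(1)] that js(2) by simp
    have "cbetw (js ! i) (js ! j) (js ! h)"
      using ijh(7) lt ijh(1-3) unfolding cbetw_def by blast
    then show ?thesis unfolding ctri_def using js(4) ijh by blast
  qed
  have gmon: "cyclic_monotone [0..<N] vs g"
    unfolding cyclic_monotone_def
  proof (intro conjI ballI impI)
    show "g ` set [0..<N] \<subseteq> set vs" using g(1) wsvs by auto
  next
    fix t assume "t \<in> set vs"
    show "subinterval [0..<N] {s \<in> set [0..<N]. g s = t}"
    proof (rule subinterval_convex)
      fix a b d assume abd: "a \<in> {s \<in> set [0..<N]. g s = t}" "d \<in> {s \<in> set [0..<N]. g s = t}" "a \<le> b" "b \<le> d"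
      then have "a = d" using ginj by auto
      then show "b \<in> {s \<in> set [0..<N]. g s = t}" using abd by simp
    qed auto
  next
    fix a b d assume abd: "a \<in> set [0..<N]" "b \<in> set [0..<N]" "d \<in> set [0..<N]" and tri: "ctri vs (g a) (g b) (g d)"
    have anti: "\<not> ctri vs u w v" if t: "ctri vs u v w" for u v w
    proof -
      have "u \<in> set vs" "v \<in> set vs" "w \<in> set vs" using t unfolding ctri_def by auto
      then obtain x y z where "P x = u" "P y = v" "P z = w" using P_surj by metis
      then show ?thesis using t ctri_P cbetw_antisym by metis
    qed
    have "cbetw a b d"
    proof (rule ccontr)
      assume "\<not> cbetw a b d"
      moreover have gne: "g a \<noteq> g b \<and> g b \<noteq> g d \<and> g a \<noteq> g d"
      proof -
        obtain i j h where ijh: "i < length vs" "j < length vs" "h < length vs" "vs ! i = g a" "vs ! j = g b" "vs ! h = g d" "cbetw i j h"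
          using tri unfolding ctri_def by blast
        show ?thesis using cbetw_distinct[OF ijh(7)] nth_eq_iff_index_eq[OF dist ijh(1,2)]
          nth_eq_iff_index_eq[OF dist ijh(2,3)] nth_eq_iff_index_eq[OF dist ijh(1,3)] ijh(4-6) by simp
      qed
      moreover have "a \<noteq> b" "b \<noteq> d" "a \<noteq> d" using gne by auto
      ultimately have "cbetw a d b" using cbetw_total by blast
      then have "ctri [0..<N] (f (g a)) (f (g d)) (f (g b))" using abd g(2) by (simp add: ctri_upt)
      then have "ctri ws (g a) (g d) (g b)" using mon abd g(1) unfolding cyclic_monotone_def by simp
      then show False using up anti[OF tri] by blast
    qed
    then show "ctri [0..<N] a b d" using abd by (simp add: ctri_upt)
  qed
  have hom: "cyclic_hom [0..<N] (Cnk N k) vs E g"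
    unfolding cyclic_hom_def
  proof (intro conjI impI)
    show "graph_hom (Cnk N k) E g" unfolding graph_hom_def using gE by (auto simp: Cnk_def)
    assume "has_dcycle (set [0..<N]) (Cnk N k)"
    then obtain cs where "cs \<noteq> []" "\<forall>i<length cs. Cnk N k (cs ! i) (cs ! ((i + 1) mod length cs))"
      unfolding has_dcycle_def by blast
    then obtain i j where ij: "Cnk N k i j" by (metis length_greater_0_conv)
    then have "i < N" "j < N" "i \<noteq> j" by (auto simp: Cnk_def)
    then show "\<exists>a\<in>set [0..<N]. \<exists>b\<in>set [0..<N]. g a \<noteq> g b" using ginj by (intro bexI[of _ i] bexI[of _ j]) auto
  qed (rule gmon)
  have ge: "real k / real N \<le> real l / real (2 * l + 1)" using wf_upper[OF kN hom] wf by simp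
  have "\<exists>y. (F ^^ N) y \<le> y + int k * n"
  \<comment> \<open>For \<open>N = 1\<close> the map \<open>g\<close> is constant and has no lift;
    the single remaining vertex is fixed by \<open>F\<close>.\<close>
  proof (cases "N = 1")
    case True
    then have k0: "k = 0" using kN by simp
    have "f v = 0" if "v \<in> set ws" for v using fN[OF that] True by simp
    then have one: "v = w" if "v \<in> set ws" "w \<in> set ws" for v w using gf that by metis
    obtain y where y: "y \<in> pos ws" using cycD(2)[OF c] by blast
    have "P (F y) = P y" using cycD(4)[OF c y] y by (intro one) (auto simp: pos_def)
    then have "F y = y" using cycD(5,8)[OF c y] P_diff[of "F y - y" y] by (cases "F y = y") auto
    then show ?thesis using True k0 by (intro exI[of _ y]) simp
  next
    case False
    then have N2: "0 < N" "1 < N" using kN by auto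
    have "g 0 \<noteq> g 1" using ginj N2 by simp
    obtain \<phi> where phi: "mono \<phi>" "\<forall>t. \<phi> (t + int N) = \<phi> t + n" "\<forall>t. P (\<phi> t) = g (nat (t mod int N))"
      by (rule hom_lift[OF gmon N2 \<open>g 0 \<noteq> g 1\<close>])
    have per: "\<phi> (t + m * int N) = \<phi> t + m * n" for t m by (rule per_mult) (rule phi(2))
    have iN: "nat (t mod int N) < N" for t using N2 by (simp add: nat_less_iff)
    have phiV: "\<phi> t \<in> pos ws" for t using phi(3) g(1)[OF iN] by (simp add: pos_def)
    \<comment> \<open>Every vertex of \<open>pos ws\<close> is a value of \<open>\<phi>\<close>, so
      a larger \<open>F (\<phi> t)\<close> would be \<open>\<phi> t'\<close> with
      \<open>t + k < t' < t + N\<close>, giving an edge of \<open>C_N^k\<close> of length more than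
      \<open>k\<close>.\<close>
    have le: "F (\<phi> t) \<le> \<phi> (t + int k)" for t
    proof (rule ccontr)
      assume "\<not> ?thesis"
      then have gt: "\<phi> (t + int k) < F (\<phi> t)" by simp
      have "P (F (\<phi> t)) \<in> set ws" using cycD(4)[OF c phiV] by (simp add: pos_def)
      then obtain j where j: "j < N" "P (F (\<phi> t)) = g j" using gf fN by metis
      have "P (\<phi> (int j)) = P (F (\<phi> t))" using phi(3) j by simp
      then have "n dvd F (\<phi> t) - \<phi> (int j)" by (metis P_eq mod_eq_dvd_iff)
      then obtain m where "F (\<phi> t) - \<phi> (int j) = n * m" by (rule dvdE)
      then have Ft: "F (\<phi> t) = \<phi> (int j + m * int N)" using per by (simp add: mult.commute)
      define t' where "t' = int j + m * int N"
      have 1: "t + int k < t'"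
      proof (rule ccontr)
        assume "\<not> t + int k < t'"
        then have "\<phi> t' \<le> \<phi> (t + int k)" by (intro monoD[OF phi(1)]) simp
        then show False using gt Ft by (simp add: t'_def)
      qed
      have 2: "t' < t + int N"
      proof (rule ccontr)
        assume "\<not> t' < t + int N"
        then have "\<phi> (t + int N) \<le> \<phi> t'" by (intro monoD[OF phi(1)]) simp
        then show False using phi(2) Ft cycD(8)[OF c phiV, of t] by (simp add: t'_def)
      qed
      have "\<phi> t \<le> \<phi> (t + int k)" by (intro monoD[OF phi(1)]) simp
      then have "cedge n F (\<phi> t) (\<phi> t')" unfolding cedge_def using gt Ft by (intro exI[of _ 0]) (simp add: t'_def)
      then have "E (g (nat (t mod int N))) (g (nat (t' mod int N)))" unfolding cedge_F using phi(3) by simp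
      then have "Cnk N k (nat (t mod int N)) (nat (t' mod int N))" using gE iN by simp
      then have "cedge (int N) (\<lambda>x. x + int k) (t mod int N) (t' mod int N)"
        using Cnk_cedge[OF iN iN kN] N2 by simp
      then obtain u where u: "t mod int N < t' mod int N + u * int N" "t' mod int N + u * int N \<le> t mod int N + int k"
        unfolding cedge_def by blast
      define w where "w = u + t div int N - t' div int N"
      have tt: "t = t mod int N + (t div int N) * int N" "t' = t' mod int N + (t' div int N) * int N" by simp_all
      have "w * int N = u * int N + (t div int N) * int N - (t' div int N) * int N" by (simp add: w_def algebra_simps)
      then have w: "t < t' + w * int N" "t' + w * int N \<le> t + int k" using u tt by linarith+
      have "w \<noteq> 0" using w(2) 1 by auto
      moreover have "w < 1"
      proof (rule ccontr)
        assume "\<not> w < 1"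
        then have "1 * int N \<le> w * int N" by (intro mult_right_mono) auto
        then show False using w(2) 1 by simp
      qed
      ultimately have "w \<le> -1" by simp
      then have "w * int N \<le> -1 * int N" by (intro mult_right_mono) auto
      then show False using w(1) 2 by simp
    qed
    have "(F ^^ m) (\<phi> 0) \<le> \<phi> (int m * int k)" for m
    proof (induction m)
      case (Suc m)
      have "(F ^^ Suc m) (\<phi> 0) \<le> F (\<phi> (int m * int k))" using F_mono[OF Suc] by simp
      also have "\<dots> \<le> \<phi> (int m * int k + int k)" by (rule le)
      also have "int m * int k + int k = int (Suc m) * int k" by (simp add: algebra_simps)
      finally show ?case .
    qed simp
    from this[of N] show ?thesis using per[of 0 "int k"] by (intro exI[of _ "\<phi> 0"]) (simp add: mult.commute)
  qed
  then obtain y where y: "(F ^^ N) y \<le> y + int k * n" by blast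
  have le: "real l / real (2 * l + 1) \<le> real k / real N"
  proof (rule ccontr)
    assume "\<not> ?thesis"
    then have "real k / real N < winding_fraction vs E" using wf by simp
    then obtain p q x where pq: "2 * p < q" "real k / real N < real p / real q" "x + int p * n \<le> (F ^^ q) x"
      by (rule wf_gtE)
    have "int p * int N \<le> int k * int q" by (rule rot_compare[OF pq(3) y])
    then have "real_of_int (int p * int N) \<le> real_of_int (int k * int q)" by (simp only: of_int_le_iff)
    then have "real p * real N \<le> real k * real q" by (simp only: of_int_mult of_int_of_nat_eq)
    then have "real p / real q \<le> real k / real N" using pq(1) kN by (simp add: divide_simps mult.commute)
    then show False using pq(2) by simp
  qed
  have "real k / real N = real l / real (2 * l + 1)" using ge le by simp
  then have "real (k * (2 * l + 1)) = real (l * N)" using kN by (simp add: field_simps)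
  then have "k * (2 * l + 1) = l * N" using of_nat_eq_iff by blast
  then have "int (k * (2 * l + 1)) = int (l * N)" by simp
  then have rot: "(2 * int l + 1) * int k = int l * int N" by (simp add: algebra_simps)
  have "clique_complex_space {0..<n} (cedge n F) homotopy_equivalent_space clique_complex_space (residues n (pos ws)) (cedge n F)"
    by (rule strong_collapse_equiv[OF sc]) simp
  note homotopy_eqv_trans[OF space_equiv this]
  also have "clique_complex_space (residues n (pos ws)) (cedge n F) homotopy_equivalent_space
      clique_complex_space {0..<int N} (cedge (int N) (\<lambda>x. x + int k))"
  proof (rule clique_complex_iso[of "\<lambda>x. int (f (P x))"])
    have 1: "bij_betw P (residues n (pos ws)) (set ws)"
    proof -
      have "inj_on P (residues n (pos ws))" by (rule inj_onI) (simp add: P_eq)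
      moreover have "P ` residues n (pos ws) = set ws"
      proof (intro equalityI subsetI)
        fix v assume v: "v \<in> set ws"
        then obtain x where "0 \<le> x" "x < n" "P x = v" using P_surj wsvs by blast
        then show "v \<in> P ` residues n (pos ws)" using v by (intro image_eqI[of _ _ x]) (auto simp: pos_def)
      qed (auto simp: pos_def)
      ultimately show ?thesis by (simp add: bij_betw_def)
    qed
    have 2: "bij_betw int {0..<N} {0..<int N}"
      by (rule bij_betwI[where g = nat]) auto
    have "bij_betw (int \<circ> (f \<circ> P)) (residues n (pos ws)) {0..<int N}"
      by (rule bij_betw_trans[OF bij_betw_trans[OF 1 bij] 2])
    then show "bij_betw (\<lambda>x. int (f (P x))) (residues n (pos ws)) {0..<int N}" by (simp add: comp_def)
    fix u v assume "u \<in> residues n (pos ws)" "v \<in> residues n (pos ws)"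
    then have uv: "P u \<in> set ws" "P v \<in> set ws" by (auto simp: pos_def)
    then show "cedge n F u v \<or> cedge n F v u \<longleftrightarrow>
       cedge (int N) (\<lambda>x. x + int k) (int (f (P u))) (int (f (P v))) \<or> cedge (int N) (\<lambda>x. x + int k) (int (f (P v))) (int (f (P u)))"
      unfolding cedge_F using edge Cnk_cedge[OF fN fN kN] by auto
  qed simp
  also have "clique_complex_space {0..<int N} (cedge (int N) (\<lambda>x. x + int k)) homotopy_equivalent_space
      wedge_spheres (nat (int N - 2 * int k - 1)) (2 * l)"
    by (rule circulant_wedge) (use kN rot in auto)
  also have "nat (int N - 2 * int k - 1) = N - 2 * k - 1" by simp
  finally show ?thesis .
qed

end

theorem theorem4p4:
  fixes vs :: "'a list" and E :: "'a \<Rightarrow> 'a \<Rightarrow> bool"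
  assumes "cyclic_graph vs E"
    and "vs \<noteq> []"
  shows "(\<forall>l::nat. real l / real (2*l+1) < winding_fraction vs E \<and>
                   winding_fraction vs E < real (l+1) / real (2*l+3) \<longrightarrow>
            clique_complex_space (set vs) E homotopy_equivalent_space nsphere (2*l+1))
       \<and> (\<forall>(l::nat) n k. winding_fraction vs E = real l / real (2*l+1) \<and>
                   dismantles_to_Cnk vs E n k \<longrightarrow>
            clique_complex_space (set vs) E homotopy_equivalent_space
              wedge_spheres (n - 2*k - 1) (2*l))"
proof -
  interpret cgraph vs E by unfold_locales (fact assms)+
  show ?thesis using odd_sphere even_spheres by blast
qed

end
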